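(* Consider an initial generalized torus seed $\mathbf{s} = \{ (e_i,(a_{i,j})) \}$, which defines the usual set of dual vectors $\{ f_i = d_i^{-1}e_i^* \}$. If $\mathbf{s}'$ is a mutation equivalent generalized torus seed, then the $i$-th coordinates of the $g$-vectors for the cluster variables in $\mathbf{s}'$ are either all non-negative or all non-positive when expressed in the basis $\{ f_1, \dots, f_n \}$.
   Context: Let $k$ be a field of characteristic zero and $R=k[a_{i,j}]$ with formal variables $a_{i,j}$. Generalized fixed data: lattice $N$ with skew-symmetric form $\{\cdot,\cdot\}$, sublattice $N^\circ$ with basis $\{d_ie_i\}$, $M=\mathrm{Hom}(N,\mathbb{Z})$ with dual basis $\{e_i^*\}$, $M^\circ$ with basis $\{f_i=d_i^{-1}e_i^*\}$, positive integers $r_i$, formal variables $a_{i,j}$ with reciprocity $a_{i,j}=a_{i,r_i-j}$, and the injectivity assumption. Generalized mutation in direction $k$ sends $e_i\mapsto e_i+r_k[\epsilon_{ik}]_+e_k$ ($i\ne k$), $e_k\mapsto -e_k$, where $\epsilon_{ij}=\{e_i,e_j\}d_j$. The $g$-vector of a cluster monomial of the generalized $\mathcal{A}$ cluster variety with respect to $\mathbf{s}$ is the $T_{N^\circ}$-weight of its lift to $\mathcal{A}_{\mathrm{prin}}$ determined by $\mathbf{s}$; equivalently, identifying $\mathcal{A}^\vee(\mathbb{R}^T)$ with $M^\circ_{\mathbb{R},\mathbf{s}}$, it is the point $m$ such that the monomial is $z^m$ on a seed torus. *)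

theory Defs
  imports
    Complex_Main
    "HOL-Library.Poly_Mapping"
    "HOL-Library.Function_Algebras"
    "HOL-Library.Product_Plus"
    "HOL-Computational_Algebra.Fraction_Field"
begin

text \<open>
  The linear order on index types (and hence this instance) is only a technical device: it makes
  the Laurent polynomial rings below integral domains as types, so that \<open>fract\<close> applies.
\<close>

instantiation sum :: (linorder, linorder) linorder
begin

definition less_eq_sum :: "'a + 'b \<Rightarrow> 'a + 'b \<Rightarrow> bool" where
  "less_eq_sum x y = (case x of
      Inl a \<Rightarrow> (case y of Inl b \<Rightarrow> a \<le> b | Inr _ \<Rightarrow> True)
    | Inr a \<Rightarrow> (case y of Inl _ \<Rightarrow> False | Inr b \<Rightarrow> a \<le> b))"

definition less_sum :: "'a + 'b \<Rightarrow> 'a + 'b \<Rightarrow> bool" where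
  "less_sum x y = (x \<le> y \<and> \<not> y \<le> x)"

instance
  by standard (auto simp: less_eq_sum_def less_sum_def split: sum.splits)

end


subsection \<open>Lattices\<close>

definition zscale :: "int \<Rightarrow> 'a::ab_group_add \<Rightarrow> 'a" where
  "zscale k x = (\<Sum>_<nat k. x) - (\<Sum>_<nat (- k). x)"

definition zcomb :: "('i::finite \<Rightarrow> 'a::ab_group_add) \<Rightarrow> ('i \<Rightarrow> int) \<Rightarrow> 'a" where
  "zcomb b c = (\<Sum>i\<in>UNIV. zscale (c i) (b i))"

definition is_zbasis :: "'i::finite set \<Rightarrow> ('i \<Rightarrow> 'a::ab_group_add) \<Rightarrow> 'a set \<Rightarrow> bool" where
  "is_zbasis J b L \<longleftrightarrow> bij_betw (zcomb b) {c. \<forall>i. i \<notin> J \<longrightarrow> c i = 0} L"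


subsection \<open>Generalized fixed data and generalized torus seeds\<close>

text \<open>
  \<open>latN\<close>, \<open>latNuf\<close>, \<open>latNo\<close> are the lattices \<open>N\<close>, \<open>N\<^sub>u\<^sub>f\<close> (unfrozen part) and \<open>N\<degree>\<close> inside an ambient
  abelian group. The index set \<open>I\<close> is the whole type \<open>'i\<close>; without frozen directions \<open>Iuf\<close> is
  \<open>UNIV\<close> and \<open>latNuf\<close> is \<open>latN\<close>.
\<close>

record ('n, 'i) gen_fixed_data =
  latN :: "'n set"
  latNuf :: "'n set"
  latNo :: "'n set"
  bform :: "'n \<Rightarrow> 'n \<Rightarrow> rat"
  Iuf :: "'i set"
  dnum :: "'i \<Rightarrow> nat"
  rdeg :: "'i \<Rightarrow> nat"

text \<open>
  That \<open>N\<close>, \<open>N\<^sub>u\<^sub>f\<close>, \<open>N\<degree>\<close> are lattices of ranks \<open>|I|\<close>, \<open>|I\<^sub>u\<^sub>f|\<close>, \<open>|I|\<close>, with \<open>N\<^sub>u\<^sub>f\<close> saturated and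
  \<open>N\<degree>\<close> of finite index in \<open>N\<close>, is part of the existence of a seed (\<open>is_torus_seed\<close> below).
\<close>

definition is_gen_fixed_data :: "('n::ab_group_add, 'i::finite) gen_fixed_data \<Rightarrow> bool" where
  "is_gen_fixed_data F \<longleftrightarrow>
     latNuf F \<subseteq> latN F \<and> latNo F \<subseteq> latN F \<and>
     (\<forall>x\<in>latN F. \<forall>y\<in>latN F. \<forall>z\<in>latN F. bform F (x + y) z = bform F x z + bform F y z) \<and>
     (\<forall>x\<in>latN F. \<forall>y\<in>latN F. bform F x y = - bform F y x) \<and>
     (\<forall>x\<in>latNuf F. \<forall>y\<in>latNo F. bform F x y \<in> \<int>) \<and>
     (\<forall>x\<in>latN F. \<forall>y\<in>latNuf F \<inter> latNo F. bform F x y \<in> \<int>) \<and>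
     (\<forall>i. 0 < dnum F i) \<and> (\<forall>i. 0 < rdeg F i)"

text \<open>
  \<open>M\<degree> = Hom(N\<degree>, \<int>)\<close> and \<open>M = Hom(N, \<int>)\<close>, both realized inside \<open>Hom(N, \<rat>)\<close>; functionals are
  extended by \<open>0\<close> outside \<open>N\<close> so that they are determined by their values on \<open>N\<close>.
\<close>

definition latMo :: "('n::ab_group_add, 'i) gen_fixed_data \<Rightarrow> ('n \<Rightarrow> rat) set" where
  "latMo F = {m. (\<forall>x\<in>latN F. \<forall>y\<in>latN F. m (x + y) = m x + m y) \<and>
                 (\<forall>x. x \<notin> latN F \<longrightarrow> m x = 0) \<and> (\<forall>x\<in>latNo F. m x \<in> \<int>)}"

definition latM :: "('n::ab_group_add, 'i) gen_fixed_data \<Rightarrow> ('n \<Rightarrow> rat) set" where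
  "latM F = {m \<in> latMo F. \<forall>x\<in>latN F. m x \<in> \<int>}"

definition p1_star :: "('n::ab_group_add, 'i) gen_fixed_data \<Rightarrow> 'n \<Rightarrow> ('n \<Rightarrow> rat)" where
  "p1_star F n = (\<lambda>x. if x \<in> latN F then bform F n x else 0)"

definition injectivity_assumption :: "('n::ab_group_add, 'i) gen_fixed_data \<Rightarrow> bool" where
  "injectivity_assumption F \<longleftrightarrow> inj_on (p1_star F) (latNuf F)"

text \<open>
  A homomorphism \<open>p\<^sup>*: N \<rightarrow> M\<degree>\<close> restricting to \<open>p\<^sub>1\<^sup>*\<close> on \<open>N\<^sub>u\<^sub>f\<close> and inducing
  \<open>p\<^sub>2\<^sup>*: N \<rightarrow> M\<degree>/N\<^sub>u\<^sub>f\<^sup>\<bottom> = Hom(N\<^sub>u\<^sub>f \<inter> N\<degree>, \<int>)\<close>, \<open>n \<mapsto> {n, \<cdot>}\<close>. Without frozen directions it is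
  necessarily \<open>n \<mapsto> {n, \<cdot>}\<close>.
\<close>

definition is_p_star ::
    "('n::ab_group_add, 'i) gen_fixed_data \<Rightarrow> ('n \<Rightarrow> ('n \<Rightarrow> rat)) \<Rightarrow> bool" where
  "is_p_star F p \<longleftrightarrow>
     (\<forall>n\<in>latN F. p n \<in> latMo F) \<and>
     (\<forall>n\<in>latN F. \<forall>n'\<in>latN F. p (n + n') = p n + p n') \<and>
     (\<forall>n\<in>latNuf F. p n = p1_star F n) \<and>
     (\<forall>n\<in>latN F. \<forall>x\<in>latNuf F \<inter> latNo F. p n x = bform F n x)"

record ('n, 'i, 'r) torus_seed =
  vec :: "'i \<Rightarrow> 'n"
  coef :: "'i \<Rightarrow> nat \<Rightarrow> 'r"

text \<open>
  \<open>R = k[a\<^sub>i\<^sub>,\<^sub>j]\<close>: a monomial assigns to each \<open>i\<close> and \<open>j\<close> the exponent of the \<open>(i,j)\<close>-th variable.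
  Reciprocity \<open>a\<^sub>i\<^sub>,\<^sub>j = a\<^sub>i\<^sub>,\<^sub>r\<^sub>-\<^sub>j\<close> (with \<open>r = r\<^sub>i\<close>) is imposed by using one variable for each pair
  \<open>{j, r - j}\<close>, and \<open>a\<^sub>i\<^sub>,\<^sub>0 = a\<^sub>i\<^sub>,\<^sub>r = 1\<close>. The variables of the polynomial ring that do not arise
  in this way are unused.
\<close>

type_synonym ('i, 'k) coeff_ring = "('i \<Rightarrow>\<^sub>0 (nat \<Rightarrow>\<^sub>0 nat)) \<Rightarrow>\<^sub>0 'k"

definition formal_coef ::
    "('n, 'i) gen_fixed_data \<Rightarrow> 'i \<Rightarrow> nat \<Rightarrow> ('i, 'k::comm_ring_1) coeff_ring" where
  "formal_coef F i j =
     (if j = 0 \<or> j = rdeg F i then 1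
      else Poly_Mapping.single
             (Poly_Mapping.single i (Poly_Mapping.single (min j (rdeg F i - j)) 1)) 1)"

definition is_torus_seed ::
    "('n::ab_group_add, 'i::finite) gen_fixed_data \<Rightarrow>
     ('n, 'i, ('i, 'k::comm_ring_1) coeff_ring) torus_seed \<Rightarrow> bool" where
  "is_torus_seed F s \<longleftrightarrow>
     is_zbasis UNIV (vec s) (latN F) \<and>
     is_zbasis (Iuf F) (vec s) (latNuf F) \<and>
     is_zbasis UNIV (\<lambda>i. zscale (int (dnum F i)) (vec s i)) (latNo F) \<and>
     coef s = formal_coef F"

text \<open>
  \<open>\<epsilon>\<^sub>i\<^sub>j = {e\<^sub>i, e\<^sub>j} d\<^sub>j\<close>. It is an integer, so that \<open>floor\<close> is a mere type conversion, whenever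
  \<open>i\<close> or \<open>j\<close> is unfrozen; only such entries are used. The same applies to the other uses of
  \<open>floor\<close> below, on values of elements of \<open>M\<degree>\<close> on \<open>N\<degree>\<close>.
\<close>

definition eps ::
    "('n, 'i) gen_fixed_data \<Rightarrow> ('n, 'i, 'r) torus_seed \<Rightarrow> 'i \<Rightarrow> 'i \<Rightarrow> int" where
  "eps F s i j = \<lfloor>bform F (vec s i) (vec s j) * of_nat (dnum F j)\<rfloor>"

text \<open>By reciprocity mutation leaves the coefficient tuples unchanged.\<close>

definition mutate ::
    "('n::ab_group_add, 'i) gen_fixed_data \<Rightarrow> 'i \<Rightarrow> ('n, 'i, 'r) torus_seed \<Rightarrow>
     ('n, 'i, 'r) torus_seed" where
  "mutate F k s = s\<lparr>vec := (\<lambda>i. if i = k then - vec s k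
     else vec s i + zscale (int (rdeg F k) * max 0 (eps F s i k)) (vec s k))\<rparr>"

definition seed_f ::
    "('n::ab_group_add, 'i::finite) gen_fixed_data \<Rightarrow> ('n, 'i, 'r) torus_seed \<Rightarrow>
     'i \<Rightarrow> ('n \<Rightarrow> rat)" where
  "seed_f F s i = (\<lambda>x. if x \<in> latN F
     then of_int (inv (zcomb (vec s)) x i) / of_nat (dnum F i) else 0)"


subsection \<open>Cluster variables of the generalized \<open>\<A>\<close> cluster variety\<close>

text \<open>
  The function field of the seed torus \<open>T\<^bsub>N\<degree>,s\<^esub> = Spec R[M\<degree>]\<close>. An element of \<open>M\<degree>\<close> is recorded
  by its coordinates in the basis \<open>f\<^sub>i\<close> attached to \<open>s\<close>, i.e. by its values on \<open>d\<^sub>i e\<^sub>i\<close>.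
\<close>

type_synonym ('i, 'r) laurent = "('i \<Rightarrow>\<^sub>0 int) \<Rightarrow>\<^sub>0 'r"
type_synonym ('i, 'r) ratfun = "('i, 'r) laurent fract"

definition pairing ::
    "('n::ab_group_add, 'i) gen_fixed_data \<Rightarrow> ('n, 'i, 'r) torus_seed \<Rightarrow>
     ('n \<Rightarrow> rat) \<Rightarrow> 'i \<Rightarrow> int" where
  "pairing F s m i = \<lfloor>m (zscale (int (dnum F i)) (vec s i))\<rfloor>"

definition zmonom ::
    "('n::ab_group_add, 'i::{finite,linorder}) gen_fixed_data \<Rightarrow>
     ('n, 'i, 'r::idom) torus_seed \<Rightarrow> ('n \<Rightarrow> rat) \<Rightarrow> ('i, 'r) ratfun" where
  "zmonom F s m = Fract (Poly_Mapping.single (Abs_poly_mapping (pairing F s m)) 1) 1"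

definition rconst :: "'r::idom \<Rightarrow> ('i::linorder, 'r) ratfun" where
  "rconst c = Fract (Poly_Mapping.single 0 c) 1"

text \<open>
  The birational gluing map from the torus of \<open>s\<close> to the torus of \<open>\<mu>\<^sub>k(s)\<close> pulls \<open>z\<^sup>m\<close> back to
  \<open>z\<^sup>m (\<Sum>j\<le>r\<^sub>k. a\<^sub>k\<^sub>,\<^sub>j z\<^bsup>j v\<^esup>)\<^bsup>-\<langle>d\<^sub>k e\<^sub>k, m\<rangle>\<^esup>\<close> with \<open>v = {e\<^sub>k, \<cdot>}\<close>. If \<open>chi m\<close> is the rational function on
  some fixed torus that is \<open>z\<^sup>m\<close> on the torus of \<open>s\<close>, then \<open>chart F ks s chi m\<close> is the one that is
  \<open>z\<^sup>m\<close> on the torus of the seed obtained from \<open>s\<close> by the mutations \<open>ks\<close> (first entry first).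
\<close>

definition glue ::
    "('n::ab_group_add, 'i::{finite,linorder}) gen_fixed_data \<Rightarrow>
     ('n, 'i, 'r::idom) torus_seed \<Rightarrow> 'i \<Rightarrow>
     (('n \<Rightarrow> rat) \<Rightarrow> ('i, 'r) ratfun) \<Rightarrow> ('n \<Rightarrow> rat) \<Rightarrow> ('i, 'r) ratfun" where
  "glue F s k chi m =
     chi m * (\<Sum>j\<le>rdeg F k. rconst (coef s k j) * chi (\<lambda>x. of_nat j * p1_star F (vec s k) x))
       powi (- pairing F s m k)"

fun chart ::
    "('n::ab_group_add, 'i::{finite,linorder}) gen_fixed_data \<Rightarrow> 'i list \<Rightarrow>
     ('n, 'i, 'r::idom) torus_seed \<Rightarrow>
     (('n \<Rightarrow> rat) \<Rightarrow> ('i, 'r) ratfun) \<Rightarrow> ('n \<Rightarrow> rat) \<Rightarrow> ('i, 'r) ratfun" where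
  "chart F [] s chi = chi"
| "chart F (k # ks) s chi = chart F ks (mutate F k s) (glue F s k chi)"

text \<open>
  The \<open>l\<close>-th cluster variable \<open>z\<^bsup>f'\<^sub>l\<^esup>\<close> of the seed \<open>s' = fold (mutate F) ks s\<close>, as a rational
  function on the torus of \<open>s\<close>.
\<close>

definition cluster_variable ::
    "('n::ab_group_add, 'i::{finite,linorder}) gen_fixed_data \<Rightarrow>
     ('n, 'i, 'r::idom) torus_seed \<Rightarrow> 'i list \<Rightarrow> 'i \<Rightarrow> ('i, 'r) ratfun" where
  "cluster_variable F s ks l = chart F ks s (zmonom F s) (seed_f F (fold (mutate F) ks s) l)"


subsection \<open>Principal coefficients\<close>

text \<open>\<open>N \<oplus> M\<degree>\<close> with unfrozen part \<open>N\<^sub>u\<^sub>f \<oplus> 0\<close> and sublattice \<open>N\<degree> \<oplus> M\<close>.\<close>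

definition principal_data ::
    "('n::ab_group_add, 'i) gen_fixed_data \<Rightarrow> ('n \<times> ('n \<Rightarrow> rat), 'i + 'i) gen_fixed_data" where
  "principal_data F =
     \<lparr>latN = latN F \<times> latMo F,
      latNuf = latNuf F \<times> {0},
      latNo = latNo F \<times> latM F,
      bform = (\<lambda>(n1, m1) (n2, m2). bform F n1 n2 + m2 n1 - m1 n2),
      Iuf = Inl ` Iuf F,
      dnum = case_sum (dnum F) (dnum F),
      rdeg = case_sum (rdeg F) (rdeg F)\<rparr>"

text \<open>The directions \<open>Inr i\<close> are frozen, so their coefficient tuples never enter.\<close>

definition principal_seed ::
    "('n::ab_group_add, 'i::finite) gen_fixed_data \<Rightarrow> ('n, 'i, 'r) torus_seed \<Rightarrow>
     ('n \<times> ('n \<Rightarrow> rat), 'i + 'i, 'r) torus_seed" where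
  "principal_seed F s =
     \<lparr>vec = case_sum (\<lambda>i. (vec s i, 0)) (\<lambda>i. (0, seed_f F s i)),
      coef = case_sum (coef s) (coef s)\<rparr>"

definition lifted_cluster_variable ::
    "('n::ab_group_add, 'i::{finite,linorder}) gen_fixed_data \<Rightarrow>
     ('n, 'i, 'r::idom) torus_seed \<Rightarrow> 'i list \<Rightarrow> 'i \<Rightarrow> ('i + 'i, 'r) ratfun" where
  "lifted_cluster_variable F s ks l =
     cluster_variable (principal_data F) (principal_seed F s) (map Inl ks) (Inl l)"


subsection \<open>The \<open>T\<^bsub>N\<degree>\<^esub>\<close>-weight and \<open>g\<close>-vectors\<close>

text \<open>
  The torus \<open>T\<^bsub>N\<degree>\<^esub>\<close> acts on \<open>\<A>\<^sub>p\<^sub>r\<^sub>i\<^sub>n\<close> such that, on the torus with character lattice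
  \<open>M\<degree> \<oplus> N\<close>, the monomial \<open>z\<^bsup>(m,n)\<^esup>\<close> has weight \<open>m - p\<^sup>*(n) \<in> M\<degree>\<close>. In the coordinates
  attached to \<open>principal_seed F s\<close>, the basis vectors of \<open>M\<degree> \<oplus> N\<close> with indices \<open>Inl i\<close> and \<open>Inr i\<close>
  are \<open>(f\<^sub>i, 0)\<close> and \<open>(0, e\<^sub>i)\<close>. Weights are given by their coordinates in the basis \<open>f\<^sub>i\<close> of \<open>M\<degree>\<close>.
\<close>

definition monom_weight ::
    "('n::ab_group_add, 'i::finite) gen_fixed_data \<Rightarrow> ('n \<Rightarrow> ('n \<Rightarrow> rat)) \<Rightarrow>
     ('n, 'i, 'r) torus_seed \<Rightarrow> (('i + 'i) \<Rightarrow>\<^sub>0 int) \<Rightarrow> 'i \<Rightarrow> int" where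
  "monom_weight F p s x i =
     Poly_Mapping.lookup x (Inl i)
       - (\<Sum>j\<in>UNIV. Poly_Mapping.lookup x (Inr j) * pairing F s (p (vec s j)) i)"

definition is_homogeneous :: "('e \<Rightarrow> 'w) \<Rightarrow> ('e \<Rightarrow>\<^sub>0 'r::zero) \<Rightarrow> 'w \<Rightarrow> bool" where
  "is_homogeneous wt P w \<longleftrightarrow> P \<noteq> 0 \<and> (\<forall>x\<in>Poly_Mapping.keys P. wt x = w)"

text \<open>
  A torus action on \<open>Spec R[M\<degree> \<oplus> N]\<close> is a grading of the ring, and an eigenfunction in the
  function field is a quotient of homogeneous elements.
\<close>

definition has_torus_weight ::
    "('n::ab_group_add, 'i::{finite,linorder}) gen_fixed_data \<Rightarrow> ('n \<Rightarrow> ('n \<Rightarrow> rat)) \<Rightarrow>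
     ('n, 'i, 'r::idom) torus_seed \<Rightarrow> ('i + 'i, 'r) ratfun \<Rightarrow> ('i \<Rightarrow> int) \<Rightarrow> bool" where
  "has_torus_weight F p s \<phi> w \<longleftrightarrow>
     (\<exists>P Q u v. is_homogeneous (monom_weight F p s) P u \<and> is_homogeneous (monom_weight F p s) Q v \<and>
        \<phi> = Fract P Q \<and> w = u - v)"

text \<open>
  Coordinates in the basis \<open>f\<^sub>1, \<dots>, f\<^sub>n\<close> of the \<open>g\<close>-vector with respect to \<open>s\<close> of the \<open>l\<close>-th cluster
  variable of \<open>s' = fold (mutate F) ks s\<close>.
\<close>

definition g_vector ::
    "('n::ab_group_add, 'i::{finite,linorder}) gen_fixed_data \<Rightarrow> ('n \<Rightarrow> ('n \<Rightarrow> rat)) \<Rightarrow>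
     ('n, 'i, 'r::idom) torus_seed \<Rightarrow> 'i list \<Rightarrow> 'i \<Rightarrow> 'i \<Rightarrow> int" where
  "g_vector F p s ks l = (THE w. has_torus_weight F p s (lifted_cluster_variable F s ks l) w)"

end

theory Submission
  imports
    Defs
    "HOL-Library.FuncSet"
    "HOL-Computational_Algebra.Polynomial_FPS"
begin

text \<open>
  The \<open>g\<close>-vectors only depend on the ordinary exchange matrix obtained by rescaling column \<open>j\<close> by
  \<open>r\<^sub>j\<close>, so everything reduces to sign coherence for skew-symmetrizable matrices, which is proved with
  the cluster scattering diagram of Gross, Hacking, Keel and Kontsevich in an algebraic form. A consistent
  scattering diagram is an element \<open>g\<close> of the group of power series with constant term \<open>1\<close> in a
  quantum torus; its wall at a point \<open>x\<close> is the middle factor of the unique factorization of \<open>g\<close> into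
  parts of degree positive, zero and negative on \<open>x\<close>, and \<open>x\<close> lies in a chamber iff that factor is \<open>1\<close>.
  Such a \<open>g\<close> is determined by its wall elements in degree \<open>n\<close> at the points \<open>{n, \<cdot>}\<close>; for the cluster
  diagram these are the quantum dilogarithms of the basis vectors. Splitting off the dilogarithm of
  \<open>e\<^sub>k\<close> leaves series that are polynomial in \<open>e\<^sub>k\<close>, and this description is invariant under mutation at
  \<open>k\<close>. Hence the positive orthant of any seed, pulled back piecewise linearly to the initial
  seed, stays inside a chamber. Chambers do not meet the hyperplanes \<open>e\<^sub>i\<^sup>\<bottom>\<close>, which is the claimed
  sign coherence for the pulled back orthants. Finally, tropical duality identifies the generators of
  these orthants with the \<open>T\<^bsub>N\<degree>\<^esub>\<close>-weights of the lifted cluster variables.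
\<close>


subsection \<open>Twisted power series\<close>

text \<open>One obstacle is that adjacent seeds have different cones of nonnegative exponents, so a
  series admissible for one need not make sense for the other. The exponents nonnegative for both
  form a \<open>slab\<close>; once the dilogarithm of \<open>e_k\<close> is split off, the rest of
  the diagram lives there, controlled by the grading \<open>lamJ k\<close>, which is blind to
  \<open>e_k\<close>. Working in the algebra of series itself rather than through its action on a
  torus keeps the argument faithful when the form is degenerate. The quantum parameter is the number
  e: its powers are real, and no denominator of the dilogarithm vanishes.

  The other obstacle is the order of mutations. The sign rule for pulled back orthants peels off the
  first mutation, whereas seeds are built by appending a last one. Exchanging the two ends needs
  coherence of g-vectors and of c-vectors, and the latter arise as g-vectors of the reversed
  sequence for the negated matrix. Finally, a function obtained by gluing has a weight only if the
  mutation factors are nonzero; natural coefficients in characteristic zero guarantee this.\<close>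

definition supp_in :: "('n \<Rightarrow> real) \<Rightarrow> 'n set \<Rightarrow> bool" where
  "supp_in f S \<longleftrightarrow> (\<forall>n. f n \<noteq> 0 \<longrightarrow> n \<in> S)"

lemma supp_in_mono: "supp_in f S \<Longrightarrow> S \<subseteq> T \<Longrightarrow> supp_in f T"
  by (auto simp: supp_in_def)

lemma supp_inD: "supp_in f S \<Longrightarrow> n \<notin> S \<Longrightarrow> f n = 0"
  by (auto simp: supp_in_def)

text \<open>Product of the quantum torus, with \<open>z^m z^n = exp (om m n) z^(m+n)\<close>. The
  index interval makes the sum finite; for series supported on nonnegative exponents it is the full
  convolution.\<close>

definition qmul ::
  "(('i \<Rightarrow> int) \<Rightarrow> ('i \<Rightarrow> int) \<Rightarrow> real) \<Rightarrow> (('i \<Rightarrow> int) \<Rightarrow> real) \<Rightarrow> (('i \<Rightarrow> int) \<Rightarrow> real) \<Rightarrow>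
   ('i \<Rightarrow> int) \<Rightarrow> real" where
  "qmul om f g n = (\<Sum>m\<in>{0..n}. exp (om m (n - m)) * f m * g (n - m))"

definition qone :: "('i \<Rightarrow> int) \<Rightarrow> real" where
  "qone n = (if n = 0 then 1 else 0)"

text \<open>A derivation when \<open>mu\<close> is additive. Logarithms of noncommuting series are
  avoided throughout in favour of logarithmic derivatives.\<close>

definition der :: "(('i \<Rightarrow> int) \<Rightarrow> real) \<Rightarrow> (('i \<Rightarrow> int) \<Rightarrow> real) \<Rightarrow> ('i \<Rightarrow> int) \<Rightarrow> real" where
  "der mu f n = mu n * f n"

lemma finite_int_fun_Icc: "finite {m::'i::finite \<Rightarrow> int. a \<le> m \<and> m \<le> b}"
proof -
  have "{m. a \<le> m \<and> m \<le> b} \<subseteq> PiE UNIV (\<lambda>i. {a i..b i})"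
    by (auto simp: PiE_def extensional_def le_fun_def)
  then show ?thesis
    by (rule finite_subset) (auto intro: finite_PiE)
qed

lemma finite_int_fun_atLeastAtMost [simp]: "finite {a..b::'i::finite \<Rightarrow> int}"
  using finite_int_fun_Icc[of a b] by (simp add: atLeastAtMost_def atLeast_def atMost_def Collect_conj_eq)

text \<open>Summing over the supports removes the order interval from the product, so that it can be
  transported along linear maps that do not respect the order.\<close>

lemma qmul_supp_sum:
  fixes f g :: "('i::finite \<Rightarrow> int) \<Rightarrow> real"
  assumes "supp_in f S" "supp_in g T" "S \<subseteq> {0..}" "T \<subseteq> {0..}"
  shows "qmul om f g n = (\<Sum>m | m \<in> S \<and> n - m \<in> T. exp (om m (n - m)) * f m * g (n - m))"
  unfolding qmul_def
proof (rule sum.mono_neutral_right)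
  show "{m. m \<in> S \<and> n - m \<in> T} \<subseteq> {0..n}"
  proof
    fix m assume "m \<in> {m. m \<in> S \<and> n - m \<in> T}"
    then have "0 \<le> m" "0 \<le> n - m" using assms by auto
    then show "m \<in> {0..n}" by simp
  qed
  show "\<forall>m\<in>{0..n} - {m. m \<in> S \<and> n - m \<in> T}. exp (om m (n - m)) * f m * g (n - m) = 0"
    using assms(1,2) by (auto simp: supp_in_def)
qed simp

lemma supp_in_qmul:
  assumes "supp_in f A" "supp_in g B" "\<And>a b. a \<in> A \<Longrightarrow> b \<in> B \<Longrightarrow> a + b \<in> C"
  shows "supp_in (qmul om f g) C"
  unfolding supp_in_def
proof (intro allI impI)
  fix n assume "qmul om f g n \<noteq> 0"
  then obtain m where "exp (om m (n - m)) * f m * g (n - m) \<noteq> 0"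
    unfolding qmul_def by (meson sum.not_neutral_contains_not_neutral)
  then have "m \<in> A" "n - m \<in> B" using assms(1,2) by (auto simp: supp_in_def)
  then have "m + (n - m) \<in> C" by (rule assms(3))
  then show "n \<in> C" by simp
qed

lemma qmul_eq_0_outside: "\<not> 0 \<le> n \<Longrightarrow> qmul om f g n = 0"
  unfolding qmul_def
  by (rule sum.neutral) (auto intro: order_trans)

lemma qone_0 [simp]: "qone 0 = 1"
  by (simp add: qone_def)

lemma supp_in_qone: "0 \<in> S \<Longrightarrow> supp_in qone S"
  by (auto simp: supp_in_def qone_def)

lemma supp_in_der: "supp_in f S \<Longrightarrow> supp_in (der mu f) S"
  by (auto simp: supp_in_def der_def)

lemma qmul_add_left: "qmul om (\<lambda>n. f n + g n) h n = qmul om f h n + qmul om g h n"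
  by (simp add: qmul_def algebra_simps sum.distrib)

lemma qmul_add_right: "qmul om h (\<lambda>n. f n + g n) n = qmul om h f n + qmul om h g n"
  by (simp add: qmul_def algebra_simps sum.distrib)

locale qtorus =
  fixes om :: "('i::finite \<Rightarrow> int) \<Rightarrow> ('i \<Rightarrow> int) \<Rightarrow> real"
  assumes om_add_left: "om (a + b) c = om a c + om b c"
    and om_skew: "om a b = - om b a"
begin

abbreviation mul (infixl "\<odot>" 70) where "f \<odot> g \<equiv> qmul om f g"

lemma om_add_right: "om a (b + c) = om a b + om a c"
  by (metis om_add_left om_skew add.commute minus_add)

lemma om_0_left [simp]: "om 0 a = 0"
  using om_add_left[of 0 0 a] by simp

lemma om_0_right [simp]: "om a 0 = 0"
  by (metis om_0_left om_skew neg_equal_0_iff_equal)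

lemma om_minus_left: "om (- a) c = - om a c"
  using om_add_left[of a "- a" c] by simp

lemma om_diff_left: "om (a - b) c = om a c - om b c"
  by (metis om_add_left om_minus_left add_uminus_conv_diff)

lemma om_diff_right: "om c (a - b) = om c a - om c b"
  using om_diff_left[of a b c] om_skew[of c] by simp

lemma om_self [simp]: "om a a = 0"
  using om_skew[of a a] by simp

lemma mul_0 [simp]: "(f \<odot> g) 0 = f 0 * g 0"
  by (simp add: qmul_def)

lemma mul_one_left: "supp_in f {0..} \<Longrightarrow> qone \<odot> f = f"
proof
  fix n assume f: "supp_in f {0..}"
  show "(qone \<odot> f) n = f n"
  proof (cases "0 \<le> n")
    case True
    have "(qone \<odot> f) n = (\<Sum>m\<in>{0..n}. if m = 0 then f n else 0)"
      unfolding qmul_def by (rule sum.cong) (auto simp: qone_def)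
    then show ?thesis using True by simp
  next
    case False
    then show ?thesis using f by (simp add: qmul_eq_0_outside supp_inD)
  qed
qed

lemma mul_one_right: "supp_in f {0..} \<Longrightarrow> f \<odot> qone = f"
proof
  fix n assume f: "supp_in f {0..}"
  show "(f \<odot> qone) n = f n"
  proof (cases "0 \<le> n")
    case True
    have "(f \<odot> qone) n = (\<Sum>m\<in>{0..n}. if m = n then f n else 0)"
      unfolding qmul_def by (rule sum.cong) (auto simp: qone_def)
    then show ?thesis using True by simp
  next
    case False
    then show ?thesis using f by (simp add: qmul_eq_0_outside supp_inD)
  qed
qed

lemma mul_assoc: "(f \<odot> g) \<odot> h = f \<odot> (g \<odot> h)"
proof
  fix n
  let ?t = "\<lambda>m p s. exp (om m p + om m s + om p s) * f m * g p * h s"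
  have "((f \<odot> g) \<odot> h) n = (\<Sum>r\<in>{0..n}. \<Sum>m\<in>{0..r}. ?t m (r - m) (n - r))"
    unfolding qmul_def sum_distrib_left sum_distrib_right
  proof (intro sum.cong refl)
    fix r m
    have "om r (n - r) = om m (n - r) + om (r - m) (n - r)"
      using om_add_left[of m "r - m" "n - r"] by simp
    then show "exp (om r (n - r)) * (exp (om m (r - m)) * f m * g (r - m)) * h (n - r) =
       ?t m (r - m) (n - r)"
      by (simp add: exp_add algebra_simps)
  qed
  also have "\<dots> = (\<Sum>(r,m)\<in>Sigma {0..n} (\<lambda>r. {0..r}). ?t m (r - m) (n - r))"
    by (simp add: sum.Sigma)
  also have "\<dots> = (\<Sum>(m,p)\<in>Sigma {0..n} (\<lambda>m. {0..n-m}). ?t m p (n - m - p))"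
  proof (rule sum.reindex_bij_witness[of _ "\<lambda>(m,p). (m + p, m)" "\<lambda>(r,m). (m, r - m)"], goal_cases)
    case (1 a)
    then show ?case by auto
  next
    case (2 a)
    then show ?case by (auto intro: order_trans)
  next
    case (3 a)
    then show ?case by auto
  next
    case (4 a)
    then show ?case by (auto simp: le_diff_eq add.commute intro: order_trans)
  next
    case (5 a)
    then show ?case by (auto simp: algebra_simps)
  qed
  also have "\<dots> = (\<Sum>m\<in>{0..n}. \<Sum>p\<in>{0..n-m}. ?t m p (n - m - p))"
    by (simp add: sum.Sigma)
  also have "\<dots> = (f \<odot> (g \<odot> h)) n"
    unfolding qmul_def sum_distrib_left sum_distrib_right
  proof (intro sum.cong refl)
    fix m p
    have "om m (n - m) = om m p + om m (n - m - p)"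
      using om_add_right[of m p "n - m - p"] by simp
    then show "?t m p (n - m - p) = exp (om m (n - m)) * f m * (exp (om p (n - m - p)) * g p * h (n - m - p))"
      by (simp add: exp_add algebra_simps)
  qed
  finally show "((f \<odot> g) \<odot> h) n = (f \<odot> (g \<odot> h)) n" .
qed

lemma der_mul:
  assumes "additive mu"
  shows "der mu (f \<odot> g) n = (der mu f \<odot> g) n + (f \<odot> der mu g) n"
proof -
  have split: "mu n = mu m + mu (n - m)" for m
    using additive.add[OF assms, of m "n - m"] by simp
  have "mu n * (exp (om m (n - m)) * f m * g (n - m)) =
     exp (om m (n - m)) * (mu m * f m) * g (n - m) + exp (om m (n - m)) * f m * (mu (n - m) * g (n - m))" for m
    by (subst split[of m]) (simp add: algebra_simps)
  then show ?thesis
    by (simp add: der_def qmul_def sum_distrib_left sum.distrib)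
qed

text \<open>When \<open>m\<close> and \<open>n - m\<close> are orthogonal to \<open>n\<close>, both
  exponents \<open>om m (n - m)\<close> and \<open>om (n - m) m\<close> vanish. The coefficient at
  \<open>n\<close> is thus a trace on the series orthogonal to \<open>n\<close>.\<close>

lemma mul_trace:
  assumes "supp_in f {m. om n m = 0}" "supp_in g {m. om n m = 0}"
  shows "(f \<odot> g) n = (g \<odot> f) n"
  unfolding qmul_def
proof (rule sum.reindex_bij_witness[of _ "\<lambda>m. n - m" "\<lambda>m. n - m"], goal_cases)
  case (5 m)
  show ?case
  proof (cases "f m = 0")
    case False
    then have "om n m = 0" using assms by (auto simp: supp_in_def)
    then have "om m n = 0" using om_skew[of m n] by simp
    then show ?thesis using \<open>om n m = 0\<close> by (simp add: om_diff_left om_diff_right)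
  qed simp
qed auto

end

text \<open>
  \<open>grading lam\<close>: all of the triangularity arguments are by induction on \<open>lam\<close>, and \<open>gcone lam\<close> is
  the monoid on which the degree-zero part is trivial.
\<close>

locale grading =
  fixes lam :: "('i::finite \<Rightarrow> int) \<Rightarrow> int"
  assumes lam_add: "lam (a + b) = lam a + lam b"
    and lam_nonneg: "0 \<le> a \<Longrightarrow> 0 \<le> lam a"

definition gcone :: "(('i \<Rightarrow> int) \<Rightarrow> int) \<Rightarrow> ('i \<Rightarrow> int) set" where
  "gcone lam = {n. 0 \<le> n \<and> (n = 0 \<or> 0 < lam n)}"

lemma gcone_nonneg: "gcone lam \<subseteq> {0..}"
  by (auto simp: gcone_def)

context grading
begin

lemma lam_0 [simp]: "lam 0 = 0"
  using lam_add[of 0 0] by simp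

lemma lam_diff: "lam (a - b) = lam a - lam b"
  using lam_add[of "a - b" b] by simp

lemma zero_in_gcone [simp]: "0 \<in> gcone lam"
  by (simp add: gcone_def)

lemma gcone_add: "a \<in> gcone lam \<Longrightarrow> b \<in> gcone lam \<Longrightarrow> a + b \<in> gcone lam"
  by (auto simp: gcone_def lam_add)

lemma additive_lam: "additive (\<lambda>n. real_of_int (lam n))"
  by (simp add: additive_def lam_add)

text \<open>The measure uses \<open>nat\<close> because \<open>lam\<close> may be negative away from
  the nonnegative cone; all such exponents sit at level 0.\<close>

lemma graded_recursion:
  fixes Phi :: "(('i \<Rightarrow> int) \<Rightarrow> 'b) \<Rightarrow> ('i \<Rightarrow> int) \<Rightarrow> 'b"
  assumes "\<And>y z n. (\<And>m. nat (lam m) < nat (lam n) \<Longrightarrow> y m = z m) \<Longrightarrow> Phi y n = Phi z n"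
  obtains y where "\<And>n. y n = Phi y n"
proof -
  let ?R = "measure (\<lambda>n. nat (lam n))"
  have "adm_wf ?R Phi"
    unfolding adm_wf_def by (intro allI impI assms) simp
  then have "wfrec ?R Phi n = Phi (wfrec ?R Phi) n" for n
    by (intro wfrec_fixpoint[THEN fun_cong]) auto
  then show ?thesis using that by blast
qed

end

section \<open>Triangularity of the product and division\<close>

locale graded_qtorus = qtorus om + grading lam
  for om :: "('i::finite \<Rightarrow> int) \<Rightarrow> ('i \<Rightarrow> int) \<Rightarrow> real" and lam :: "('i \<Rightarrow> int) \<Rightarrow> int"
begin

text \<open>An interior term pairs two exponents of positive degree adding up to
  \<open>lam n\<close>, so both lie below \<open>lam n\<close>, where the series agree; only the two
  extreme terms survive. Every triangular system below is solved through this identity.\<close>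

lemma mul_diff_top:
  assumes supp: "supp_in a (gcone lam)" "supp_in a' (gcone lam)" "supp_in b (gcone lam)" "supp_in b' (gcone lam)"
    and a: "\<And>m. lam m < lam n \<Longrightarrow> a m = a' m" and b: "\<And>m. lam m < lam n \<Longrightarrow> b m = b' m"
    and n: "0 < lam n"
  shows "(a \<odot> b) n - (a' \<odot> b') n = (a n - a' n) * b 0 + a 0 * (b n - b' n)"
proof (cases "0 \<le> n")
  case True
  have n0: "n \<noteq> 0" using n by auto
  have split: "{0..n} = insert 0 (insert n ({0..n} - {0,n}))" using True by auto
  have "(f \<odot> g) n = f 0 * g n + f n * g 0 +
      (\<Sum>m\<in>{0..n} - {0,n}. exp (om m (n - m)) * f m * g (n - m))" for f g
    unfolding qmul_def by (subst split) (use n0 in auto)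
  moreover have "(\<Sum>m\<in>{0..n} - {0,n}. exp (om m (n - m)) * a m * b (n - m)) =
      (\<Sum>m\<in>{0..n} - {0,n}. exp (om m (n - m)) * a' m * b' (n - m))"
  proof (rule sum.cong[OF refl])
    fix m assume m: "m \<in> {0..n} - {0,n}"
    then have nn: "0 \<le> m" "0 \<le> n - m" "m \<noteq> 0" "n - m \<noteq> 0" by auto
    show "exp (om m (n - m)) * a m * b (n - m) = exp (om m (n - m)) * a' m * b' (n - m)"
    proof (cases "0 < lam m \<and> 0 < lam (n - m)")
      case True
      then show ?thesis using a[of m] b[of "n - m"] by (simp add: lam_diff)
    next
      case False
      then have "m \<notin> gcone lam \<or> n - m \<notin> gcone lam"
        using nn by (auto simp: gcone_def)
      then have "a m * b (n - m) = 0" "a' m * b' (n - m) = 0"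
        using supp by (auto simp: supp_inD)
      then show ?thesis by auto
    qed
  qed
  moreover have "a 0 = a' 0" "b 0 = b' 0" using a[of 0] b[of 0] n by auto
  ultimately show ?thesis by (simp add: algebra_simps)
next
  case False
  then have "n \<notin> gcone lam" by (simp add: gcone_def)
  then show ?thesis using supp False by (simp add: qmul_eq_0_outside supp_inD)
qed

lemma supp_in_gcone_qmul:
  "supp_in a (gcone lam) \<Longrightarrow> supp_in b (gcone lam) \<Longrightarrow> supp_in (a \<odot> b) (gcone lam)"
  by (rule supp_in_qmul) (auto intro: gcone_add)

lemma mul_cong_below:
  assumes supp: "supp_in a (gcone lam)" "supp_in a' (gcone lam)" "supp_in b (gcone lam)" "supp_in b' (gcone lam)"
    and a: "\<And>m. lam m < e \<Longrightarrow> a m = a' m" and b: "\<And>m. lam m < e \<Longrightarrow> b m = b' m"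
    and n: "lam n < e"
  shows "(a \<odot> b) n = (a' \<odot> b') n"
proof (cases "n \<in> gcone lam")
  case False
  then show ?thesis using supp_in_gcone_qmul supp by (metis supp_inD)
next
  case True
  then consider "n = 0" | "0 < lam n" by (auto simp: gcone_def)
  then show ?thesis
  proof cases
    case 1
    then show ?thesis using a[of 0] b[of 0] n by simp
  next
    case 2
    have "(a \<odot> b) n - (a' \<odot> b') n = (a n - a' n) * b 0 + a 0 * (b n - b' n)"
      by (rule mul_diff_top) (use supp a b n 2 in auto)
    then show ?thesis using a[OF n] b[OF n] by simp
  qed
qed

text \<open>In degree \<open>n\<close> the unknown \<open>z n\<close> occurs in
  \<open>f \<odot> z\<close> with coefficient \<open>f 0 = 1\<close>, and all other unknowns have
  smaller degree.\<close>

lemma left_division: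
  assumes S: "S \<subseteq> gcone lam" "\<And>a b. a \<in> S \<Longrightarrow> b \<in> S \<Longrightarrow> a + b \<in> S"
    and f: "supp_in f S" "f 0 = 1" and y: "supp_in y S"
  obtains z where "supp_in z S" "f \<odot> z = y"
proof -
  \<comment> \<open>Cutting off at degree \<open>d\<close> ensures that the recursion reads only
    values of smaller degree.\<close>
  define tr where "tr z d m = (if m \<in> S \<and> nat (lam m) < d then z m else 0)" for z :: "_ \<Rightarrow> real" and d m
  have "(\<lambda>n. y n - (f \<odot> tr v (nat (lam n))) n) n = (\<lambda>n. y n - (f \<odot> tr z (nat (lam n))) n) n"
    if "\<And>m. nat (lam m) < nat (lam n) \<Longrightarrow> v m = z m" for v z n
  proof -
    have "tr v (nat (lam n)) = tr z (nat (lam n))"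
      using that by (auto simp: tr_def)
    then show ?thesis by simp
  qed
  then obtain z where z: "\<And>n. z n = y n - (f \<odot> tr z (nat (lam n))) n"
    using graded_recursion[of "\<lambda>z n. y n - (f \<odot> tr z (nat (lam n))) n"] by blast
  have trS: "supp_in (tr v d) S" for v d by (auto simp: supp_in_def tr_def)
  have zS: "supp_in z S"
    unfolding supp_in_def
  proof (intro allI impI)
    fix n assume "z n \<noteq> 0"
    then have "y n \<noteq> 0 \<or> (f \<odot> tr z (nat (lam n))) n \<noteq> 0" using z[of n] by auto
    then show "n \<in> S" using y supp_in_qmul[OF f(1) trS S(2)] by (auto simp: supp_in_def)
  qed
  have gS: "supp_in v (gcone lam)" if "supp_in v S" for v
    using that S(1) by (rule supp_in_mono)
  have "(f \<odot> z) n = y n" for n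
  proof (cases "n \<in> S")
    case False
    then show ?thesis using y supp_in_qmul[OF f(1) zS S(2)] by (metis supp_inD)
  next
    case True
    then consider "n = 0" | "0 < lam n" using S by (auto simp: gcone_def)
    then show ?thesis
    proof cases
      case 1
      then show ?thesis using z[of 0] f by (simp add: tr_def)
    next
      case 2
      let ?t = "tr z (nat (lam n))"
      have agree: "z m = ?t m" if "lam m < lam n" for m
        using that zS 2 by (auto simp: tr_def supp_inD)
      have "(f \<odot> z) n - (f \<odot> ?t) n = (f n - f n) * z 0 + f 0 * (z n - ?t n)"
        by (rule mul_diff_top) (use gS f zS trS 2 agree in auto)
      also have "\<dots> = z n" using f 2 by (simp add: tr_def)
      finally show ?thesis using z[of n] by simp
    qed
  qed
  then show ?thesis using that zS by blast
qed

lemma mul_inverse: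
  assumes S: "S \<subseteq> gcone lam" "0 \<in> S" "\<And>a b. a \<in> S \<Longrightarrow> b \<in> S \<Longrightarrow> a + b \<in> S"
    and f: "supp_in f S" "f 0 = 1"
  obtains z where "supp_in z S" "z 0 = 1" "f \<odot> z = qone" "z \<odot> f = qone"
proof -
  obtain z where z: "supp_in z S" "f \<odot> z = qone"
    using left_division[OF S(1,3) f supp_in_qone[OF S(2)]] by blast
  have "(f \<odot> z) 0 = 1" unfolding z(2) by simp
  then have z0: "z 0 = 1" using f by simp
  obtain y where y: "supp_in y S" "z \<odot> y = qone"
    using left_division[OF S(1,3) z(1) z0 supp_in_qone[OF S(2)]] by blast
  have S0: "S \<subseteq> {0..}" using S(1) gcone_nonneg by blast
  have "f = f \<odot> (z \<odot> y)"
    unfolding y(2) using mul_one_right[OF supp_in_mono[OF f(1) S0]] by simp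
  also have "\<dots> = y"
    unfolding mul_assoc[symmetric] z(2) using mul_one_left[OF supp_in_mono[OF y(1) S0]] by simp
  finally have "f = y" .
  then show ?thesis using that z z0 y by blast
qed

lemma left_cancel:
  assumes f: "supp_in f (gcone lam)" "f 0 = 1" and "supp_in y (gcone lam)" "supp_in z (gcone lam)"
    and "f \<odot> y = f \<odot> z"
  shows "y = z"
proof -
  obtain g where g: "g \<odot> f = qone"
    using mul_inverse[OF order_refl zero_in_gcone gcone_add f] by blast
  have "g \<odot> (f \<odot> v) = v" if "supp_in v (gcone lam)" for v
    unfolding mul_assoc[symmetric] g using mul_one_left[OF supp_in_mono[OF that gcone_nonneg]] .
  then show ?thesis using assms by metis
qed

end

subsection \<open>Factorizations and walls\<close>

definition factors ::
  "(('i \<Rightarrow> int) \<Rightarrow> ('i \<Rightarrow> int) \<Rightarrow> real) \<Rightarrow> (('i \<Rightarrow> int) \<Rightarrow> real) \<Rightarrow> ('i \<Rightarrow> int) set \<Rightarrow>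
   (('i \<Rightarrow> int) \<Rightarrow> real) \<Rightarrow> (('i \<Rightarrow> int) \<Rightarrow> real) \<Rightarrow> (('i \<Rightarrow> int) \<Rightarrow> real) \<Rightarrow>
   (('i \<Rightarrow> int) \<Rightarrow> real) \<Rightarrow> bool" where
  "factors om x S f a b c \<longleftrightarrow> f = qmul om a (qmul om b c) \<and> a 0 = 1 \<and> b 0 = 1 \<and> c 0 = 1 \<and>
     supp_in a {n \<in> S. n = 0 \<or> 0 < x n} \<and> supp_in b {n \<in> S. x n = 0} \<and>
     supp_in c {n \<in> S. n = 0 \<or> x n < 0}"

lemma factors_supp:
  assumes "factors om x S f a b c"
  shows "supp_in a S" "supp_in b S" "supp_in c S"
  using assms by (auto simp: factors_def supp_in_def)

lemma factors_mono: "factors om x S f a b c \<Longrightarrow> S \<subseteq> T \<Longrightarrow> factors om x T f a b c"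
  by (auto simp: factors_def supp_in_def)

context graded_qtorus
begin

text \<open>There is one unknown per exponent: \<open>p n\<close> is the defect of the product of
  the factors truncated below \<open>n\<close>, and the sign of \<open>x n\<close> decides which of
  the three factors receives it.\<close>

lemma factors_exists:
  assumes S: "S \<subseteq> gcone lam" "0 \<in> S" "\<And>a b. a \<in> S \<Longrightarrow> b \<in> S \<Longrightarrow> a + b \<in> S"
    and x: "additive x" and f: "supp_in f S" "f 0 = 1"
  obtains a b c where "factors om x S f a b c"
proof -
  have x0: "x 0 = 0" using additive.zero[OF x] .
  define pa where "pa p d m = (if m = 0 then 1 else if m \<in> S \<and> nat (lam m) < d \<and> 0 < x m then p m else 0)"
    for p :: "_ \<Rightarrow> real" and d m
  define pb where "pb p d m = (if m = 0 then 1 else if m \<in> S \<and> nat (lam m) < d \<and> x m = 0 then p m else 0)"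
    for p :: "_ \<Rightarrow> real" and d m
  define pc where "pc p d m = (if m = 0 then 1 else if m \<in> S \<and> nat (lam m) < d \<and> x m < 0 then p m else 0)"
    for p :: "_ \<Rightarrow> real" and d m
  define Phi where "Phi p n = f n - (pa p (nat (lam n)) \<odot> (pb p (nat (lam n)) \<odot> pc p (nat (lam n)))) n" for p n
  have "Phi v n = Phi p n" if "\<And>m. nat (lam m) < nat (lam n) \<Longrightarrow> v m = p m" for v p n
  proof -
    have "pa v (nat (lam n)) = pa p (nat (lam n))" "pb v (nat (lam n)) = pb p (nat (lam n))"
      "pc v (nat (lam n)) = pc p (nat (lam n))"
      using that by (auto simp: pa_def pb_def pc_def)
    then show ?thesis by (simp add: Phi_def)
  qed
  then obtain p where p: "\<And>n. p n = Phi p n" using graded_recursion[of Phi] by blast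
  define a where "a m = (if m = 0 then 1 else if m \<in> S \<and> 0 < x m then p m else 0)" for m
  define b where "b m = (if m = 0 then 1 else if m \<in> S \<and> x m = 0 then p m else 0)" for m
  define c where "c m = (if m = 0 then 1 else if m \<in> S \<and> x m < 0 then p m else 0)" for m
  note defs = a_def b_def c_def pa_def pb_def pc_def
  have supp: "supp_in a S" "supp_in b S" "supp_in c S"
    "supp_in (pa p d) S" "supp_in (pb p d) S" "supp_in (pc p d) S" for d
    using S(2) by (auto simp: supp_in_def defs)
  have mulS: "supp_in (g \<odot> h) S" if "supp_in g S" "supp_in h S" for g h
    using that S(3) by (rule supp_in_qmul)
  have gS: "supp_in g (gcone lam)" if "supp_in g S" for g
    using that S(1) by (rule supp_in_mono)
  have "f n = (a \<odot> (b \<odot> c)) n" for n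
  proof (cases "n \<in> S")
    case False
    then show ?thesis using f mulS supp(1-3) by (metis supp_inD)
  next
    case True
    then consider "n = 0" | "0 < lam n" using S by (auto simp: gcone_def)
    then show ?thesis
    proof cases
      case 1
      then show ?thesis using f by (simp add: defs)
    next
      case 2
      let ?d = "nat (lam n)"
      have ag: "a m = pa p ?d m" "b m = pb p ?d m" "c m = pc p ?d m" if "lam m < lam n" for m
        using that 2 by (auto simp: defs)
      have n0: "n \<noteq> 0" using 2 by auto
      have "(b \<odot> c) m = (pb p ?d \<odot> pc p ?d) m" if "lam m < lam n" for m
        by (rule mul_cong_below[of _ _ _ _ "lam n"]) (use supp gS ag that in auto)
      then have 1: "(a \<odot> (b \<odot> c)) n - (pa p ?d \<odot> (pb p ?d \<odot> pc p ?d)) n =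
         (a n - pa p ?d n) * (b \<odot> c) 0 + a 0 * ((b \<odot> c) n - (pb p ?d \<odot> pc p ?d) n)"
        by (intro mul_diff_top) (use supp gS mulS ag 2 in auto)
      have 3: "(b \<odot> c) n - (pb p ?d \<odot> pc p ?d) n = (b n - pb p ?d n) * c 0 + b 0 * (c n - pc p ?d n)"
        by (intro mul_diff_top) (use supp gS mulS ag 2 in auto)
      have "a 0 = 1" "b 0 = 1" "c 0 = 1" by (simp_all add: defs)
      moreover have "(a n - pa p ?d n) + (b n - pb p ?d n) + (c n - pc p ?d n) = p n"
        using n0 True by (auto simp: defs)
      ultimately have "(a \<odot> (b \<odot> c)) n - (pa p ?d \<odot> (pb p ?d \<odot> pc p ?d)) n = p n"
        unfolding 1 3 by simp
      then show ?thesis using p[of n] by (simp add: Phi_def)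
    qed
  qed
  then have "factors om x S f a b c"
    unfolding factors_def using S(2) x0 by (auto simp: supp_in_def defs)
  then show ?thesis using that by blast
qed

text \<open>To first order the three factors add up, and away from 0 their supports are disjoint.
  Hence agreement of the products below a degree forces agreement factor by factor, and in
  particular the factorization is unique.\<close>

lemma factors_diff_top:
  assumes F: "factors om x (gcone lam) f a b c" and F': "factors om x (gcone lam) f' a' b' c'"
    and x: "additive x"
    and ag: "\<And>m. lam m < e \<Longrightarrow> f m = f' m"
  shows "(\<forall>m. lam m < e \<longrightarrow> a m = a' m \<and> b m = b' m \<and> c m = c' m) \<and>
    (\<forall>n. 0 < lam n \<longrightarrow> lam n = e \<longrightarrow> f n - f' n = (a n - a' n) + (b n - b' n) + (c n - c' n))"
  using ag
proof (induction "nat e" arbitrary: e rule: less_induct)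
  case less
  note supp = factors_supp[OF F] factors_supp[OF F']
  have eq: "f = a \<odot> (b \<odot> c)" "f' = a' \<odot> (b' \<odot> c')" using F F' by (auto simp: factors_def)
  have one: "a 0 = 1" "b 0 = 1" "c 0 = 1" "a' 0 = 1" "b' 0 = 1" "c' 0 = 1"
    using F F' by (auto simp: factors_def)
  have below: "a m = a' m \<and> b m = b' m \<and> c m = c' m" if m: "lam m < e" for m
  proof (cases "m \<in> gcone lam \<and> m \<noteq> 0")
    case False
    then show ?thesis using one supp by (cases "m = 0") (auto simp: supp_inD)
  next
    case True
    then have lm: "0 < lam m" by (auto simp: gcone_def)
    have "f m - f' m = (a m - a' m) + (b m - b' m) + (c m - c' m)"
      using less(1)[of "lam m"] less(2) m lm by force
    moreover have "f m = f' m" using less(2) m by blast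
    moreover have "\<not> 0 < x m \<longrightarrow> a m = 0 \<and> a' m = 0" "x m \<noteq> 0 \<longrightarrow> b m = 0 \<and> b' m = 0"
      "\<not> x m < 0 \<longrightarrow> c m = 0 \<and> c' m = 0"
      using F F' True by (auto simp: factors_def supp_in_def)
    ultimately show ?thesis
      by (cases "x m" "0::real" rule: linorder_cases) auto
  qed
  moreover have "f n - f' n = (a n - a' n) + (b n - b' n) + (c n - c' n)"
    if n: "0 < lam n" "lam n = e" for n
  proof -
    have "(b \<odot> c) m = (b' \<odot> c') m" if "lam m < lam n" for m
      by (rule mul_cong_below[of _ _ _ _ "lam n"]) (use supp below n that in auto)
    then have 1: "f n - f' n = (a n - a' n) * (b \<odot> c) 0 + a 0 * ((b \<odot> c) n - (b' \<odot> c') n)"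
      unfolding eq by (intro mul_diff_top) (use supp supp_in_gcone_qmul below n in auto)
    have 2: "(b \<odot> c) n - (b' \<odot> c') n = (b n - b' n) * c 0 + b 0 * (c n - c' n)"
      by (intro mul_diff_top) (use supp below n in auto)
    show ?thesis unfolding 1 2 using one by simp
  qed
  ultimately show ?case by blast
qed

text \<open>The derivation multiplies degree \<open>n\<close> by \<open>lam n\<close>, and
  \<open>w 0 = 0\<close> kills the other first-order term.\<close>

lemma log_der_diff_top:
  fixes b b' w w' :: "('i \<Rightarrow> int) \<Rightarrow> real"
  assumes supp: "supp_in b (gcone lam)" "supp_in b' (gcone lam)" "supp_in w (gcone lam)" "supp_in w' (gcone lam)"
    and one: "b 0 = 1" "b' 0 = 1"
    and w: "der lam b = b \<odot> w" "der lam b' = b' \<odot> w'"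
    and ag: "\<And>m. lam m < e \<Longrightarrow> b m = b' m"
  shows "(\<forall>m. lam m < e \<longrightarrow> w m = w' m) \<and>
    (\<forall>n. 0 < lam n \<longrightarrow> lam n = e \<longrightarrow> w n - w' n = lam n * (b n - b' n))"
  using ag
proof (induction "nat e" arbitrary: e rule: less_induct)
  case less
  have "(b \<odot> w) 0 = 0" "(b' \<odot> w') 0 = 0" unfolding w[symmetric] by (simp_all add: der_def)
  then have w0: "w 0 = 0" "w' 0 = 0" using one by auto
  have below: "w m = w' m" if m: "lam m < e" for m
  proof (cases "m \<in> gcone lam \<and> m \<noteq> 0")
    case False
    then show ?thesis using w0 supp by (cases "m = 0") (auto simp: supp_inD)
  next
    case True
    then have lm: "0 < lam m" by (auto simp: gcone_def)
    have "w m - w' m = lam m * (b m - b' m)"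
      using less(1)[of "lam m"] less(2) m lm by force
    moreover have "b m = b' m" using less(2) m by blast
    ultimately show ?thesis by simp
  qed
  moreover have "w n - w' n = lam n * (b n - b' n)" if n: "0 < lam n" "lam n = e" for n
  proof -
    have "(b \<odot> w) n - (b' \<odot> w') n = (b n - b' n) * w 0 + b 0 * (w n - w' n)"
      by (intro mul_diff_top) (use supp less(2) below n in auto)
    then show ?thesis using w0 one
      unfolding w[symmetric] by (simp add: der_def algebra_simps)
  qed
  ultimately show ?case by blast
qed

text \<open>
  \<open>att S f n v\<close>: the wall element \<open>b\<close> of \<open>f\<close> at the point \<open>om n\<close> has a logarithm whose coefficient in
  degree \<open>n\<close> is \<open>v / lam n\<close>. It is read off from the logarithmic derivative \<open>w\<close>; since monomials of
  complementary degree commute there, this is additive in \<open>b\<close>.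
\<close>

definition att :: "('i \<Rightarrow> int) set \<Rightarrow> (('i \<Rightarrow> int) \<Rightarrow> real) \<Rightarrow> ('i \<Rightarrow> int) \<Rightarrow> real \<Rightarrow> bool" where
  "att S f n v \<longleftrightarrow> (\<exists>a b c w. factors om (om n) S f a b c \<and> supp_in w {m \<in> S. om n m = 0} \<and>
     der lam b = b \<odot> w \<and> w n = v)"

lemma additive_om: "additive (om n)"
  by (simp add: additive_def om_add_right)

lemma att_mono:
  assumes "att S f n v" "S \<subseteq> T"
  shows "att T f n v"
proof -
  obtain a b c w where F: "factors om (om n) S f a b c" and w: "supp_in w {m \<in> S. om n m = 0}"
    "der lam b = b \<odot> w" "w n = v"
    using assms(1) unfolding att_def by blast
  have "supp_in w {m \<in> T. om n m = 0}" using w(1) assms(2) by (auto simp: supp_in_def)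
  then show ?thesis
    unfolding att_def using factors_mono[OF F assms(2)] w by blast
qed

text \<open>Factorization and division can both be carried out inside the submonoid
  \<open>S\<close>, so the logarithmic derivative vanishes outside \<open>S\<close>; the clause for
  \<open>n \<notin> S\<close> records this.\<close>

lemma att_exists:
  assumes S: "S \<subseteq> gcone lam" "0 \<in> S" "\<And>a b. a \<in> S \<Longrightarrow> b \<in> S \<Longrightarrow> a + b \<in> S"
    and f: "supp_in f S" "f 0 = 1"
  shows "\<exists>v. att S f n v \<and> (n \<notin> S \<longrightarrow> v = 0)"
proof -
  obtain a b c where F: "factors om (om n) S f a b c"
    using factors_exists[OF S additive_om f] .
  let ?T = "{m \<in> S. om n m = 0}"
  have b: "supp_in b ?T" "b 0 = 1" using F by (auto simp: factors_def)
  have "?T \<subseteq> gcone lam" "\<And>a b. a \<in> ?T \<Longrightarrow> b \<in> ?T \<Longrightarrow> a + b \<in> ?T"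
    using S by (auto simp: om_add_right)
  then obtain w where w: "supp_in w ?T" "b \<odot> w = der lam b"
    using left_division[OF _ _ b supp_in_der[OF b(1)]] by blast
  have "n \<notin> S \<Longrightarrow> w n = 0" using w by (auto simp: supp_in_def)
  moreover have "att S f n (w n)"
    unfolding att_def using F w(1) w(2)[symmetric] by blast
  ultimately show ?thesis by blast
qed

text \<open>Because \<open>om n n = 0\<close>, the outer factors vanish in degree \<open>n\<close>,
  so a change of \<open>f n\<close> passes unchanged into the wall element and is multiplied by
  \<open>lam n\<close> in its logarithmic derivative. Prescribing \<open>v\<close> therefore amounts
  to prescribing \<open>f n\<close>, once the lower degrees are known.\<close>

lemma att_diff:
  fixes f f' :: "('i \<Rightarrow> int) \<Rightarrow> real"
  assumes "att (gcone lam) f n v" "att (gcone lam) f' n v'"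
    and ag: "\<And>m. lam m < lam n \<Longrightarrow> f m = f' m" and n: "0 < lam n"
  shows "v - v' = lam n * (f n - f' n)"
proof -
  obtain a b c w where F: "factors om (om n) (gcone lam) f a b c"
    and w: "supp_in w {m \<in> gcone lam. om n m = 0}" "der lam b = b \<odot> w" "w n = v"
    using assms(1) unfolding att_def by blast
  obtain a' b' c' w' where F': "factors om (om n) (gcone lam) f' a' b' c'"
    and w': "supp_in w' {m \<in> gcone lam. om n m = 0}" "der lam b' = b' \<odot> w'" "w' n = v'"
    using assms(2) unfolding att_def by blast
  have ww: "supp_in w (gcone lam)" "supp_in w' (gcone lam)" using w w' by (auto simp: supp_in_def)
  note 1 = factors_diff_top[OF F F' additive_om, of "lam n", OF ag, simplified]
  have "b 0 = 1" "b' 0 = 1" using F F' by (auto simp: factors_def)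
  then have "w n - w' n = lam n * (b n - b' n)"
    using log_der_diff_top[OF factors_supp(2)[OF F] factors_supp(2)[OF F'] ww _ _ w(2) w'(2), of "lam n"] 1 n
    by blast
  moreover have "b n - b' n = f n - f' n"
  proof -
    have "f n - f' n = (a n - a' n) + (b n - b' n) + (c n - c' n)" using 1 n by blast
    moreover have "n \<noteq> 0" using n by auto
    then have "a n = 0" "a' n = 0" "c n = 0" "c' n = 0"
      using F F' by (auto simp: factors_def supp_in_def)
    ultimately show ?thesis by simp
  qed
  ultimately show ?thesis using w w' by simp
qed

text \<open>Flatness of the two logarithmic derivatives; their commutator is killed by \<open>mul_trace\<close>.\<close>

lemma log_der_change_degree:
  assumes b: "supp_in b (gcone lam)" "b 0 = 1"
    and w: "supp_in w {m \<in> gcone lam. om n m = 0}" "supp_in w' {m \<in> gcone lam. om n m = 0}"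
    and mu: "additive mu" "additive mu'"
    and d: "der mu b = b \<odot> w" "der mu' b = b \<odot> w'"
  shows "mu n * w' n = mu' n * w n"
proof -
  have ws: "supp_in w (gcone lam)" "supp_in w' (gcone lam)" using w by (auto simp: supp_in_def)
  have "(b \<odot> (\<lambda>n. (w' \<odot> w) n + der mu' w n)) m = der mu' (der mu b) m" for m
    unfolding d(1) der_mul[OF mu(2)] d(2) qmul_add_right mul_assoc by simp
  moreover have "(b \<odot> (\<lambda>n. (w \<odot> w') n + der mu w' n)) m = der mu (der mu' b) m" for m
    unfolding d(2) der_mul[OF mu(1)] d(1) qmul_add_right mul_assoc by simp
  moreover have "der mu (der mu' b) = der mu' (der mu b)" by (auto simp: der_def)
  ultimately have eq: "b \<odot> (\<lambda>n. (w' \<odot> w) n + der mu' w n) = b \<odot> (\<lambda>n. (w \<odot> w') n + der mu w' n)"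
    by auto
  have plus: "supp_in (\<lambda>n. f n + g n) (gcone lam)" if "supp_in f (gcone lam)" "supp_in g (gcone lam)"
    for f g :: "('i \<Rightarrow> int) \<Rightarrow> real" unfolding supp_in_def
    by (metis (no_types) add.right_neutral supp_inD that)
  have "(\<lambda>n. (w' \<odot> w) n + der mu' w n) = (\<lambda>n. (w \<odot> w') n + der mu w' n)"
    by (rule left_cancel[OF b _ _ eq])
      (intro plus supp_in_der ws supp_in_gcone_qmul)+
  then have "(w' \<odot> w) n + der mu' w n = (w \<odot> w') n + der mu w' n" by metis
  moreover have "(w' \<odot> w) n = (w \<odot> w') n"
    by (rule mul_trace) (use w in \<open>auto simp: supp_in_def\<close>)
  ultimately show ?thesis by (simp add: der_def)
qed

lemma att_unique:
  assumes f: "supp_in f (gcone lam)" "f 0 = 1" and f': "supp_in f' (gcone lam)" "f' 0 = 1"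
    and att: "\<And>n. n \<in> gcone lam \<Longrightarrow> n \<noteq> 0 \<Longrightarrow> att (gcone lam) f n (v n) \<and> att (gcone lam) f' n (v n)"
  shows "f = f'"
proof
  fix n show "f n = f' n"
  proof (induction "nat (lam n)" arbitrary: n rule: less_induct)
    case less
    show ?case
    proof (cases "n \<in> gcone lam \<and> n \<noteq> 0")
      case True
      then have n: "0 < lam n" by (auto simp: gcone_def)
      have "v n - v n = lam n * (f n - f' n)"
        by (rule att_diff) (use att[of n] True n less in auto)
      then show ?thesis using n by simp
    next
      case False
      then show ?thesis using f f' by (cases "n = 0") (auto simp: supp_inD)
    qed
  qed
qed

end

subsection \<open>The quantum dilogarithm\<close>

definition fscale :: "real \<Rightarrow> real fps \<Rightarrow> real fps" where
  "fscale c F = Abs_fps (\<lambda>n. c ^ n * fps_nth F n)"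

lemma fscale_mult: "fscale c (F * G) = fscale c F * fscale c G"
  by (rule fps_ext)
    (auto simp: fscale_def fps_mult_nth sum_distrib_left power_add[symmetric] mult_ac intro!: sum.cong
      simp flip: power_add)

lemma fscale_fscale: "fscale a (fscale b F) = fscale (a * b) F"
  by (rule fps_ext) (simp add: fscale_def power_mult_distrib)

lemma fscale_one [simp]: "fscale 1 F = F"
  by (rule fps_ext) (simp add: fscale_def)

text \<open>With \<open>q = exp (1 / d)\<close>, the recursion compares coefficients in the
  functional equation \<open>Psi(x / q) = (1 + x) Psi(q x)\<close> with \<open>Psi(0) = 1\<close>:
  in degree \<open>a + 1\<close> it reads
  \<open>(q^-(a+1) - q^(a+1)) c_(a+1) = q^a c_a\<close>.\<close>

primrec dilog_coeff :: "real \<Rightarrow> nat \<Rightarrow> real" where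
  "dilog_coeff d 0 = 1"
| "dilog_coeff d (Suc a) =
     exp (real a / d) * dilog_coeff d a / (exp (- (real (Suc a) / d)) - exp (real (Suc a) / d))"

definition dilog :: "real \<Rightarrow> real fps" where
  "dilog d = Abs_fps (dilog_coeff d)"

lemma dilog_functional:
  assumes "0 < d"
  shows "fscale (exp (- (1 / d))) (dilog d) = fps_of_poly [:1, 1:] * fscale (exp (1 / d)) (dilog d)"
proof (rule fps_ext)
  fix n
  show "fps_nth (fscale (exp (- (1 / d))) (dilog d)) n =
    fps_nth (fps_of_poly [:1, 1:] * fscale (exp (1 / d)) (dilog d)) n"
  proof (cases n)
    case 0
    then show ?thesis by (simp add: fscale_def dilog_def fps_mult_nth)
  next
    case (Suc a)
    have ne: "exp (- (real (Suc a) / d)) - exp (real (Suc a) / d) \<noteq> 0"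
      using assms by (simp add: neg_equal_iff_equal)
    have pw: "exp (1 / d) ^ m = exp (real m / d)" "exp (- (1 / d)) ^ m = exp (- (real m / d))" for m
      by (simp_all flip: exp_of_nat_mult)
    have "fps_of_poly [:1, 1:] = 1 + (fps_X :: real fps)"
      by (simp add: fps_of_poly_pCons)
    then have "fps_nth (fps_of_poly [:1, 1:] * fscale (exp (1 / d)) (dilog d)) n =
        exp (real (Suc a) / d) * dilog_coeff d (Suc a) + exp (real a / d) * dilog_coeff d a"
      unfolding Suc by (simp only: distrib_right) (simp add: fscale_def dilog_def pw del: dilog_coeff.simps power_Suc)
    moreover have "(exp (- (real (Suc a) / d)) - exp (real (Suc a) / d)) * dilog_coeff d (Suc a) =
        exp (real a / d) * dilog_coeff d a"
      using ne by simp
    ultimately show ?thesis unfolding Suc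
      by (simp add: fscale_def dilog_def pw algebra_simps del: dilog_coeff.simps power_Suc)
  qed
qed

lemma dilog_shift:
  assumes "0 < d"
  shows "fscale (exp (s - 1 / d)) (dilog d) = fps_of_poly [:1, exp s:] * fscale (exp (s + 1 / d)) (dilog d)"
proof -
  have "fscale (exp s) (fps_of_poly [:1, 1:]) = fps_of_poly [:1, exp s:]"
    by (rule fps_ext) (auto simp: fscale_def coeff_pCons split: nat.splits)
  moreover have "fscale (exp s) (fscale (exp (- (1 / d))) (dilog d)) =
      fscale (exp s) (fps_of_poly [:1, 1:]) * fscale (exp s) (fscale (exp (1 / d)) (dilog d))"
    by (simp add: dilog_functional[OF assms] fscale_mult)
  ultimately show ?thesis
    by (simp add: fscale_fscale exp_add[symmetric])
qed

text \<open>The quotient \<open>Psi(x / q^b) / Psi(q^b x)\<close>, which is the product of the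
  \<open>b\<close> factors \<open>1 + q^t x\<close> with \<open>t = -(b-1), -(b-3), ..., b-1\<close>
  (a q-binomial generating polynomial). The recursion in steps of two adds the outermost pair of
  factors.\<close>

fun rho :: "real \<Rightarrow> nat \<Rightarrow> real poly" where
  "rho d 0 = 1"
| "rho d (Suc 0) = [:1, 1:]"
| "rho d (Suc (Suc b)) = [:1, exp (- (real (Suc b) / d)):] * ([:1, exp (real (Suc b) / d):] * rho d b)"

lemma rho_dilog:
  assumes "0 < d"
  shows "fscale (exp (- (real b / d))) (dilog d) = fps_of_poly (rho d b) * fscale (exp (real b / d)) (dilog d)"
  using assms
proof (induction d b rule: rho.induct)
  case (1 d)
  then show ?case by simp
next
  case (2 d)
  then show ?case using dilog_functional[of d] by simp
next
  case (3 d b)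
  let ?s = "real (Suc b) / d"
  have e: "- ?s - 1 / d = - (real (Suc (Suc b)) / d)" "- ?s + 1 / d = - (real b / d)"
    "?s - 1 / d = real b / d" "?s + 1 / d = real (Suc (Suc b)) / d"
    by (simp_all add: add_divide_distrib)
  have "fscale (exp (- (real (Suc (Suc b)) / d))) (dilog d) =
      fps_of_poly [:1, exp (- ?s):] * (fps_of_poly (rho d b) * (fps_of_poly [:1, exp ?s:] *
        fscale (exp (real (Suc (Suc b)) / d)) (dilog d)))"
    using dilog_shift[OF 3(2), of "- ?s"] dilog_shift[OF 3(2), of ?s] 3(1)[OF 3(2)]
    unfolding e by simp
  then show ?case
    by (simp only: rho.simps fps_of_poly_mult mult_ac)
qed

lemma rho_neq_0: "rho d b \<noteq> 0"
  by (induction d b rule: rho.induct) (simp_all del: mult_pCons_left)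

lemma degree_rho: "degree (rho d b) = b"
  by (induction d b rule: rho.induct) (auto simp: degree_mult_eq rho_neq_0 simp del: mult_pCons_left)

text \<open>The factors come in pairs with exponents \<open>c\<close> and \<open>- c\<close>, whose
  product is palindromic. The symmetry is later used to absorb a shift of exponents under
  mutation.\<close>

lemma reflect_rho: "reflect_poly (rho d b) = rho d b"
proof (induction d b rule: rho.induct)
  case (3 d b)
  have "reflect_poly [:1, exp c:] = [:exp c, 1::real:]" for c
    by (simp add: reflect_poly_def)
  moreover have "[:exp (- c), 1:] * ([:exp c, 1:] * p) = [:1, exp (- c):] * ([:1, exp c:] * p)" for p and c :: real
  proof -
    have "[:exp (- c), 1:] * [:exp c, 1:] = [:1, exp (- c):] * [:1, exp c:]"
      by (simp flip: exp_add)
    then show ?thesis by (simp only: mult.assoc[symmetric])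
  qed
  ultimately show ?case using 3 by (simp add: reflect_poly_mult del: mult_pCons_left)
qed (simp_all add: reflect_poly_def)

lemma coeff_rho_sym: "i \<le> b \<Longrightarrow> coeff (rho d b) (b - i) = coeff (rho d b) i"
  using coeff_reflect_poly[of "rho d b" i] by (simp add: reflect_rho degree_rho)

text \<open>The logarithmic derivative \<open>x Psi' / Psi\<close>; dividing its \<open>a\<close>-th
  coefficient by \<open>a\<close> gives the \<open>a\<close>-th coefficient of
  \<open>log Psi\<close>.\<close>

definition dilog_beta :: "real \<Rightarrow> real fps" where
  "dilog_beta d = fps_X * fps_deriv (dilog d) * inverse (dilog d)"

lemma dilog_0 [simp]: "fps_nth (dilog d) 0 = 1"
  by (simp add: dilog_def)

lemma dilog_1_neq_0: "0 < d \<Longrightarrow> fps_nth (dilog d) (Suc 0) \<noteq> 0"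
  by (simp add: dilog_def)

lemma dilog_beta: "dilog d * dilog_beta d = fps_X * fps_deriv (dilog d)"
proof -
  have "dilog d * inverse (dilog d) = 1"
    using inverse_mult_eq_1'[of "dilog d"] by simp
  then show ?thesis by (simp add: dilog_beta_def mult_ac)
qed

section \<open>Series in one variable and restriction to lines\<close>

definition axis_vec :: "'i \<Rightarrow> int \<Rightarrow> 'i \<Rightarrow> int" where
  "axis_vec k a = (\<lambda>j. if j = k then a else 0)"

lemma axis_vec_apply: "axis_vec k a j = (if j = k then a else 0)"
  by (simp add: axis_vec_def)

lemma axis_vec_same [simp]: "axis_vec k a k = a"
  by (simp add: axis_vec_def)

lemma axis_vec_add: "axis_vec k (a + b) = axis_vec k a + axis_vec k b"
  by (auto simp: axis_vec_def)

lemma axis_vec_0 [simp]: "axis_vec k 0 = 0"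
  by (auto simp: axis_vec_def)

lemma axis_vec_minus: "axis_vec k (- a) = - axis_vec k a"
  by (auto simp: axis_vec_def)

lemma axis_vec_nonneg_iff [simp]: "0 \<le> axis_vec k a \<longleftrightarrow> 0 \<le> a"
  by (auto simp: axis_vec_def le_fun_def)

lemma additive_axis_vec:
  fixes x :: "('i \<Rightarrow> int) \<Rightarrow> real"
  assumes "additive x"
  shows "x (axis_vec k a) = a * x (axis_vec k 1)"
proof -
  have nat: "x (axis_vec k (int m)) = m * x (axis_vec k 1)" for m
  proof (induction m)
    case 0
    show ?case unfolding of_nat_0 axis_vec_0 additive.zero[OF assms] by simp
  next
    case (Suc m)
    have "x (axis_vec k (int (Suc m))) = x (axis_vec k 1) + x (axis_vec k (int m))"
      unfolding additive.add[OF assms, symmetric] axis_vec_add[symmetric] by simp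
    then show ?case using Suc by (simp add: algebra_simps)
  qed
  show ?thesis
  proof (cases "0 \<le> a")
    case True
    then show ?thesis using nat[of "nat a"] by simp
  next
    case False
    have "x (- axis_vec k a) = - a * x (axis_vec k 1)"
      using nat[of "nat (- a)"] False by (simp add: axis_vec_minus)
    then show ?thesis by (simp add: additive.minus[OF assms])
  qed
qed

definition emb :: "'i \<Rightarrow> real fps \<Rightarrow> ('i \<Rightarrow> int) \<Rightarrow> real" where
  "emb k F n = (if 0 \<le> n k \<and> n = axis_vec k (n k) then fps_nth F (nat (n k)) else 0)"

lemma emb_axis: "0 \<le> a \<Longrightarrow> emb k F (axis_vec k a) = fps_nth F (nat a)"
  by (simp add: emb_def)

lemma supp_in_emb: "supp_in (emb k F) {n. 0 \<le> n k \<and> n = axis_vec k (n k)}"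
  by (auto simp: supp_in_def emb_def)

lemma emb_0 [simp]: "emb k F 0 = fps_nth F 0"
  using emb_axis[of 0 k F] by simp

text \<open>The restriction of \<open>f\<close> to the line through \<open>n\<close> in direction
  \<open>e_k\<close>, from coordinate 0 on. Multiplication by a series in \<open>e_k\<close> acts on
  each such line separately.\<close>

definition slice :: "'i \<Rightarrow> (('i \<Rightarrow> int) \<Rightarrow> real) \<Rightarrow> ('i \<Rightarrow> int) \<Rightarrow> real fps" where
  "slice k f n = Abs_fps (\<lambda>a. f (n(k := int a)))"

lemma minus_axis_vec: "n - axis_vec k c = n(k := n k - c)"
  by (auto simp: axis_vec_def)

lemma sum_axis_interval:
  fixes n :: "'i::finite \<Rightarrow> int" and g :: "('i \<Rightarrow> int) \<Rightarrow> real"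
  assumes "0 \<le> n" "supp_in g {m. 0 \<le> m k \<and> m = axis_vec k (m k)}"
  shows "(\<Sum>m\<in>{0..n}. g m) = (\<Sum>c\<in>{0..nat (n k)}. g (axis_vec k (int c)))"
proof -
  have "(\<Sum>m\<in>{0..n}. g m) = (\<Sum>m\<in>(\<lambda>c. axis_vec k (int c)) ` {0..nat (n k)}. g m)"
  proof (rule sum.mono_neutral_right)
    show "(\<lambda>c. axis_vec k (int c)) ` {0..nat (n k)} \<subseteq> {0..n}"
      using assms(1) by (auto simp: axis_vec_def le_fun_def le_nat_iff)
    show "\<forall>m\<in>{0..n} - (\<lambda>c. axis_vec k (int c)) ` {0..nat (n k)}. g m = 0"
    proof
      fix m assume m: "m \<in> {0..n} - (\<lambda>c. axis_vec k (int c)) ` {0..nat (n k)}"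
      show "g m = 0"
      proof (rule ccontr)
        assume "g m \<noteq> 0"
        then have "0 \<le> m k" "m = axis_vec k (m k)" using assms(2) by (auto simp: supp_in_def)
        moreover have "m k \<le> n k" using m by (auto simp: le_fun_def)
        ultimately have "m = axis_vec k (int (nat (m k)))" "nat (m k) \<in> {0..nat (n k)}" by auto
        then show False using m by blast
      qed
    qed
  qed simp
  also have "\<dots> = (\<Sum>c\<in>{0..nat (n k)}. g (axis_vec k (int c)))"
  proof (subst sum.reindex)
    show "inj_on (\<lambda>c. axis_vec k (int c)) {0..nat (n k)}"
      by (rule inj_onI) (metis axis_vec_same of_nat_eq_iff)
  qed simp
  finally show ?thesis .
qed

context qtorus
begin

lemma additive_om': "additive (om n)" "additive (\<lambda>n. om n m)"
  by (simp_all add: additive_def om_add_right om_add_left)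

lemma om_axis_right: "om n (axis_vec k a) = a * om n (axis_vec k 1)"
  by (rule additive_axis_vec[OF additive_om'(1)])

lemma om_axis_left: "om (axis_vec k a) n = - (a * om n (axis_vec k 1))"
  using om_axis_right[of n k a] om_skew[of "axis_vec k a" n] by simp

lemma om_axis_axis [simp]: "om (axis_vec k a) (axis_vec k b) = 0"
proof -
  have "om (axis_vec k 1) (axis_vec k b) = 0"
    by (subst om_axis_right) simp
  then have "om (axis_vec k b) (axis_vec k 1) = 0" using om_skew[of "axis_vec k b"] by simp
  then show ?thesis by (simp add: om_axis_left)
qed

text \<open>Commuting a power of \<open>e_k\<close> past a monomial costs a factor that is constant
  along the line, since \<open>e_k\<close> is orthogonal to itself. The product is therefore an
  ordinary one, with the variable of \<open>F\<close> rescaled.\<close>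

lemma emb_mul_slice:
  assumes "0 \<le> n"
  shows "(emb k F \<odot> f) n = fps_nth (slice k f n * fscale (exp (- om n (axis_vec k 1))) F) (nat (n k))"
proof -
  let ?t = "om n (axis_vec k 1)"
  have "(emb k F \<odot> f) n = (\<Sum>c\<in>{0..nat (n k)}. exp (om (axis_vec k (int c)) (n - axis_vec k (int c))) *
     emb k F (axis_vec k (int c)) * f (n - axis_vec k (int c)))"
    unfolding qmul_def
    by (rule sum_axis_interval[OF assms]) (auto simp: supp_in_def emb_def)
  also have "\<dots> = (\<Sum>c\<in>{0..nat (n k)}. (exp (- ?t) ^ c * fps_nth F c) * f (n(k := int (nat (n k) - c))))"
  proof (rule sum.cong[OF refl])
    fix c assume "c \<in> {0..nat (n k)}"
    moreover have "0 \<le> n k" using assms by (auto simp: le_fun_def)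
    ultimately have upd: "n - axis_vec k (int c) = n(k := int (nat (n k) - c))"
      by (auto simp: minus_axis_vec of_nat_diff)
    have "om (axis_vec k (int c)) (n - axis_vec k (int c)) = real c * (- ?t)"
      unfolding om_diff_right om_axis_axis om_axis_left[of k _ n] by simp
    then have "exp (om (axis_vec k (int c)) (n - axis_vec k (int c))) = exp (- ?t) ^ c"
      by (simp only: exp_of_nat_mult)
    then show "exp (om (axis_vec k (int c)) (n - axis_vec k (int c))) *
       emb k F (axis_vec k (int c)) * f (n - axis_vec k (int c)) =
       (exp (- ?t) ^ c * fps_nth F c) * f (n(k := int (nat (n k) - c)))"
      unfolding upd[symmetric] by (simp add: emb_axis)
  qed
  also have "\<dots> = fps_nth (fscale (exp (- ?t)) F * slice k f n) (nat (n k))"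
    by (simp add: fps_mult_nth fscale_def slice_def)
  finally show ?thesis by (simp add: mult.commute)
qed

lemma mul_emb_slice:
  assumes "0 \<le> n"
  shows "(f \<odot> emb k F) n = fps_nth (slice k f n * fscale (exp (om n (axis_vec k 1))) F) (nat (n k))"
proof -
  let ?t = "om n (axis_vec k 1)"
  have "(f \<odot> emb k F) n = (\<Sum>m\<in>{0..n}. exp (om (n - m) m) * f (n - m) * emb k F m)"
    unfolding qmul_def
    by (rule sum.reindex_bij_witness[of _ "\<lambda>m. n - m" "\<lambda>m. n - m"]) auto
  also have "\<dots> = (\<Sum>c\<in>{0..nat (n k)}. exp (om (n - axis_vec k (int c)) (axis_vec k (int c))) *
     f (n - axis_vec k (int c)) * emb k F (axis_vec k (int c)))"
    by (rule sum_axis_interval[OF assms]) (auto simp: supp_in_def emb_def)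
  also have "\<dots> = (\<Sum>c\<in>{0..nat (n k)}. (exp ?t ^ c * fps_nth F c) * f (n(k := int (nat (n k) - c))))"
  proof (rule sum.cong[OF refl])
    fix c assume "c \<in> {0..nat (n k)}"
    moreover have "0 \<le> n k" using assms by (auto simp: le_fun_def)
    ultimately have upd: "n - axis_vec k (int c) = n(k := int (nat (n k) - c))"
      by (auto simp: minus_axis_vec of_nat_diff)
    have "om (n - axis_vec k (int c)) (axis_vec k (int c)) = real c * ?t"
      unfolding om_diff_left om_axis_axis om_axis_right[of n k "int c"] by simp
    then have "exp (om (n - axis_vec k (int c)) (axis_vec k (int c))) = exp ?t ^ c"
      by (simp only: exp_of_nat_mult)
    then show "exp (om (n - axis_vec k (int c)) (axis_vec k (int c))) *
       f (n - axis_vec k (int c)) * emb k F (axis_vec k (int c)) =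
       (exp ?t ^ c * fps_nth F c) * f (n(k := int (nat (n k) - c)))"
      unfolding upd[symmetric] by (simp add: emb_axis)
  qed
  also have "\<dots> = fps_nth (fscale (exp ?t) F * slice k f n) (nat (n k))"
    by (simp add: fps_mult_nth fscale_def slice_def)
  finally show ?thesis by (simp add: mult.commute)
qed

lemma emb_mul_emb: "emb k F \<odot> emb k G = emb k (F * G)"
proof
  fix n
  show "(emb k F \<odot> emb k G) n = emb k (F * G) n"
  proof (cases "0 \<le> n \<and> n = axis_vec k (n k)")
    case True
    have n0: "0 \<le> n k" using True by (auto simp: le_fun_def)
    have upd: "n(k := a) = axis_vec k a" for a
      by (subst conjunct2[OF True]) (auto simp: axis_vec_def)
    have "slice k (emb k G) n = G"
      by (rule fps_ext) (simp add: slice_def emb_axis upd)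
    moreover have "om n (axis_vec k 1) = 0"
      using om_axis_axis[of k "n k" 1] True by metis
    ultimately show ?thesis
      using True n0 by (simp add: emb_mul_slice emb_def mult.commute)
  next
    case False
    have "supp_in (emb k F \<odot> emb k G) {n. 0 \<le> n k \<and> n = axis_vec k (n k)}"
    proof (rule supp_in_qmul[OF supp_in_emb supp_in_emb], goal_cases)
      case (1 a b)
      then have "a = axis_vec k (a k)" "b = axis_vec k (b k)" "0 \<le> a k" "0 \<le> b k" by auto
      then show ?case using axis_vec_add[of k "a k" "b k"] by simp
    qed
    moreover have "\<not> (0 \<le> n k \<and> n = axis_vec k (n k))"
      using False by (metis axis_vec_nonneg_iff)
    ultimately show ?thesis by (auto simp: emb_def supp_inD)
  qed
qed

text \<open>On one line in direction \<open>e_k\<close> the integer \<open>B\<close> is constant,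
  and the claim becomes \<open>slice h * Psi(q^B x) = slice h' * Psi(x / q^B)\<close>. This is the
  defining property of \<open>rho\<close> when \<open>B \<ge> 0\<close>, and the same with
  \<open>h\<close> and \<open>h'\<close> exchanged when \<open>B \<le> 0\<close>.\<close>

lemma dilog_commutation:
  assumes d: "0 < d" and B: "\<And>n. real_of_int (B n) = d * om n (axis_vec k 1)"
    and supp: "supp_in h {0..}" "supp_in h' {0..}"
    and pos: "\<And>n. 0 \<le> B n \<Longrightarrow> h n = (\<Sum>i\<le>nat (B n). coeff (rho d (nat (B n))) i * h' (n - axis_vec k (int i)))"
    and neg: "\<And>n. B n \<le> 0 \<Longrightarrow> h' n = (\<Sum>i\<le>nat (- B n). coeff (rho d (nat (- B n))) i * h (n - axis_vec k (int i)))"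
  shows "h \<odot> emb k (dilog d) = emb k (dilog d) \<odot> h'"
proof
  fix n
  show "(h \<odot> emb k (dilog d)) n = (emb k (dilog d) \<odot> h') n"
  proof (cases "0 \<le> n")
    case True
    let ?t = "om n (axis_vec k 1)"
    have Bk: "B (n(k := a)) = B n" for a
    proof -
      have "n(k := a) = n - axis_vec k (n k - a)" by (auto simp: axis_vec_def)
      then have "om (n(k := a)) (axis_vec k 1) = om n (axis_vec k 1)" by (simp add: om_diff_left)
      then have "real_of_int (B (n(k := a))) = real_of_int (B n)" by (simp add: B)
      then show ?thesis by simp
    qed
    \<comment> \<open>On a line the conjugation sum is multiplication by a polynomial; terms that
      would reach below coordinate 0 vanish because \<open>g\<close> is supported on nonnegative
      exponents.\<close>
    have slice: "slice k f n = fps_of_poly p * slice k g n"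
      if f: "\<And>a. f (n(k := int a)) = (\<Sum>i\<le>degree p. coeff p i * g (n(k := int a) - axis_vec k (int i)))"
        and g: "supp_in g {0..}" for f g p
    proof (rule fps_ext)
      fix a
      have "(\<Sum>i\<le>degree p. coeff p i * g (n(k := int a) - axis_vec k (int i))) =
          (\<Sum>i\<in>{0..a}. coeff p i * g (n(k := int (a - i))))"
      proof (rule sum.mono_neutral_cong)
        fix i assume "i \<in> {..degree p} - {0..a}"
        then have "\<not> 0 \<le> n(k := int a) - axis_vec k (int i)"
          by (auto simp: axis_vec_def le_fun_def not_le intro!: exI[of _ k])
        then show "coeff p i * g (n(k := int a) - axis_vec k (int i)) = 0"
          using g by (simp add: supp_inD)
      next
        fix i assume "i \<in> {0..a} - {..degree p}"
        then show "coeff p i * g (n(k := int (a - i))) = 0" by (simp add: coeff_eq_0)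
      next
        fix i assume "i \<in> {..degree p} \<inter> {0..a}"
        then have "n(k := int a) - axis_vec k (int i) = n(k := int (a - i))"
          by (auto simp: axis_vec_def fun_eq_iff)
        then show "coeff p i * g (n(k := int a) - axis_vec k (int i)) = coeff p i * g (n(k := int (a - i)))"
          by simp
      qed auto
      then show "fps_nth (slice k f n) a = fps_nth (fps_of_poly p * slice k g n) a"
        by (simp add: slice_def fps_mult_nth f)
    qed
    have "slice k h n * fscale (exp ?t) (dilog d) = slice k h' n * fscale (exp (- ?t)) (dilog d)"
    proof (cases "0 \<le> B n")
      case True
      then have "?t = real (nat (B n)) / d" using B[of n] d by (simp add: field_simps)
      then have "fscale (exp (- ?t)) (dilog d) = fps_of_poly (rho d (nat (B n))) * fscale (exp ?t) (dilog d)"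
        using rho_dilog[OF d] by simp
      moreover have "slice k h n = fps_of_poly (rho d (nat (B n))) * slice k h' n"
        by (rule slice) (use pos[of "n(k := int _)"] supp True in \<open>auto simp: Bk degree_rho\<close>)
      ultimately show ?thesis by (simp add: mult_ac)
    next
      case False
      then have "?t = - (real (nat (- B n)) / d)" using B[of n] d by (simp add: field_simps)
      then have "fscale (exp ?t) (dilog d) = fps_of_poly (rho d (nat (- B n))) * fscale (exp (- ?t)) (dilog d)"
        using rho_dilog[OF d] by simp
      moreover have "slice k h' n = fps_of_poly (rho d (nat (- B n))) * slice k h n"
        by (rule slice) (use neg[of "n(k := int _)"] supp False in \<open>auto simp: Bk degree_rho\<close>)
      ultimately show ?thesis by (simp add: mult_ac)
    qed
    then show ?thesis by (simp add: mul_emb_slice[OF True] emb_mul_slice[OF True])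
  qed (simp add: qmul_eq_0_outside)
qed

end

subsection \<open>Scattering in a slab\<close>

text \<open>The skew form itself, recovered from the exchange matrix by undoing the multiplication
  of column \<open>j\<close> by \<open>d j\<close>.\<close>

definition sform :: "('i::finite \<Rightarrow> 'i \<Rightarrow> int) \<Rightarrow> ('i \<Rightarrow> real) \<Rightarrow> ('i \<Rightarrow> int) \<Rightarrow> ('i \<Rightarrow> int) \<Rightarrow> real" where
  "sform E d m n = (\<Sum>i\<in>UNIV. \<Sum>j\<in>UNIV. m i * n j * E i j / d j)"

definition colsum :: "('i::finite \<Rightarrow> 'i \<Rightarrow> int) \<Rightarrow> 'i \<Rightarrow> ('i \<Rightarrow> int) \<Rightarrow> int" where
  "colsum E k n = (\<Sum>i\<in>UNIV. n i * E i k)"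

definition colpos :: "('i::finite \<Rightarrow> 'i \<Rightarrow> int) \<Rightarrow> 'i \<Rightarrow> ('i \<Rightarrow> int) \<Rightarrow> int" where
  "colpos E k n = (\<Sum>i\<in>UNIV. n i * max 0 (E i k))"

definition nege :: "('i \<Rightarrow> 'i \<Rightarrow> int) \<Rightarrow> 'i \<Rightarrow> 'i \<Rightarrow> int" where
  "nege E i j = - E i j"

text \<open>Constant along lines in direction \<open>e_k\<close> and unchanged by mutation at
  \<open>k\<close>, unlike the total degree \<open>lamT\<close>.\<close>

definition lamJ :: "'i::finite \<Rightarrow> ('i \<Rightarrow> int) \<Rightarrow> int" where
  "lamJ k n = (\<Sum>i\<in>UNIV - {k}. n i)"

definition lamT :: "('i::finite \<Rightarrow> int) \<Rightarrow> int" where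
  "lamT n = (\<Sum>i\<in>UNIV. n i)"

text \<open>The exponents that are nonnegative both in the given basis and in the basis mutated at
  \<open>k\<close> (compare \<open>amap\<close>). For fixed coordinates away from \<open>k\<close>
  only finitely many values of the coordinate at \<open>k\<close> remain.\<close>

definition slab :: "('i::finite \<Rightarrow> 'i \<Rightarrow> int) \<Rightarrow> 'i \<Rightarrow> ('i \<Rightarrow> int) set" where
  "slab E k = {n. 0 \<le> n \<and> n k \<le> colpos E k n}"

text \<open>The coefficients of the sum of the logarithms of the dilogarithms of the basis vectors.
  At most one summand is nonzero, since a nonzero multiple of a basis vector determines the
  vector.\<close>

definition wall_data :: "('i::finite \<Rightarrow> real) \<Rightarrow> ('i \<Rightarrow> int) \<Rightarrow> real" where
  "wall_data d n = (\<Sum>i\<in>UNIV. if n = axis_vec i (n i) \<and> 0 < n i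
     then fps_nth (dilog_beta (d i)) (nat (n i)) / n i else 0)"

locale exchange =
  fixes E :: "'i::finite \<Rightarrow> 'i \<Rightarrow> int" and d :: "'i \<Rightarrow> real"
  assumes d_pos: "0 < d i" and E_skew: "d i * E i j = - (d j * E j i)"

lemma nege_nege [simp]: "nege (nege E) = E"
  by (simp add: nege_def fun_eq_iff)

lemma exchange_nege:
  assumes "exchange E d"
  shows "exchange (nege E) d"
proof
  fix i j
  show "0 < d i" using exchange.d_pos[OF assms] .
  show "d i * nege E i j = - (d j * nege E j i)"
    using exchange.E_skew[OF assms, of i j] by (simp add: nege_def)
qed

lemma grading_lamJ: "grading (lamJ k)"
  by standard (auto simp: lamJ_def sum.distrib le_fun_def intro: sum_nonneg)

lemma grading_lamT: "grading lamT"
  by standard (auto simp: lamT_def sum.distrib le_fun_def intro: sum_nonneg)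

lemma gcone_lamT: "gcone lamT = {0..}"
proof -
  have "0 < lamT n" if "0 \<le> n" "n \<noteq> 0" for n :: "'a::finite \<Rightarrow> int"
  proof -
    obtain i where "n i \<noteq> 0" using \<open>n \<noteq> 0\<close> by (auto simp: fun_eq_iff)
    then have "0 < n i" using that(1) by (auto simp: le_fun_def less_le)
    then show ?thesis unfolding lamT_def
      using that(1) by (intro sum_pos2[of _ i]) (auto simp: le_fun_def)
  qed
  then show ?thesis by (auto simp: gcone_def)
qed

lemma colpos_add: "colpos E k (m + n) = colpos E k m + colpos E k n"
  by (simp add: colpos_def sum.distrib distrib_right)

lemma colsum_add: "colsum E k (m + n) = colsum E k m + colsum E k n"
  by (simp add: colsum_def sum.distrib distrib_right)

lemma colpos_0 [simp]: "colpos E k 0 = 0" by (simp add: colpos_def)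

lemma colsum_0 [simp]: "colsum E k 0 = 0" by (simp add: colsum_def)

lemma colpos_diff: "colpos E k (m - n) = colpos E k m - colpos E k n"
  using colpos_add[of E k "m - n" n] by simp

lemma colsum_diff: "colsum E k (m - n) = colsum E k m - colsum E k n"
  using colsum_add[of E k "m - n" n] by simp

lemma colpos_axis: "colpos E k (axis_vec i a) = a * max 0 (E i k)"
  by (simp add: colpos_def axis_vec_apply if_distrib[of "\<lambda>x. x * _"] cong: if_cong)

lemma colsum_axis: "colsum E k (axis_vec i a) = a * E i k"
  by (simp add: colsum_def axis_vec_apply if_distrib[of "\<lambda>x. x * _"] cong: if_cong)

lemma lamJ_axis: "lamJ k (axis_vec i a) = (if i = k then 0 else a)"
  by (simp add: lamJ_def axis_vec_apply)

lemma lamT_axis: "lamT (axis_vec i a) = a"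
  by (simp add: lamT_def axis_vec_apply)

lemma colpos_nege: "colpos E k n - colpos (nege E) k n = colsum E k n"
  unfolding colpos_def colsum_def sum_subtractf[symmetric]
  by (rule sum.cong) (auto simp: nege_def max_def algebra_simps)

lemma slab_nonneg: "slab E k \<subseteq> {0..}"
  by (auto simp: slab_def)

lemma zero_in_slab [simp]: "0 \<in> slab E k"
  by (simp add: slab_def)

lemma slab_add: "a \<in> slab E k \<Longrightarrow> b \<in> slab E k \<Longrightarrow> a + b \<in> slab E k"
  by (auto simp: slab_def colpos_add)

lemma wall_data_axis: "0 < a \<Longrightarrow> wall_data d (axis_vec i a) = fps_nth (dilog_beta (d i)) (nat a) / a"
proof -
  assume a: "0 < a"
  have "(axis_vec i a = axis_vec j (axis_vec i a j) \<and> 0 < axis_vec i a j) \<longleftrightarrow> j = i" for j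
    using a by (auto simp: axis_vec_apply)
  then show ?thesis
    by (simp add: wall_data_def if_distrib cong: if_cong)
qed

lemma wall_data_neq_0:
  assumes "wall_data d n \<noteq> 0"
  obtains i a where "0 < a" "n = axis_vec i a"
proof -
  obtain i where "(if n = axis_vec i (n i) \<and> 0 < n i
     then fps_nth (dilog_beta (d i)) (nat (n i)) / n i else 0) \<noteq> 0"
    using assms unfolding wall_data_def by (rule sum.not_neutral_contains_not_neutral)
  then have "n = axis_vec i (n i)" "0 < n i" by (auto split: if_splits)
  then show ?thesis using that by blast
qed

context exchange
begin

lemma E_diag [simp]: "E k k = 0"
  using E_skew[of k k] d_pos[of k] by simp

lemma sform_skew: "sform E d a b = - sform E d b a"
proof -
  have E: "E i j / d j = - (E j i / d i)" for i j
    using E_skew[of i j] d_pos[of i] d_pos[of j] by (simp add: field_simps)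
  have "a i * b j * E i j / d j = - (b j * a i * E j i / d i)" for i j
  proof -
    have "a i * b j * E i j / d j = a i * b j * (E i j / d j)" by simp
    also have "\<dots> = - (b j * a i * E j i / d i)" unfolding E[of i j] by simp
    finally show ?thesis .
  qed
  then have "sform E d a b = (\<Sum>i\<in>UNIV. \<Sum>j\<in>UNIV. - (b j * a i * E j i / d i))"
    by (simp add: sform_def)
  also have "\<dots> = - sform E d b a"
    unfolding sform_def by (subst sum.swap) (simp add: sum_negf)
  finally show ?thesis .
qed

sublocale qtorus "sform E d"
proof
  show "sform E d (a + b) c = sform E d a c + sform E d b c" for a b c
    by (simp add: sform_def sum.distrib add_divide_distrib distrib_right)
qed (rule sform_skew)

lemma graded_J: "graded_qtorus (sform E d) (lamJ k)"
  using grading_lamJ qtorus_axioms by (simp add: graded_qtorus_def)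

lemma graded_T: "graded_qtorus (sform E d) lamT"
  using grading_lamT qtorus_axioms by (simp add: graded_qtorus_def)

lemma colsum_eq: "real_of_int (colsum E k n) = d k * sform E d n (axis_vec k 1)"
proof -
  have "sform E d n (axis_vec k 1) = (\<Sum>i\<in>UNIV. \<Sum>j\<in>UNIV. if j = k then n i * E i k / d k else 0)"
    unfolding sform_def by (intro sum.cong) (auto simp: axis_vec_apply)
  also have "\<dots> = (\<Sum>i\<in>UNIV. n i * E i k) / d k"
    by (simp add: sum_divide_distrib)
  finally show ?thesis using d_pos[of k] by (simp add: colsum_def)
qed

text \<open>Since \<open>E k k = 0\<close>, the bound defining the slab excludes every nonzero
  multiple of \<open>e_k\<close>. This makes \<open>lamJ k\<close> an admissible grading
  there.\<close>

lemma slab_gcone: "slab E k \<subseteq> gcone (lamJ k)"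
proof
  fix n assume n: "n \<in> slab E k"
  then have n0: "0 \<le> n i" for i by (auto simp: slab_def le_fun_def)
  have "n = 0 \<or> 0 < lamJ k n"
  proof (cases "\<forall>i. i \<noteq> k \<longrightarrow> n i = 0")
    case True
    then have "n = axis_vec k (n k)" by (auto simp: axis_vec_def)
    then have "colpos E k n = 0" by (metis E_diag colpos_axis max.idem mult_zero_right)
    then have "n k = 0" using n n0[of k] by (simp add: slab_def)
    then show ?thesis using \<open>n = axis_vec k (n k)\<close> by simp
  next
    case False
    then obtain i where "i \<noteq> k" "n i \<noteq> 0" by blast
    then have "0 < lamJ k n"
      unfolding lamJ_def using n0 n0[of i] by (intro sum_pos2[of _ i]) (auto simp: less_le)
    then show ?thesis ..
  qed
  then show "n \<in> gcone (lamJ k)" using n by (auto simp: gcone_def slab_def)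
qed

lemma slab_nege_gcone: "slab (nege E) k \<subseteq> gcone (lamJ k)"
  using exchange.slab_gcone exchange_nege exchange_axioms by blast

lemma axis_in_slab: "0 \<le> a \<Longrightarrow> i \<noteq> k \<Longrightarrow> axis_vec i a \<in> slab E k"
  by (simp add: slab_def colpos_axis axis_vec_apply)

lemma wall_data_supp: "0 < lamJ k n \<Longrightarrow> n \<notin> slab E k \<Longrightarrow> wall_data d n = 0"
proof (rule ccontr)
  assume n: "0 < lamJ k n" "n \<notin> slab E k" "wall_data d n \<noteq> 0"
  then obtain i a where a: "0 < a" "n = axis_vec i a" using wall_data_neq_0 by blast
  then show False using n axis_in_slab[of a i k] by (auto simp: lamJ_axis split: if_splits)
qed

end

text \<open>
  The diagram is \<open>u \<odot> h' = h \<odot> u\<close> with \<open>u\<close> the dilogarithm of \<open>e\<^sub>k\<close>; the two sums say that \<open>h\<close> and \<open>h'\<close>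
  are conjugate under \<open>u\<close>. On the side of \<open>e\<^sub>k\<^sup>\<bottom>\<close> containing \<open>{n, \<cdot>}\<close>, the walls are those of the
  series for which the condition in degree \<open>n\<close> is imposed. No series in \<open>u\<close> itself enters, which makes
  the notion symmetric under mutation at \<open>k\<close>.
\<close>

definition slab_pair ::
  "('i::finite \<Rightarrow> 'i \<Rightarrow> int) \<Rightarrow> ('i \<Rightarrow> real) \<Rightarrow> 'i \<Rightarrow> (('i \<Rightarrow> int) \<Rightarrow> real) \<Rightarrow> (('i \<Rightarrow> int) \<Rightarrow> real) \<Rightarrow> bool" where
  "slab_pair E d k h' h \<longleftrightarrow>
     supp_in h' (slab (nege E) k) \<and> supp_in h (slab E k) \<and> h' 0 = 1 \<and> h 0 = 1 \<and>
     (\<forall>n. 0 \<le> colsum E k n \<longrightarrow> h n = (\<Sum>i\<le>nat (colsum E k n).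
        coeff (rho (d k) (nat (colsum E k n))) i * h' (n - axis_vec k (int i)))) \<and>
     (\<forall>n. colsum E k n \<le> 0 \<longrightarrow> h' n = (\<Sum>i\<le>nat (- colsum E k n).
        coeff (rho (d k) (nat (- colsum E k n))) i * h (n - axis_vec k (int i)))) \<and>
     (\<forall>n. 0 < lamJ k n \<longrightarrow>
        (0 < colsum E k n \<longrightarrow>
           graded_qtorus.att (sform E d) (lamJ k) (slab (nege E) k) h' n (lamJ k n * wall_data d n)) \<and>
        (colsum E k n < 0 \<longrightarrow>
           graded_qtorus.att (sform E d) (lamJ k) (slab E k) h n (lamJ k n * wall_data d n)) \<and>
        (colsum E k n = 0 \<longrightarrow>
           graded_qtorus.att (sform E d) (lamJ k) (slab (nege E) k) h' n (lamJ k n * wall_data d n) \<or>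
           graded_qtorus.att (sform E d) (lamJ k) (slab E k) h n (lamJ k n * wall_data d n)))"

text \<open>One unknown \<open>y\<close> encodes both series: it is \<open>h'\<close> where
  \<open>colsum\<close> is nonnegative and \<open>h\<close> elsewhere, the values left being given
  by the conjugation sums. These sums stay on a line in direction \<open>e_k\<close>, where
  \<open>lamJ k\<close> and \<open>colsum\<close> are constant, so a recursion on
  \<open>lamJ k\<close> determines \<open>y\<close>.\<close>

lemma (in exchange) slab_pair_exists: "\<exists>h' h. slab_pair E d k h' h"
proof -
  interpret J: graded_qtorus "sform E d" "lamJ k" by (rule graded_J)
  let ?B = "colsum E k" and ?r = "rho (d k)"
  let ?S = "slab E k" and ?S' = "slab (nege E) k"
  define T where "T n = (if 0 \<le> ?B n then ?S' else ?S)" for n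
  have T: "T n \<subseteq> gcone (lamJ k)" "0 \<in> T n" "\<And>a b. a \<in> T n \<Longrightarrow> b \<in> T n \<Longrightarrow> a + b \<in> T n" for n
    using slab_gcone slab_nege_gcone by (auto simp: T_def slab_add)
  \<comment> \<open>The choice includes the value 0 outside \<open>T n\<close>; this is what keeps
    the solution supported in the slabs.\<close>
  define al where "al f n = (SOME v. J.att (T n) f n v \<and> (n \<notin> T n \<longrightarrow> v = 0))" for f n
  have al: "J.att (T n) f n (al f n)" "n \<notin> T n \<Longrightarrow> al f n = 0" if "supp_in f (T n)" "f 0 = 1" for f n
  proof -
    have "J.att (T n) f n (al f n) \<and> (n \<notin> T n \<longrightarrow> al f n = 0)"
      unfolding al_def by (rule someI_ex[OF J.att_exists[OF T that]])
    then show "J.att (T n) f n (al f n)" "n \<notin> T n \<Longrightarrow> al f n = 0" by auto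
  qed
  define H' where "H' y n = (if 0 \<le> ?B n then y n
     else (\<Sum>i\<le>nat (- ?B n). coeff (?r (nat (- ?B n))) i * y (n - axis_vec k (int i))))" for y n
  define H where "H y n = (if ?B n \<le> 0 then y n
     else (\<Sum>i\<le>nat (?B n). coeff (?r (nat (?B n))) i * y (n - axis_vec k (int i))))" for y n
  define HH where "HH y n = (if 0 \<le> ?B n then H' y else H y)" for y n
  define tr where "tr f n m = (if m = 0 then 1 else if m \<in> T n \<and> lamJ k m < lamJ k n then f m else 0)"
    for f :: "_ \<Rightarrow> real" and n m
  \<comment> \<open>By \<open>J.att_diff\<close>, adding \<open>y n\<close> in degree
    \<open>n\<close> raises the attached value of the truncated series by
    \<open>lamJ k n * y n\<close>; this choice brings it to
    \<open>lamJ k n * wall_data d n\<close>.\<close>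
  define Phi where "Phi y n = (if 0 < lamJ k n then wall_data d n - al (tr (HH y n) n) n / lamJ k n
     else if n = 0 then 1 else 0)" for y n
  have trS: "supp_in (tr f n) (T n)" "tr f n 0 = 1" for f n
    using T(2) by (auto simp: supp_in_def tr_def)
  have Bax [simp]: "?B (n - axis_vec k a) = ?B n" "lamJ k (n - axis_vec k a) = lamJ k n" for n a
    by (simp_all add: colsum_diff colsum_axis J.lam_diff lamJ_axis)
  have "Phi y n = Phi z n" if "\<And>m. nat (lamJ k m) < nat (lamJ k n) \<Longrightarrow> y m = z m" for y z n
  proof (cases "0 < lamJ k n")
    case True
    have "H' y m = H' z m" "H y m = H z m" if "lamJ k m < lamJ k n" for m
    proof -
      have "y (m - axis_vec k a) = z (m - axis_vec k a)" "y m = z m" for a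
        using \<open>\<And>m. nat (lamJ k m) < nat (lamJ k n) \<Longrightarrow> y m = z m\<close>[of "m - axis_vec k a"]
          \<open>\<And>m. nat (lamJ k m) < nat (lamJ k n) \<Longrightarrow> y m = z m\<close>[of m] that True by auto
      then show "H' y m = H' z m" "H y m = H z m" by (simp_all add: H'_def H_def)
    qed
    then have "tr (HH y n) n = tr (HH z n) n" by (auto simp: tr_def HH_def)
    then show ?thesis by (simp add: Phi_def)
  next
    case False
    then show ?thesis by (simp add: Phi_def)
  qed
  then obtain y where y: "\<And>n. y n = Phi y n" using J.graded_recursion[of Phi] by blast
  have y0: "y 0 = 1" using y[of 0] by (simp add: Phi_def)
  have slabs: "n \<in> ?S \<longleftrightarrow> n \<in> ?S'" if "?B n = 0" for n
    using that colpos_nege[of E k n] by (simp add: slab_def)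
  have yT: "n \<in> T n" if "y n \<noteq> 0" for n
  proof (rule ccontr)
    assume nT: "n \<notin> T n"
    then have "n \<noteq> 0" using T(2) by metis
    then have n: "0 < lamJ k n" using that y[of n] by (auto simp: Phi_def split: if_splits)
    have "wall_data d n = 0"
      using nT wall_data_supp[OF n] exchange.wall_data_supp[OF exchange_nege[OF exchange_axioms] n]
      by (auto simp: T_def split: if_splits)
    then show False using that y[of n] n nT al(2)[OF trS] by (simp add: Phi_def)
  qed
  define h' where "h' = H' y"
  define h where "h = H y"
  have h'S: "supp_in h' ?S'"
    unfolding supp_in_def
  proof (intro allI impI)
    fix n assume nz: "h' n \<noteq> 0"
    show "n \<in> ?S'"
    proof (cases "0 \<le> ?B n")
      case True
      then show ?thesis using nz yT[of n] by (simp add: h'_def H'_def T_def)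
    next
      case False
      then have "(\<Sum>i\<le>nat (- ?B n). coeff (?r (nat (- ?B n))) i * y (n - axis_vec k (int i))) \<noteq> 0"
        using nz by (simp add: h'_def H'_def)
      then obtain i where i: "i \<le> nat (- ?B n)" "y (n - axis_vec k (int i)) \<noteq> 0"
        by (metis (no_types, lifting) atMost_iff mult_zero_right sum.not_neutral_contains_not_neutral)
      then have "n - axis_vec k (int i) \<in> ?S" using yT[of "n - axis_vec k (int i)"] False by (simp add: T_def)
      then have 1: "0 \<le> n - axis_vec k (int i)" "n k - int i \<le> colpos E k n"
        by (simp_all add: slab_def colpos_diff colpos_axis)
      have "axis_vec k (int i) \<ge> 0" by simp
      then have "0 \<le> n" using 1(1) by (metis add_increasing diff_add_cancel le_add_same_cancel2 order_trans add.commute)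
      \<comment> \<open>The conjugating polynomial has degree \<open>- colsum E k n\<close>, which
        is exactly the difference between the bounds of the two slabs.\<close>
      moreover have "n k \<le> colpos (nege E) k n"
        using 1(2) i(1) False colpos_nege[of E k n] by linarith
      ultimately show ?thesis by (simp add: slab_def)
    qed
  qed
  have hS: "supp_in h ?S"
    unfolding supp_in_def
  proof (intro allI impI)
    fix n assume nz: "h n \<noteq> 0"
    show "n \<in> ?S"
    proof (cases "?B n \<le> 0")
      case True
      then show ?thesis using nz yT[of n] slabs[of n] by (auto simp: h_def H_def T_def split: if_splits)
    next
      case False
      then have "(\<Sum>i\<le>nat (?B n). coeff (?r (nat (?B n))) i * y (n - axis_vec k (int i))) \<noteq> 0"
        using nz by (simp add: h_def H_def)
      then obtain i where i: "i \<le> nat (?B n)" "y (n - axis_vec k (int i)) \<noteq> 0"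
        by (metis (no_types, lifting) atMost_iff mult_zero_right sum.not_neutral_contains_not_neutral)
      then have "n - axis_vec k (int i) \<in> ?S'" using yT[of "n - axis_vec k (int i)"] False by (simp add: T_def)
      then have 1: "0 \<le> n - axis_vec k (int i)" "n k - int i \<le> colpos (nege E) k n"
        by (simp_all add: slab_def colpos_diff colpos_axis nege_def)
      have "axis_vec k (int i) \<ge> 0" by simp
      then have "0 \<le> n" using 1(1) by (metis add_increasing diff_add_cancel le_add_same_cancel2 order_trans add.commute)
      moreover have "n k \<le> colpos E k n"
        using 1(2) i(1) False colpos_nege[of E k n] by linarith
      ultimately show ?thesis by (simp add: slab_def)
    qed
  qed
  have h0: "h' 0 = 1" "h 0 = 1" using y0 by (simp_all add: h'_def H'_def h_def H_def)
  have attT: "J.att (T n) (HH y n) n (lamJ k n * wall_data d n)" if n: "0 < lamJ k n" for n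
  proof -
    let ?f = "HH y n"
    have f: "supp_in ?f (T n)" "?f 0 = 1"
      using h'S hS h0 by (auto simp: HH_def T_def h'_def h_def)
    obtain v where v: "J.att (T n) ?f n v" using J.att_exists[OF T f] by blast
    have "v - al (tr ?f n) n = lamJ k n * (?f n - tr ?f n n)"
    proof (rule J.att_diff[of ?f n v "tr ?f n"])
      show "J.att (gcone (lamJ k)) ?f n v" using v T(1) by (rule J.att_mono)
      show "J.att (gcone (lamJ k)) (tr ?f n) n (al (tr ?f n) n)"
        using al(1)[OF trS] T(1) by (rule J.att_mono)
      show "?f m = tr ?f n m" if "lamJ k m < lamJ k n" for m
        using f that by (auto simp: tr_def supp_inD)
    qed (rule n)
    moreover have "tr ?f n n = 0" using n by (auto simp: tr_def)
    moreover have "?f n = y n" using n by (auto simp: HH_def H'_def H_def)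
    moreover have "y n = wall_data d n - al (tr ?f n) n / lamJ k n" using y[of n] n by (simp add: Phi_def)
    ultimately have "v = lamJ k n * wall_data d n" using n by (simp add: field_simps)
    then show ?thesis using v by simp
  qed
  have "slab_pair E d k h' h"
    unfolding slab_pair_def
  proof (intro conjI allI impI h'S hS h0)
    fix n assume "0 \<le> ?B n"
    then show "h n = (\<Sum>i\<le>nat (?B n). coeff (?r (nat (?B n))) i * h' (n - axis_vec k (int i)))"
      by (cases "?B n = 0") (auto simp: h_def h'_def H_def H'_def)
  next
    fix n assume "?B n \<le> 0"
    then show "h' n = (\<Sum>i\<le>nat (- ?B n). coeff (?r (nat (- ?B n))) i * h (n - axis_vec k (int i)))"
      by (cases "?B n = 0") (auto simp: h_def h'_def H_def H'_def)
  next
    fix n assume "0 < lamJ k n" "0 < ?B n"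
    then show "J.att ?S' h' n (lamJ k n * wall_data d n)"
      using attT[of n] by (simp add: T_def HH_def h'_def)
  next
    fix n assume "0 < lamJ k n" "?B n < 0"
    then show "J.att ?S h n (lamJ k n * wall_data d n)"
      using attT[of n] by (simp add: T_def HH_def h_def)
  next
    fix n assume "0 < lamJ k n" "?B n = 0"
    then show "J.att ?S' h' n (lamJ k n * wall_data d n) \<or> J.att ?S h n (lamJ k n * wall_data d n)"
      using attT[of n] by (simp add: T_def HH_def h'_def)
  qed
  then show ?thesis by blast
qed

subsection \<open>Mutation of slab solutions\<close>

definition mutE :: "'i \<Rightarrow> ('i \<Rightarrow> 'i \<Rightarrow> int) \<Rightarrow> 'i \<Rightarrow> 'i \<Rightarrow> int" where
  "mutE k E i j = (if i = k \<or> j = k then - E i j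
     else E i j + max 0 (E i k) * E k j + E i k * max 0 (- E k j))"

text \<open>Coordinates in the mutated basis turned into coordinates in the original one:
  \<open>e_k\<close> goes to \<open>- e_k\<close> and \<open>e_i\<close> to
  \<open>e_i + max 0 (E i k) e_k\<close>. With \<open>nege E\<close> it is the base change of the
  opposite sign.\<close>

definition amap :: "('i::finite \<Rightarrow> 'i \<Rightarrow> int) \<Rightarrow> 'i \<Rightarrow> ('i \<Rightarrow> int) \<Rightarrow> 'i \<Rightarrow> int" where
  "amap E k n = n(k := colpos E k n - n k)"

lemma mutE_nege: "mutE k (nege E) = nege (mutE k E)"
  by (auto simp: fun_eq_iff mutE_def nege_def max_def algebra_simps)

lemma amap_add: "amap E k (m + n) = amap E k m + amap E k n"
  by (auto simp: amap_def colpos_add)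

lemma amap_0 [simp]: "amap E k 0 = 0"
  by (auto simp: amap_def)

lemma amap_apply: "amap E k n i = (if i = k then colpos E k n - n k else n i)"
  by (simp add: amap_def)

lemma lamJ_amap [simp]: "lamJ k (amap E k n) = lamJ k n"
  by (simp add: lamJ_def amap_def)

lemma additive_expand:
  fixes x :: "('i::finite \<Rightarrow> int) \<Rightarrow> real"
  assumes "additive x"
  shows "x n = (\<Sum>i\<in>UNIV. n i * x (axis_vec i 1))"
proof -
  have "x (\<Sum>i\<in>A. axis_vec i (n i)) = (\<Sum>i\<in>A. n i * x (axis_vec i 1))" for A
  proof (induction A rule: infinite_finite_induct)
    case (insert i A)
    then show ?case
      unfolding sum.insert[OF insert(1,2)] additive.add[OF assms] additive_axis_vec[OF assms, of i "n i"]
      by simp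
  qed (simp_all only: sum.infinite sum.empty additive.zero[OF assms] not_False_eq_True)
  moreover have "(\<Sum>i\<in>UNIV. axis_vec i (n i)) = n"
  proof
    fix j
    have "(\<Sum>i\<in>A. axis_vec i (n i)) j = (\<Sum>i\<in>A. axis_vec i (n i) j)" for A
      by (induction A rule: infinite_finite_induct) auto
    then show "(\<Sum>i\<in>UNIV. axis_vec i (n i)) j = n j" by (simp add: axis_vec_apply)
  qed
  ultimately show ?thesis by metis
qed

context exchange
begin

lemma sform_axis: "sform E d (axis_vec i 1) (axis_vec j 1) = E i j / d j"
  using colsum_eq[of j "axis_vec i 1"] d_pos[of j] by (simp add: colsum_axis field_simps)

lemma colpos_amap: "colpos E k (amap E k n) = colpos E k n"
  unfolding colpos_def by (rule sum.cong) (auto simp: amap_apply)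

lemma colsum_amap: "colsum E k (amap F k n) = colsum E k n"
  unfolding colsum_def by (rule sum.cong) (auto simp: amap_apply)

lemma amap_amap [simp]: "amap E k (amap E k n) = n"
  by (rule ext) (simp add: amap_apply colpos_amap)

lemma amap_axis: "amap E k (axis_vec i 1) =
    (if i = k then - axis_vec k 1 else axis_vec i 1 + axis_vec k (max 0 (E i k)))"
  by (rule ext) (auto simp: amap_apply colpos_axis axis_vec_apply)

text \<open>Matrix mutation is the base change \<open>amap\<close> of the skew form. By bilinearity
  it is enough to compare values on basis vectors.\<close>

lemma sform_mutE: "sform (mutE k E) d m n = sform E d (amap E k m) (amap E k n)"
proof -
  have ab: "additive (\<lambda>m. sform E d (amap E k m) n)" "additive (\<lambda>n. sform E d m (amap E k n))" for m n
    by (auto simp: additive_def amap_add om_add_left om_add_right)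
  have "sform E d (amap E k m) (amap E k n) =
      (\<Sum>i\<in>UNIV. m i * (\<Sum>j\<in>UNIV. n j * sform E d (amap E k (axis_vec i 1)) (amap E k (axis_vec j 1))))"
    by (subst additive_expand[OF ab(1)], subst additive_expand[OF ab(2)]) (rule refl)
  moreover have "sform E d (amap E k (axis_vec i 1)) (amap E k (axis_vec j 1)) = mutE k E i j / d j" for i j
  proof -
    have m: "sform E d (- a) b = - sform E d a b" "sform E d b (- a) = - sform E d b a" for a b
      using om_minus_left[of a b] om_skew[of b "- a"] om_skew[of b a] by simp_all
    have ax: "sform E d a (axis_vec k c) = c * sform E d a (axis_vec k 1)"
      "sform E d (axis_vec k c) a = c * sform E d (axis_vec k 1) a" for a c
      using om_axis_right[of a k c] om_axis_left[of k c a] om_axis_left[of k 1 a] by simp_all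
    show ?thesis
    proof (cases "i = k \<or> j = k")
      case True
      then show ?thesis
        unfolding amap_axis
        by (auto simp: m om_add_left om_add_right sform_axis mutE_def ax(1)[of _ "max 0 _"] ax(2)[of "max 0 _"])
    next
      case False
      \<comment> \<open>Symmetrizability exchanges the positive part of a column entry for the
        negative part of a row entry, which is the term in \<open>mutE\<close>.\<close>
      have "max 0 (E j k) * d j = max 0 (- E k j) * d k"
      proof (cases "0 \<le> E j k")
        case True
        then have "0 \<le> d j * E j k" using d_pos[of j] by simp
        then have "d k * E k j \<le> 0" using E_skew[of j k] by simp
        then have "E k j \<le> 0" using d_pos[of k] by (simp add: mult_le_0_iff)
        then show ?thesis using True E_skew[of j k] by (simp add: mult.commute)
      next
        case False
        then have "d j * E j k \<le> 0" using d_pos[of j] by (simp add: mult_le_0_iff)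
        then have "0 \<le> d k * E k j" using E_skew[of j k] by simp
        then have "0 \<le> E k j" using d_pos[of k] by (simp add: zero_le_mult_iff)
        then show ?thesis using False by simp
      qed
      then have "max 0 (E j k) * (E i k / d k) = E i k * max 0 (- E k j) / d j"
        using d_pos[of j] d_pos[of k] by (simp add: field_simps)
      then show ?thesis using False
        unfolding amap_axis
        by (simp add: om_add_left om_add_right sform_axis mutE_def ax(1)[of _ "max 0 _"] ax(2)[of "max 0 _"]
            add_divide_distrib)
    qed
  qed
  ultimately have "sform E d (amap E k m) (amap E k n) =
      (\<Sum>i\<in>UNIV. m i * (\<Sum>j\<in>UNIV. n j * (mutE k E i j / d j)))" by simp
  then show ?thesis
    unfolding sform_def[of "mutE k E"] by (simp add: sum_distrib_left mult.assoc)
qed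

end

lemma sform_nege: "sform (nege E) d m n = - sform E d m n"
  by (simp add: sform_def nege_def sum_negf)

text \<open>Matrix mutation commutes with negation, so both base changes induce the same form; the
  sign can be chosen according to the side of the wall.\<close>

lemma (in exchange) sform_mutE': "sform (mutE k E) d m n = sform E d (amap (nege E) k m) (amap (nege E) k n)"
  using exchange.sform_mutE[OF exchange_nege[OF exchange_axioms], of k m n]
  by (simp add: mutE_nege sform_nege)

lemma (in exchange) exchange_mutE: "exchange (mutE k E) d"
proof
  fix i j
  show "0 < d i" using d_pos .
  have "sform (mutE k E) d (axis_vec i 1) (axis_vec j 1) = mutE k E i j / d j" for i j
  proof -
    have "sform (mutE k E) d (axis_vec i 1) (axis_vec j 1) =
       (\<Sum>i'\<in>UNIV. \<Sum>j'\<in>UNIV. if j' = j then (if i' = i then mutE k E i j / d j else 0) else 0)"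
      unfolding sform_def by (intro sum.cong) (auto simp: axis_vec_apply)
    then show ?thesis by simp
  qed
  then have "mutE k E i j / d j = - (mutE k E j i / d i)"
    using sform_mutE om_skew by metis
  then show "d i * mutE k E i j = - (d j * mutE k E j i)"
    using d_pos[of i] d_pos[of j] by (simp add: field_simps)
qed

lemma nege_mutE_col: "nege (mutE k E) i k = E i k" "mutE k E i k = - E i k"
  by (simp_all add: nege_def mutE_def)

lemma colpos_mutE: "colpos (nege (mutE k E)) k = colpos E k" "colpos (mutE k E) k = colpos (nege E) k"
  by (simp_all add: colpos_def fun_eq_iff nege_mutE_col nege_def)

lemma colsum_mutE: "colsum (mutE k E) k n = - colsum E k n"
  by (simp add: colsum_def nege_mutE_col sum_negf)

lemma amap_mutE: "amap (nege (mutE k E)) k = amap E k" "amap (mutE k E) k = amap (nege E) k"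
  by (simp_all add: amap_def colpos_mutE fun_eq_iff)

text \<open>The involution \<open>A\<close> need not preserve nonnegativity, but \<open>S\<close>
  and its preimage both consist of nonnegative exponents, and the convolution only sees
  these.\<close>

lemma qmul_transport:
  fixes A :: "('i::finite \<Rightarrow> int) \<Rightarrow> ('i \<Rightarrow> int)"
  assumes A: "\<And>m n. A (m + n) = A m + A n" "\<And>n. A (A n) = n"
    and om: "\<And>m n. om' m n = om (A m) (A n)"
    and S: "S \<subseteq> {0..}" "A -` S \<subseteq> {0..}"
    and f: "supp_in f S" "supp_in g S"
  shows "qmul om' (f \<circ> A) (g \<circ> A) = qmul om f g \<circ> A"
proof
  fix n
  have Ad: "A (n - m) = A n - A m" for m n using A(1)[of "n - m" m] by simp
  have "supp_in (f \<circ> A) (A -` S)" "supp_in (g \<circ> A) (A -` S)" using f by (auto simp: supp_in_def)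
  then have "qmul om' (f \<circ> A) (g \<circ> A) n =
      (\<Sum>m | m \<in> A -` S \<and> n - m \<in> A -` S. exp (om' m (n - m)) * (f \<circ> A) m * (g \<circ> A) (n - m))"
    using S by (intro qmul_supp_sum)
  also have "\<dots> = (\<Sum>m | m \<in> S \<and> A n - m \<in> S. exp (om m (A n - m)) * f m * g (A n - m))"
    by (rule sum.reindex_bij_witness[of _ A A]) (auto simp: A(2) om Ad)
  also have "\<dots> = qmul om f g (A n)"
    using f S by (intro qmul_supp_sum[symmetric])
  finally show "qmul om' (f \<circ> A) (g \<circ> A) n = (qmul om f g \<circ> A) n" by simp
qed

lemma supp_in_comp: "supp_in f S \<Longrightarrow> supp_in (f \<circ> A) (A -` S)"
  by (auto simp: supp_in_def)

lemma factors_transport: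
  fixes A :: "('i::finite \<Rightarrow> int) \<Rightarrow> ('i \<Rightarrow> int)"
  assumes A: "\<And>m n. A (m + n) = A m + A n" "\<And>n. A (A n) = n"
    and om: "\<And>m n. om' m n = om (A m) (A n)" and x: "\<And>n. x' n = x (A n)"
    and S: "S \<subseteq> {0..}" "A -` S \<subseteq> {0..}" "\<And>a b. a \<in> S \<Longrightarrow> b \<in> S \<Longrightarrow> a + b \<in> S"
    and F: "factors om x S f a b c"
  shows "factors om' x' (A -` S) (f \<circ> A) (a \<circ> A) (b \<circ> A) (c \<circ> A)"
proof -
  note supp = factors_supp[OF F]
  have A0: "A 0 = 0" using A(1)[of 0 0] by simp
  have A0': "A n = 0 \<longleftrightarrow> n = 0" for n using A(2)[of n] A0 by metis
  have "f \<circ> A = qmul om' (a \<circ> A) (qmul om' (b \<circ> A) (c \<circ> A))"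
    using F supp supp_in_qmul[OF supp(2,3) S(3)]
    by (simp add: factors_def qmul_transport[where om = om and om' = om' and S = S, OF A om S(1,2)])
  then show ?thesis
    using F by (auto simp: factors_def supp_in_def A0 A0' x)
qed

lemma att_transport:
  fixes A :: "('i::finite \<Rightarrow> int) \<Rightarrow> ('i \<Rightarrow> int)"
  assumes A: "\<And>m n. A (m + n) = A m + A n" "\<And>n. A (A n) = n"
    and om: "\<And>m n. om' m n = om (A m) (A n)" and lam: "\<And>n. lam (A n) = lam n"
    and S: "S \<subseteq> {0..}" "A -` S \<subseteq> {0..}" "\<And>a b. a \<in> S \<Longrightarrow> b \<in> S \<Longrightarrow> a + b \<in> S"
    and G: "graded_qtorus om lam" "graded_qtorus om' lam"
    and att: "graded_qtorus.att om lam S f (A n) v"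
  shows "graded_qtorus.att om' lam (A -` S) (f \<circ> A) n v"
proof -
  obtain a b c w where F: "factors om (om (A n)) S f a b c"
    and w: "supp_in w {m \<in> S. om (A n) m = 0}" "der lam b = qmul om b w" "w (A n) = v"
    using att unfolding graded_qtorus.att_def[OF G(1)] by blast
  have F': "factors om' (om' n) (A -` S) (f \<circ> A) (a \<circ> A) (b \<circ> A) (c \<circ> A)"
    by (rule factors_transport[OF A om _ S F]) (simp add: om)
  have wS: "supp_in w S" using w(1) by (auto simp: supp_in_def)
  have "der lam (b \<circ> A) = der lam b \<circ> A" by (auto simp: der_def lam)
  also have "\<dots> = qmul om' (b \<circ> A) (w \<circ> A)"
    unfolding w(2) by (rule qmul_transport[where om = om and om' = om' and A = A, OF A om S(1,2) factors_supp(2)[OF F] wS, symmetric])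
  finally have "der lam (b \<circ> A) = qmul om' (b \<circ> A) (w \<circ> A)" .
  moreover have "supp_in (w \<circ> A) {m \<in> A -` S. om' n m = 0}"
    using w(1) by (auto simp: supp_in_def om)
  ultimately show ?thesis
    unfolding graded_qtorus.att_def[OF G(2)] using F' w(3)
    by (intro exI[of _ "a \<circ> A"] exI[of _ "b \<circ> A"] exI[of _ "c \<circ> A"] exI[of _ "w \<circ> A"]) simp
qed

lemma (in exchange) vimage_slab: "amap E k -` slab E k = slab E k"
proof -
  have "amap E k n \<in> slab E k" if "n \<in> slab E k" for n
    using that by (auto simp: slab_def colpos_amap) (auto simp: le_fun_def amap_apply)
  then show ?thesis by (auto simp: set_eq_iff) (metis amap_amap)
qed

lemma slab_mutE: "slab (nege (mutE k E)) k = slab E k" "slab (mutE k E) k = slab (nege E) k"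
  by (simp_all add: slab_def colpos_mutE)

text \<open>Positive multiples of \<open>e_i\<close> with \<open>i \<noteq> k\<close> on this side
  have \<open>E i k \<le> 0\<close> and are fixed by the base change, so the prescribed walls are
  the same for both seeds.\<close>

lemma (in exchange) wall_data_amap:
  assumes "colsum E k n \<le> 0" "0 < lamJ k n"
  shows "wall_data d (amap E k n) = wall_data d n"
proof -
  have ax: "amap E k (axis_vec i a) = axis_vec i a" if "i \<noteq> k" "0 < a" "colsum E k (axis_vec i a) \<le> 0" for i a
  proof -
    have "E i k \<le> 0" using that by (simp add: colsum_axis mult_le_0_iff)
    then show ?thesis using that(1) by (auto simp: amap_def colpos_axis fun_eq_iff axis_vec_apply)
  qed
  show ?thesis
  proof (cases "wall_data d n = 0 \<and> wall_data d (amap E k n) = 0")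
    case False
    then consider i a where "0 < a" "n = axis_vec i a" | i a where "0 < a" "amap E k n = axis_vec i a"
      by (metis wall_data_neq_0)
    then show ?thesis
    proof cases
      case (1 i a)
      then show ?thesis using ax[of i a] assms by (auto simp: lamJ_axis split: if_splits)
    next
      case (2 i a)
      then have "amap E k (axis_vec i a) = axis_vec i a"
        using ax[of i a] assms lamJ_amap[of k E n] colsum_amap[of k E n]
        by (auto simp: lamJ_axis split: if_splits)
      then show ?thesis using 2 by (metis amap_amap)
    qed
  qed simp
qed

text \<open>Mutation negates \<open>colsum\<close>, which makes the two series exchange roles. The
  two base changes differ by a shift by \<open>colsum\<close> along \<open>e_k\<close>; reversing
  the conjugation sums absorbs it, because \<open>rho\<close> is palindromic.\<close>

lemma (in exchange) slab_pair_mutate: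
  assumes "slab_pair E d k h' h"
  shows "slab_pair (mutE k E) d k (h \<circ> amap E k) (h' \<circ> amap (nege E) k)"
proof -
  interpret N: exchange "nege E" d by (rule exchange_nege[OF exchange_axioms])
  interpret M: exchange "mutE k E" d by (rule exchange_mutE)
  let ?A = "amap E k" and ?A' = "amap (nege E) k"
  have AA': "?A n = ?A' n + axis_vec k (colsum E k n)" for n
    using colpos_nege[of E k n] by (auto simp: fun_eq_iff amap_apply axis_vec_apply)
  have Ad: "?A (n - axis_vec k a) = ?A n + axis_vec k a" "?A' (n - axis_vec k a) = ?A' n + axis_vec k a" for n a
    by (auto simp: fun_eq_iff amap_apply axis_vec_apply colpos_diff colpos_axis nege_def)
  note P = assms[unfolded slab_pair_def]
  have P1: "graded_qtorus.att (sform E d) (lamJ k) (slab (nege E) k) h' n (lamJ k n * wall_data d n)"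
    if "0 < lamJ k n" "0 < colsum E k n" for n using P that by blast
  have P2: "graded_qtorus.att (sform E d) (lamJ k) (slab E k) h n (lamJ k n * wall_data d n)"
    if "0 < lamJ k n" "colsum E k n < 0" for n using P that by blast
  have attA: "graded_qtorus.att (sform (mutE k E) d) (lamJ k) (slab E k) (h \<circ> ?A) n (lamJ k n * wall_data d n)"
    if "graded_qtorus.att (sform E d) (lamJ k) (slab E k) h (?A n) (lamJ k (?A n) * wall_data d (?A n))"
      "colsum E k n \<le> 0" "0 < lamJ k n" for n
    using att_transport[of ?A "sform (mutE k E) d" "sform E d" "lamJ k" "slab E k" h n, OF amap_add amap_amap
        sform_mutE lamJ_amap slab_nonneg _ slab_add graded_J M.graded_J that(1)]
    by (simp add: vimage_slab slab_nonneg wall_data_amap[OF that(2,3)])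
  have attA': "graded_qtorus.att (sform (mutE k E) d) (lamJ k) (slab (nege E) k) (h' \<circ> ?A') n (lamJ k n * wall_data d n)"
    if "graded_qtorus.att (sform E d) (lamJ k) (slab (nege E) k) h' (?A' n) (lamJ k (?A' n) * wall_data d (?A' n))"
      "0 \<le> colsum E k n" "0 < lamJ k n" for n
  proof -
    have "colsum (nege E) k n \<le> 0" using that(2) by (simp add: colsum_def nege_def sum_negf)
    then show ?thesis
    using att_transport[of ?A' "sform (mutE k E) d" "sform E d" "lamJ k" "slab (nege E) k" h' n, OF amap_add N.amap_amap
        sform_mutE' lamJ_amap slab_nonneg _ slab_add graded_J M.graded_J that(1)]
    by (simp add: N.vimage_slab slab_nonneg N.wall_data_amap[OF _ that(3)])
  qed
  have rev: "(\<Sum>i\<le>b. coeff (rho (d k) b) i * f (int b - int i)) = (\<Sum>i\<le>b. coeff (rho (d k) b) i * f (int i))"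
    for b and f :: "int \<Rightarrow> real"
    by (rule sum.reindex_bij_witness[of _ "\<lambda>i. b - i" "\<lambda>i. b - i"]) (auto simp: coeff_rho_sym of_nat_diff)
  show ?thesis
    unfolding slab_pair_def slab_mutE colsum_mutE
  proof (intro conjI allI impI)
    show "supp_in (h \<circ> ?A) (slab E k)"
      using P supp_in_comp[of h "slab E k" ?A] by (simp add: vimage_slab)
    show "supp_in (h' \<circ> ?A') (slab (nege E) k)"
      using P supp_in_comp[of h' "slab (nege E) k" ?A'] by (simp add: N.vimage_slab)
    show "(h \<circ> ?A) 0 = 1" "(h' \<circ> ?A') 0 = 1" using P by simp_all
  next
    fix n assume n: "0 \<le> - colsum E k n"
    let ?b = "nat (- colsum E k n)"
    have B: "colsum E k (?A' n) = colsum E k n" by (rule colsum_amap)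
    have "h' (?A' n) = (\<Sum>i\<le>?b. coeff (rho (d k) ?b) i * h (?A' n - axis_vec k (int i)))"
      using P n B by auto
    also have "\<dots> = (\<Sum>i\<le>?b. coeff (rho (d k) ?b) i * h (?A n + axis_vec k (int ?b - int i)))"
    proof -
      have "?A' n - axis_vec k (int i) = ?A n + axis_vec k (int ?b - int i)" for i
        unfolding AA' using n by (auto simp: fun_eq_iff axis_vec_apply)
      then show ?thesis by simp
    qed
    also have "\<dots> = (\<Sum>i\<le>?b. coeff (rho (d k) ?b) i * h (?A n + axis_vec k (int i)))"
      by (rule rev[of _ "\<lambda>i. h (?A n + axis_vec k i)"])
    finally show "(h' \<circ> ?A') n = (\<Sum>i\<le>?b. coeff (rho (d k) ?b) i * (h \<circ> ?A) (n - axis_vec k (int i)))"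
      by (simp add: Ad)
  next
    fix n assume n: "- colsum E k n \<le> 0"
    let ?b = "nat (- (- colsum E k n))"
    have B: "colsum E k (?A n) = colsum E k n" by (rule colsum_amap)
    have "h (?A n) = (\<Sum>i\<le>?b. coeff (rho (d k) ?b) i * h' (?A n - axis_vec k (int i)))"
      using P n B by auto
    also have "\<dots> = (\<Sum>i\<le>?b. coeff (rho (d k) ?b) i * h' (?A' n + axis_vec k (int ?b - int i)))"
    proof -
      have "?A n - axis_vec k (int i) = ?A' n + axis_vec k (int ?b - int i)" for i
        unfolding AA' using n by (auto simp: fun_eq_iff axis_vec_apply)
      then show ?thesis by simp
    qed
    also have "\<dots> = (\<Sum>i\<le>?b. coeff (rho (d k) ?b) i * h' (?A' n + axis_vec k (int i)))"
      by (rule rev[of _ "\<lambda>i. h' (?A' n + axis_vec k i)"])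
    finally show "(h \<circ> ?A) n = (\<Sum>i\<le>?b. coeff (rho (d k) ?b) i * (h' \<circ> ?A') (n - axis_vec k (int i)))"
      by (simp add: Ad)
  next
    fix n assume n: "0 < lamJ k n" "0 < - colsum E k n"
    then have "colsum E k (?A n) < 0" "0 < lamJ k (?A n)" by (simp_all add: colsum_amap)
    then show "graded_qtorus.att (sform (mutE k E) d) (lamJ k) (slab E k) (h \<circ> ?A) n (lamJ k n * wall_data d n)"
      using n by (intro attA P2) auto
  next
    fix n assume n: "0 < lamJ k n" "- colsum E k n < 0"
    then have "0 < colsum E k (?A' n)" "0 < lamJ k (?A' n)" by (simp_all add: colsum_amap)
    then show "graded_qtorus.att (sform (mutE k E) d) (lamJ k) (slab (nege E) k) (h' \<circ> ?A') n (lamJ k n * wall_data d n)"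
      using n by (intro attA' P1) auto
  next
    fix n assume n: "0 < lamJ k n" "- colsum E k n = 0"
    then have "?A n = ?A' n" using AA'[of n] by simp
    moreover have "colsum E k (?A n) = 0" "0 < lamJ k (?A n)" using n by (simp_all add: colsum_amap)
    then have "graded_qtorus.att (sform E d) (lamJ k) (slab (nege E) k) h' (?A n) (lamJ k (?A n) * wall_data d (?A n)) \<or>
           graded_qtorus.att (sform E d) (lamJ k) (slab E k) h (?A n) (lamJ k (?A n) * wall_data d (?A n))"
      using P by blast
    ultimately show "graded_qtorus.att (sform (mutE k E) d) (lamJ k) (slab E k) (h \<circ> ?A) n (lamJ k n * wall_data d n) \<or>
       graded_qtorus.att (sform (mutE k E) d) (lamJ k) (slab (nege E) k) (h' \<circ> ?A') n (lamJ k n * wall_data d n)"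
      using attA[of n] attA'[of n] n by auto
  qed
qed

subsection \<open>The cluster scattering diagram\<close>

lemma qmul_add_right_fun: "qmul om h (\<lambda>n. f n + g n) = (\<lambda>n. qmul om h f n + qmul om h g n)"
  by (rule ext) (rule qmul_add_right)

section \<open>Effect on the walls of multiplying by a further factor\<close>

context graded_qtorus
begin

abbreviation T where "T \<equiv> gcone lam"

lemma T_mul_one: "supp_in f T \<Longrightarrow> qone \<odot> f = f" "supp_in f T \<Longrightarrow> f \<odot> qone = f"
  using mul_one_left mul_one_right supp_in_mono[OF _ gcone_nonneg] by blast+

text \<open>Write \<open>a = 1 + b\<close>. Conjugation fixes 1, and \<open>b\<close> keeps its
  positive degrees because \<open>u\<close> and \<open>v\<close> have degree zero for
  \<open>x\<close>.\<close>

lemma supp_conjugate: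
  fixes x :: "('i \<Rightarrow> int) \<Rightarrow> real"
  assumes x: "additive x"
    and u: "supp_in u {m \<in> T. x m = 0}" "supp_in v {m \<in> T. x m = 0}" "u \<odot> v = qone"
    and a: "supp_in a {m \<in> T. m = 0 \<or> 0 < x m}" "a 0 = 1"
  shows "supp_in (u \<odot> (a \<odot> v)) {m \<in> T. m = 0 \<or> 0 < x m}" "(u \<odot> (a \<odot> v)) 0 = 1"
proof -
  define b where "b n = a n - qone n" for n
  have ab: "a = (\<lambda>n. b n + qone n)" by (auto simp: b_def)
  have b: "supp_in b {m \<in> T. 0 < x m}"
    using a by (auto simp: supp_in_def b_def qone_def)
  have vT: "supp_in v T" using u by (auto simp: supp_in_def)
  have "a \<odot> v = (\<lambda>n. (b \<odot> v) n + v n)"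
    unfolding ab by (rule ext) (simp only: qmul_add_left T_mul_one(1)[OF vT])
  then have eq: "u \<odot> (a \<odot> v) = (\<lambda>n. (u \<odot> (b \<odot> v)) n + qone n)"
    by (auto simp: qmul_add_right u(3))
  have "supp_in (b \<odot> v) {m \<in> T. 0 < x m}"
    by (rule supp_in_qmul[OF b u(2)]) (auto simp: gcone_add additive.add[OF x])
  then have "supp_in (u \<odot> (b \<odot> v)) {m \<in> T. 0 < x m}"
    by (rule supp_in_qmul[OF u(1)]) (auto simp: gcone_add additive.add[OF x])
  then show "supp_in (u \<odot> (a \<odot> v)) {m \<in> T. m = 0 \<or> 0 < x m}"
    unfolding eq by (auto simp: supp_in_def qone_def)
  have "(u \<odot> v) 0 = 1" unfolding u(3) by simp
  then show "(u \<odot> (a \<odot> v)) 0 = 1" using a(2) by simp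
qed

text \<open>In \<open>u f = (u a u^-1) (u b) c\<close> the new wall element is \<open>u b\<close>,
  with logarithmic derivative \<open>b^-1 wu b + w\<close>; the trace property removes the
  conjugation in degree \<open>n\<close>. On the right one uses \<open>a (b u) (u^-1 c u)\<close>
  instead.\<close>

lemma att_mul_zero:
  assumes att: "att T f n v"
    and u: "supp_in u {m \<in> T. om n m = 0}" "u 0 = 1"
    and wu: "supp_in wu {m \<in> T. om n m = 0}" "der lam u = u \<odot> wu"
  shows "att T (u \<odot> f) n (wu n + v)" "att T (f \<odot> u) n (wu n + v)"
proof -
  obtain a b c w where F: "factors om (om n) T f a b c"
    and w: "supp_in w {m \<in> T. om n m = 0}" "der lam b = b \<odot> w" "w n = v"
    using att unfolding att_def by blast
  let ?Z = "{m \<in> T. om n m = 0}"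
  have Z: "?Z \<subseteq> T" "0 \<in> ?Z" "\<And>a b. a \<in> ?Z \<Longrightarrow> b \<in> ?Z \<Longrightarrow> a + b \<in> ?Z"
    by (auto simp: gcone_add om_add_right)
  have mulZ: "supp_in (f \<odot> g) ?Z" if "supp_in f ?Z" "supp_in g ?Z" for f g
    using that Z(3) by (rule supp_in_qmul)
  have ZT: "supp_in f T" if "supp_in f ?Z" for f using that Z(1) by (rule supp_in_mono)
  have Z0: "supp_in f {m. om n m = 0}" if "supp_in f ?Z" for f using that by (auto simp: supp_in_def)
  have b: "supp_in b ?Z" "b 0 = 1" and f: "f = a \<odot> (b \<odot> c)"
    and a: "supp_in a {m \<in> T. m = 0 \<or> 0 < om n m}" "a 0 = 1"
    and c: "supp_in c {m \<in> T. m = 0 \<or> om n m < 0}" "c 0 = 1"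
    using F by (auto simp: factors_def)
  have T: "supp_in a T" "supp_in b T" "supp_in c T" using factors_supp[OF F] .
  obtain ui where ui: "supp_in ui ?Z" "ui 0 = 1" "u \<odot> ui = qone" "ui \<odot> u = qone"
    using mul_inverse[OF Z u] by blast
  obtain bi where bi: "supp_in bi ?Z" "bi 0 = 1" "b \<odot> bi = qone" "bi \<odot> b = qone"
    using mul_inverse[OF Z b] by blast
  have plus: "supp_in (\<lambda>n. f n + g n) ?Z" if "supp_in f ?Z" "supp_in g ?Z" for f g :: "_ \<Rightarrow> real"
    unfolding supp_in_def by (metis (no_types, lifting) add.right_neutral supp_inD that)
  have can: "u \<odot> (ui \<odot> y) = y" "ui \<odot> (u \<odot> y) = y" "b \<odot> (bi \<odot> y) = y" if "supp_in y T" for y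
    using that by (simp_all add: mul_assoc[symmetric] ui bi T_mul_one)
  show "att T (u \<odot> f) n (wu n + v)"
    unfolding att_def
  proof (intro exI conjI)
    have "u \<odot> f = (u \<odot> (a \<odot> ui)) \<odot> ((u \<odot> b) \<odot> c)"
      by (simp add: f mul_assoc can supp_in_gcone_qmul T)
    then show "factors om (om n) T (u \<odot> f) (u \<odot> (a \<odot> ui)) (u \<odot> b) c"
      unfolding factors_def
      using supp_conjugate[OF additive_om u(1) ui(1,3) a] mulZ[OF u(1) b(1)] c u(2) b(2) by simp
    show "supp_in (\<lambda>m. (bi \<odot> (wu \<odot> b)) m + w m) ?Z"
      by (intro plus mulZ bi wu b w)
    show "der lam (u \<odot> b) = (u \<odot> b) \<odot> (\<lambda>m. (bi \<odot> (wu \<odot> b)) m + w m)"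
      by (rule ext) (simp add: der_mul[OF additive_lam] wu(2) w(2) qmul_add_right mul_assoc can
          supp_in_gcone_qmul T ZT[OF wu(1)] qmul_add_right_fun)
    have "(bi \<odot> (wu \<odot> b)) n = ((wu \<odot> b) \<odot> bi) n"
      by (rule mul_trace; rule Z0; intro mulZ bi wu b)
    also have "\<dots> = wu n" by (simp add: mul_assoc bi T_mul_one ZT[OF wu(1)])
    finally show "(bi \<odot> (wu \<odot> b)) n + w n = wu n + v" by (simp add: w)
  qed
  have add': "additive (\<lambda>m. - om n m)" by (simp add: additive_def om_add_right)
  show "att T (f \<odot> u) n (wu n + v)"
    unfolding att_def
  proof (intro exI conjI)
    have "f \<odot> u = a \<odot> ((b \<odot> u) \<odot> (ui \<odot> (c \<odot> u)))"
      by (simp add: f mul_assoc can supp_in_gcone_qmul T ZT[OF u(1)])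
    moreover have "supp_in (ui \<odot> (c \<odot> u)) {m \<in> T. m = 0 \<or> om n m < 0}" "(ui \<odot> (c \<odot> u)) 0 = 1"
      using supp_conjugate[OF add', of ui u c] u ui c by auto
    ultimately show "factors om (om n) T (f \<odot> u) a (b \<odot> u) (ui \<odot> (c \<odot> u))"
      unfolding factors_def using a mulZ[OF b(1) u(1)] u(2) b(2) by simp
    show "supp_in (\<lambda>m. (ui \<odot> (w \<odot> u)) m + wu m) ?Z"
      by (intro plus mulZ ui wu u w)
    show "der lam (b \<odot> u) = (b \<odot> u) \<odot> (\<lambda>m. (ui \<odot> (w \<odot> u)) m + wu m)"
      by (rule ext) (simp add: der_mul[OF additive_lam] wu(2) w(2) qmul_add_right mul_assoc can
          supp_in_gcone_qmul T ZT[OF w(1)] ZT[OF u(1)] qmul_add_right_fun)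
    have "(ui \<odot> (w \<odot> u)) n = ((w \<odot> u) \<odot> ui) n"
      by (rule mul_trace; rule Z0; intro mulZ ui u w)
    also have "\<dots> = w n" by (simp add: mul_assoc ui T_mul_one ZT[OF w(1)])
    finally show "(ui \<odot> (w \<odot> u)) n + wu n = wu n + v" by (simp add: w)
  qed
qed

lemma supp_mul_pos:
  fixes x :: "('i \<Rightarrow> int) \<Rightarrow> real"
  assumes "additive x" "supp_in a {m \<in> T. m = 0 \<or> 0 < x m}" "supp_in b {m \<in> T. m = 0 \<or> 0 < x m}"
  shows "supp_in (a \<odot> b) {m \<in> T. m = 0 \<or> 0 < x m}"
  using assms(2,3) by (rule supp_in_qmul) (auto simp: gcone_add additive.add[OF assms(1)] additive.zero[OF assms(1)])

lemma supp_mul_neg: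
  fixes x :: "('i \<Rightarrow> int) \<Rightarrow> real"
  assumes "additive x" "supp_in a {m \<in> T. m = 0 \<or> x m < 0}" "supp_in b {m \<in> T. m = 0 \<or> x m < 0}"
  shows "supp_in (a \<odot> b) {m \<in> T. m = 0 \<or> x m < 0}"
  using assms(2,3) by (rule supp_in_qmul) (auto simp: gcone_add additive.add[OF assms(1)] additive.zero[OF assms(1)])

lemma factors_mul_left_pos:
  fixes x :: "('i \<Rightarrow> int) \<Rightarrow> real"
  assumes "additive x" "factors om x T f a b c" "supp_in u {m \<in> T. m = 0 \<or> 0 < x m}" "u 0 = 1"
  shows "factors om x T (u \<odot> f) (u \<odot> a) b c"
  using assms supp_mul_pos[OF assms(1,3)] by (simp add: factors_def mul_assoc)

lemma factors_mul_right_neg: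
  fixes x :: "('i \<Rightarrow> int) \<Rightarrow> real"
  assumes "additive x" "factors om x T f a b c" "supp_in u {m \<in> T. m = 0 \<or> x m < 0}" "u 0 = 1"
  shows "factors om x T (f \<odot> u) a b (c \<odot> u)"
  using assms supp_mul_neg[OF assms(1) _ assms(3)] by (simp add: factors_def mul_assoc)

lemma att_mul_left_pos:
  assumes "att T f n v" "supp_in u {m \<in> T. m = 0 \<or> 0 < om n m}" "u 0 = 1"
  shows "att T (u \<odot> f) n v"
  using assms(1) factors_mul_left_pos[OF additive_om _ assms(2,3)] unfolding att_def by blast

lemma att_mul_right_neg:
  assumes "att T f n v" "supp_in u {m \<in> T. m = 0 \<or> om n m < 0}" "u 0 = 1"
  shows "att T (f \<odot> u) n v"
  using assms(1) factors_mul_right_neg[OF additive_om _ assms(2,3)] unfolding att_def by blast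

text \<open>With trivial middle factor the outer factors inherit the support of \<open>f\<close>: at
  an exponent outside \<open>S\<close> of least degree the product has coefficient
  \<open>a n + c n = 0\<close>, while the sign of \<open>x n\<close> allows only one of the two to
  be nonzero. Thus a factorization in the full cone descends to a slab.\<close>

lemma factors_one_supp:
  fixes x :: "('i \<Rightarrow> int) \<Rightarrow> real"
  assumes F: "factors om x T f a qone c" and f: "supp_in f S"
    and S: "S \<subseteq> T" "0 \<in> S" "\<And>a b. a \<in> S \<Longrightarrow> b \<in> S \<Longrightarrow> a + b \<in> S"
  shows "factors om x S f a qone c"
proof -
  note supp = factors_supp[OF F]
  have fac: "f = a \<odot> c" using F T_mul_one(1)[OF supp(3)] by (simp add: factors_def)
  have one: "a 0 = 1" "c 0 = 1" using F by (auto simp: factors_def)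
  have zero: "a n = 0 \<and> c n = 0" if "n \<notin> S" for n
    using that
  proof (induction "nat (lam n)" arbitrary: n rule: less_induct)
    case less
    show ?case
    proof (cases "n \<in> T")
      case False
      then show ?thesis using supp by (simp add: supp_inD)
    next
      case True
      then have n: "0 < lam n" "n \<noteq> 0" using less(2) S by (auto simp: gcone_def)
      define a' where "a' m = (if m \<in> S then a m else 0)" for m
      define c' where "c' m = (if m \<in> S then c m else 0)" for m
      have S': "supp_in a' S" "supp_in c' S" by (auto simp: supp_in_def a'_def c'_def)
      have "(a \<odot> c) n - (a' \<odot> c') n = (a n - a' n) * c 0 + a 0 * (c n - c' n)"
        by (rule mul_diff_top)
          (use supp S' supp_in_mono[OF _ S(1)] n less(1) in \<open>auto simp: a'_def c'_def\<close>)
      moreover have "(a' \<odot> c') n = 0" using supp_in_qmul[OF S' S(3)] less(2) by (rule supp_inD)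
      moreover have "(a \<odot> c) n = 0" using f less(2) fac by (metis supp_inD)
      ultimately have "a n + c n = 0" using one less(2) by (simp add: a'_def c'_def)
      moreover have "a n \<noteq> 0 \<Longrightarrow> 0 < x n" "c n \<noteq> 0 \<Longrightarrow> x n < 0"
        using F n by (auto simp: factors_def supp_in_def)
      ultimately show ?thesis by force
    qed
  qed
  have "x 0 = 0" using F by (auto simp: factors_def supp_in_def)
  then show ?thesis
    using F zero S(2) unfolding factors_def by (auto simp: supp_in_def qone_def)
qed

end

text \<open>The prescribed values are those of the incoming walls; the factor \<open>lamT n\<close>
  converts coefficients of a logarithm into those of its logarithmic derivative.\<close>

definition is_diagram :: "('i::finite \<Rightarrow> 'i \<Rightarrow> int) \<Rightarrow> ('i \<Rightarrow> real) \<Rightarrow> (('i \<Rightarrow> int) \<Rightarrow> real) \<Rightarrow> bool" where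
  "is_diagram E d g \<longleftrightarrow> supp_in g {0..} \<and> g 0 = 1 \<and>
     (\<forall>n\<in>gcone lamT. n \<noteq> 0 \<longrightarrow> graded_qtorus.att (sform E d) lamT (gcone lamT) g n (lamT n * wall_data d n))"

lemma der_emb_dilog: "der (\<lambda>n. real_of_int (lamT n)) (emb k F) = emb k (fps_X * fps_deriv F)"
proof
  fix n
  have "lamT n * fps_nth F (nat (n k)) = fps_nth (fps_X * fps_deriv F) (nat (n k))"
    if n: "0 \<le> n k" "n = axis_vec k (n k)"
  proof -
    have "lamT n = n k" by (subst n(2)) (simp add: lamT_axis)
    then show ?thesis using n(1) by (cases "nat (n k)") auto
  qed
  then show "der (\<lambda>n. real_of_int (lamT n)) (emb k F) n = emb k (fps_X * fps_deriv F) n"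
    by (auto simp: der_def emb_def)
qed

lemma emb_supp_gcone:
  fixes k :: "'i::finite"
  shows "supp_in (emb k F) {m \<in> gcone lamT. \<exists>a\<ge>0. m = axis_vec k a}"
proof -
  have "0 \<le> n" if "0 \<le> n k" "n = axis_vec k (n k)" for n :: "'i \<Rightarrow> int"
    using that by (metis axis_vec_nonneg_iff)
  then show ?thesis
    by (auto simp: supp_in_def emb_def gcone_lamT)
qed

context exchange
begin

abbreviation emul (infixl "\<odot>" 70) where "f \<odot> g \<equiv> qmul (sform E d) f g"

text \<open>Slabs are graded by \<open>lamJ k\<close>, the whole diagram by \<open>lamT\<close>.
  Both attached values are the same coefficient of a logarithm times the respective degree.\<close>

lemma att_change_degree:
  fixes v :: real
  assumes att: "graded_qtorus.att (sform E d) (lamJ k) S f n v" and S: "S \<subseteq> {0..}"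
  obtains v' :: real where "graded_qtorus.att (sform E d) lamT (gcone lamT) f n v'" "lamJ k n * v' = lamT n * v"
proof -
  interpret J: graded_qtorus "sform E d" "lamJ k" by (rule graded_J)
  interpret T: graded_qtorus "sform E d" lamT by (rule graded_T)
  have S': "S \<subseteq> gcone lamT" using S by (simp add: gcone_lamT)
  obtain a b c w where F: "factors (sform E d) (sform E d n) S f a b c"
    and w: "supp_in w {m \<in> S. sform E d n m = 0}" "der (lamJ k) b = b \<odot> w" "w n = v"
    using att unfolding J.att_def by blast
  let ?Z = "{m \<in> gcone lamT. sform E d n m = 0}"
  have F': "factors (sform E d) (sform E d n) (gcone lamT) f a b c"
    using F S' by (rule factors_mono)
  have b: "supp_in b ?Z" "b 0 = 1" using F' by (auto simp: factors_def)
  have w1: "supp_in w ?Z" using w(1) S' by (auto simp: supp_in_def)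
  have "?Z \<subseteq> gcone lamT" "\<And>a b. a \<in> ?Z \<Longrightarrow> b \<in> ?Z \<Longrightarrow> a + b \<in> ?Z"
    by (auto simp: T.gcone_add om_add_right)
  then obtain w' where w': "supp_in w' ?Z" "b \<odot> w' = der lamT b"
    using T.left_division[OF _ _ b supp_in_der[OF b(1)]] by blast
  have "T.att (gcone lamT) f n (w' n)"
    unfolding T.att_def using F' w'(1) w'(2)[symmetric] by blast
  moreover have "lamJ k n * w' n = lamT n * w n"
    by (rule T.log_der_change_degree[OF factors_supp(2)[OF F'] b(2) w1 w'(1) J.additive_lam T.additive_lam
          w(2) w'(2)[symmetric]])
  ultimately show ?thesis using that w(3) by blast
qed

text \<open>The sign of \<open>colsum E k n\<close> is the sign of the exponents of \<open>u\<close>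
  under \<open>{n, _}\<close>. If positive, \<open>u\<close> joins the left factor and the wall is
  that of \<open>h'\<close>; if negative, \<open>u\<close> joins the right factor of
  \<open>h \<odot> u\<close> and the wall is that of \<open>h\<close>; if zero, the attached values
  add.\<close>

lemma slab_pair_is_diagram:
  assumes P: "slab_pair E d k h' h"
  defines "u \<equiv> emb k (dilog (d k))"
  shows "h \<odot> u = u \<odot> h'" "is_diagram E d (u \<odot> h')"
proof -
  interpret T: graded_qtorus "sform E d" lamT by (rule graded_T)
  note P' = P[unfolded slab_pair_def]
  have h': "supp_in h' (slab (nege E) k)" "h' 0 = 1" and h: "supp_in h (slab E k)" "h 0 = 1"
    using P' by auto
  have pos: "supp_in h' {0..}" "supp_in h {0..}"
    using h' h supp_in_mono[OF _ slab_nonneg] by blast+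
  show comm: "h \<odot> u = u \<odot> h'"
    unfolding u_def
    by (rule dilog_commutation[where B = "colsum E k", OF d_pos colsum_eq pos(2,1)]) (use P' in blast)+
  have u0: "u 0 = 1" by (simp add: u_def)
  have uT: "supp_in u {m \<in> gcone lamT. \<exists>a\<ge>0. m = axis_vec k a}"
    unfolding u_def by (rule emb_supp_gcone)
  define wu where "wu = emb k (dilog_beta (d k))"
  have wuT: "supp_in wu {m \<in> gcone lamT. \<exists>a\<ge>0. m = axis_vec k a}"
    unfolding wu_def by (rule emb_supp_gcone)
  have der_u: "der (\<lambda>n. real_of_int (lamT n)) u = u \<odot> wu"
    unfolding u_def wu_def der_emb_dilog emb_mul_emb dilog_beta ..
  have axis: "sform E d n (axis_vec k a) = a * colsum E k n / d k" for n a
    using colsum_eq[of k n] om_axis_right[of n k a] d_pos[of k] by simp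
  have uZ: "supp_in u {m \<in> gcone lamT. sform E d n m = 0}" "supp_in wu {m \<in> gcone lamT. sform E d n m = 0}"
    if "colsum E k n = 0" for n
    using uT wuT that by (auto intro: supp_in_mono simp: supp_in_def axis)
  have att_zero: "T.att (gcone lamT) (u \<odot> h') n (lamT n * wall_data d n)"
    if n: "colsum E k n = 0" "T.att (gcone lamT) h' n v \<or> T.att (gcone lamT) h n v"
      "wu n + v = lamT n * wall_data d n" for n v
    using n T.att_mul_zero[OF _ uZ(1)[OF n(1)] u0 uZ(2)[OF n(1)] der_u] comm by metis
  have "T.att (gcone lamT) (u \<odot> h') n (lamT n * wall_data d n)" if n: "n \<in> gcone lamT" "n \<noteq> 0" for n
  proof (cases "0 < lamJ k n")
    case True
    have wu0: "wu n = 0"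
    proof (rule ccontr)
      assume "wu n \<noteq> 0"
      then obtain a where "n = axis_vec k a" using wuT by (auto simp: supp_in_def)
      then show False using True by (simp add: lamJ_axis)
    qed
    have change: "T.att (gcone lamT) f n (lamT n * wall_data d n)"
      if A: "graded_qtorus.att (sform E d) (lamJ k) S f n (lamJ k n * wall_data d n)" "S \<subseteq> {0..}" for f S
    proof -
      obtain v' :: real where v': "T.att (gcone lamT) f n v'" "lamJ k n * v' = lamT n * (lamJ k n * wall_data d n)"
        using att_change_degree[OF A] .
      then have "v' = lamT n * wall_data d n" using True by simp
      then show ?thesis using v'(1) by simp
    qed
    consider "0 < colsum E k n" | "colsum E k n < 0" | "colsum E k n = 0" by linarith
    then show ?thesis
    proof cases
      case 1
      then have "T.att (gcone lamT) h' n (lamT n * wall_data d n)"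
        using P' True by (intro change[OF _ slab_nonneg]) blast
      moreover have "supp_in u {m \<in> gcone lamT. m = 0 \<or> 0 < sform E d n m}"
        using uT 1 d_pos[of k] by (auto simp: supp_in_def axis zero_less_mult_iff less_le)
      ultimately show ?thesis using u0 by (intro T.att_mul_left_pos)
    next
      case 2
      then have "T.att (gcone lamT) h n (lamT n * wall_data d n)"
        using P' True by (intro change[OF _ slab_nonneg]) blast
      moreover have "supp_in u {m \<in> gcone lamT. m = 0 \<or> sform E d n m < 0}"
        unfolding supp_in_def
      proof (intro allI impI)
        fix m assume "u m \<noteq> 0"
        then obtain a where a: "m \<in> gcone lamT" "0 \<le> a" "m = axis_vec k a"
          using uT by (auto simp: supp_in_def)
        then show "m \<in> {m \<in> gcone lamT. m = 0 \<or> sform E d n m < 0}"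
          using 2 d_pos[of k] by (cases "a = 0") (auto simp: axis divide_less_0_iff mult_less_0_iff)
      qed
      ultimately show ?thesis using u0 unfolding comm[symmetric] by (intro T.att_mul_right_neg)
    next
      case 3
      then have "graded_qtorus.att (sform E d) (lamJ k) (slab (nege E) k) h' n (lamJ k n * wall_data d n) \<or>
           graded_qtorus.att (sform E d) (lamJ k) (slab E k) h n (lamJ k n * wall_data d n)"
        using P' True by blast
      then have "T.att (gcone lamT) h' n (lamT n * wall_data d n) \<or> T.att (gcone lamT) h n (lamT n * wall_data d n)"
        using change[OF _ slab_nonneg] by blast
      then show ?thesis using 3 wu0 by (intro att_zero) auto
    qed
  next
    case False
    have n0: "0 \<le> n i" for i using n(1) by (auto simp: gcone_lamT le_fun_def)
    have "n i = 0" if "i \<noteq> k" for i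
    proof (rule ccontr)
      assume "n i \<noteq> 0"
      then have "0 < lamJ k n" unfolding lamJ_def
        using n0 n0[of i] that by (intro sum_pos2[of _ i]) (auto simp: less_le)
      then show False using False by simp
    qed
    then have ax: "n = axis_vec k (n k)" by (auto simp: axis_vec_def)
    then have a: "0 < n k" using n0[of k] n(2) by (metis axis_vec_0 less_le)
    have B: "colsum E k n = 0" by (subst ax) (simp add: colsum_axis)
    \<comment> \<open>A positive multiple of \<open>e_k\<close> lies outside the slab, so
      \<open>h'\<close> contributes 0 and the whole prescribed value comes from
      \<open>u\<close>.\<close>
    have "n \<notin> slab (nege E) k"
    proof -
      have "colpos (nege E) k n = 0" by (subst ax) (simp add: colpos_axis nege_def)
      then show ?thesis using a by (simp add: slab_def)
    qed
    moreover have S: "slab (nege E) k \<subseteq> gcone lamT" using slab_nonneg by (auto simp: gcone_lamT)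
    ultimately have "T.att (slab (nege E) k) h' n 0"
      using T.att_exists[OF S zero_in_slab slab_add h'] by metis
    then have "T.att (gcone lamT) h' n 0" using S by (rule T.att_mono)
    moreover have "wu n = lamT n * wall_data d n"
    proof -
      have "wu n = fps_nth (dilog_beta (d k)) (nat (n k))"
        by (subst ax) (use a in \<open>simp add: wu_def emb_axis\<close>)
      moreover have "lamT n = n k" by (subst ax) (simp add: lamT_axis)
      moreover have "wall_data d n = fps_nth (dilog_beta (d k)) (nat (n k)) / n k"
        by (subst ax) (rule wall_data_axis[OF a])
      ultimately show ?thesis using a by simp
    qed
    ultimately show ?thesis using B by (intro att_zero[of n 0]) auto
  qed
  moreover have "supp_in (u \<odot> h') {0..}"
    by (auto simp: supp_in_def) (metis qmul_eq_0_outside)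
  ultimately show "is_diagram E d (u \<odot> h')"
    using h'(2) u0 by (simp add: is_diagram_def)
qed

lemma is_diagram_unique: "is_diagram E d g \<Longrightarrow> is_diagram E d g' \<Longrightarrow> g = g'"
proof -
  assume g: "is_diagram E d g" "is_diagram E d g'"
  interpret T: graded_qtorus "sform E d" lamT by (rule graded_T)
  show ?thesis
    by (rule T.att_unique[where v = "\<lambda>n. lamT n * wall_data d n"])
      (use g in \<open>auto simp: is_diagram_def gcone_lamT\<close>)
qed

end

subsection \<open>Chambers and sign coherence\<close>

definition xev :: "('i::finite \<Rightarrow> real) \<Rightarrow> ('i \<Rightarrow> int) \<Rightarrow> real" where
  "xev x n = (\<Sum>i\<in>UNIV. n i * x i)"

lemma additive_xev: "additive (xev x)"
  by (simp add: additive_def xev_def sum.distrib distrib_right)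

lemma xev_axis: "xev x (axis_vec i a) = a * x i"
  by (simp add: xev_def axis_vec_apply if_distrib[of "\<lambda>y. real_of_int y * _"] cong: if_cong)

lemma xev_pos:
  assumes "\<And>i. 0 < x i" "0 \<le> n" "n \<noteq> 0"
  shows "0 < xev x n"
proof -
  obtain i where "n i \<noteq> 0" using \<open>n \<noteq> 0\<close> by (auto simp: fun_eq_iff)
  then have "0 < n i" using assms(2) by (auto simp: le_fun_def less_le)
  then show ?thesis unfolding xev_def
    using assms by (intro sum_pos2[of _ i]) (auto simp: le_fun_def less_imp_le)
qed

text \<open>A vector with entries of both signs is orthogonal to a strictly positive one: weight its
  positive entries by the total of the negative ones and conversely.\<close>

lemma sign_coherent_if_nonzero:
  assumes "\<And>x. (\<And>i. 0 < x i) \<Longrightarrow> xev x n \<noteq> 0"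
  shows "0 \<le> n \<or> n \<le> 0"
proof (rule ccontr)
  assume "\<not> (0 \<le> n \<or> n \<le> 0)"
  then obtain i j where ij: "n i < 0" "0 < n j" by (auto simp: le_fun_def not_le)
  define P where "P = (\<Sum>i | 0 < n i. real_of_int (n i))"
  define Q where "Q = (\<Sum>i | n i < 0. - real_of_int (n i))"
  have P: "0 < P" unfolding P_def using ij by (intro sum_pos2[of _ j]) auto
  have Q: "0 < Q" unfolding Q_def using ij by (intro sum_pos2[of _ i]) auto
  define x where "x i = (if 0 < n i then Q else if n i < 0 then P else 1)" for i
  have "xev x n = (\<Sum>i\<in>UNIV. (if 0 < n i then n i * Q else 0) + (if n i < 0 then n i * P else 0))"
    unfolding xev_def by (rule sum.cong) (auto simp: x_def)
  also have "\<dots> = (\<Sum>i | 0 < n i. n i * Q) + (\<Sum>i | n i < 0. n i * P)"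
    by (simp add: sum.distrib sum.If_cases)
  also have "\<dots> = P * Q - Q * P"
    by (simp add: P_def[symmetric] sum_distrib_right[symmetric] Q_def sum_negf)
  finally have "xev x n = 0" by simp
  moreover have "0 < x i" for i using P Q by (simp add: x_def)
  ultimately show False using assms by blast
qed

definition chamber :: "('i::finite \<Rightarrow> 'i \<Rightarrow> int) \<Rightarrow> ('i \<Rightarrow> real) \<Rightarrow> ('i \<Rightarrow> real) \<Rightarrow> bool" where
  "chamber E d x \<longleftrightarrow> (\<exists>g a c. is_diagram E d g \<and> factors (sform E d) (xev x) (gcone lamT) g a qone c)"

text \<open>The piecewise linear identification of dual spaces, from the mutated seed to the
  original one, so that the sign tested is that of a coordinate in the mutated seed. The two
  branches differ by \<open>colsum\<close> times \<open>x k\<close> and thus agree at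
  \<open>x k = 0\<close>.\<close>

definition tmap :: "('i::finite \<Rightarrow> 'i \<Rightarrow> int) \<Rightarrow> 'i \<Rightarrow> ('i \<Rightarrow> real) \<Rightarrow> 'i \<Rightarrow> real" where
  "tmap E k x i = xev x (amap (if 0 < x k then E else nege E) k (axis_vec i 1))"

lemma xev_tmap: "xev (tmap E k x) n = xev x (amap (if 0 < x k then E else nege E) k n)"
proof -
  have "additive (\<lambda>n. xev x (amap F k n))" for F
    unfolding additive_def amap_add additive.add[OF additive_xev] by simp
  then show ?thesis
    unfolding xev_def[of "tmap E k x"] tmap_def by (rule additive_expand[symmetric])
qed

context exchange
begin

lemma chamber_orthant:
  assumes "\<And>i. 0 < x i"
  shows "chamber E d x"
proof -
  interpret T: graded_qtorus "sform E d" lamT by (rule graded_T)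
  obtain g where g: "is_diagram E d g"
    \<comment> \<open>Any direction serves to construct the diagram; \<open>undefined\<close> is
      just some index.\<close>
    using slab_pair_exists[of undefined] slab_pair_is_diagram by blast
  have gT: "supp_in g (gcone lamT)" using g by (simp add: is_diagram_def gcone_lamT)
  have "supp_in g {n \<in> gcone lamT. n = 0 \<or> 0 < xev x n}"
    using gT xev_pos[of x, OF assms] by (auto simp: supp_in_def gcone_lamT)
  moreover have "g = g \<odot> (qone \<odot> qone)"
    using T.T_mul_one(2)[OF gT] T.T_mul_one(1)[OF supp_in_qone[OF T.zero_in_gcone]] by simp
  ultimately have "factors (sform E d) (xev x) (gcone lamT) g g qone qone"
    using g additive.zero[OF additive_xev, of x]
    by (auto simp: factors_def is_diagram_def intro!: supp_in_qone)
  then show ?thesis unfolding chamber_def using g by blast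
qed

text \<open>The exponent \<open>e_i\<close> is indecomposable. If \<open>x i = 0\<close>, both outer
  factors vanish there, hence so does the diagram; yet its coefficient there is the nonzero linear
  coefficient of the dilogarithm, as \<open>h'\<close> has none.\<close>

lemma chamber_nonzero:
  assumes "chamber E d x"
  shows "x i \<noteq> 0"
proof
  assume x: "x i = 0"
  interpret T: graded_qtorus "sform E d" lamT by (rule graded_T)
  obtain g a c where g: "is_diagram E d g" and F: "factors (sform E d) (xev x) (gcone lamT) g a qone c"
    using assms unfolding chamber_def by blast
  obtain h' h where P: "slab_pair E d i h' h" using slab_pair_exists by blast
  have "g = emb i (dilog (d i)) \<odot> h'"
    using is_diagram_unique[OF g slab_pair_is_diagram(2)[OF P]] .
  moreover have c: "g = a \<odot> c" using F T.T_mul_one(1)[OF factors_supp(3)[OF F]] by (simp add: factors_def)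
  moreover have ne: "axis_vec i 1 \<noteq> (0::'i \<Rightarrow> int)" by (metis axis_vec_same zero_fun_apply zero_neq_one)
  have Icc: "{0..axis_vec i 1} = {0, axis_vec i (1::int)}"
  proof
    show "{0..axis_vec i 1} \<subseteq> {0, axis_vec i (1::int)}"
    proof
      fix m assume "m \<in> {0..axis_vec i (1::int)}"
      then have m: "0 \<le> m j" "m j \<le> axis_vec i 1 j" for j by (auto simp: le_fun_def)
      then have "m = axis_vec i (m i)" by (auto simp: fun_eq_iff axis_vec_apply) (metis antisym)
      moreover have "m i = 0 \<or> m i = 1" using m[of i] by auto
      ultimately show "m \<in> {0, axis_vec i (1::int)}" by (metis axis_vec_0 insertCI)
    qed
  qed simp
  have prod: "(f \<odot> f') (axis_vec i 1) = f 0 * f' (axis_vec i 1) + f (axis_vec i 1) * f' 0" for f f'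
    unfolding qmul_def Icc using ne by simp
  have "xev x (axis_vec i 1) = 0" using x by (simp add: xev_axis)
  then have "a (axis_vec i 1) = 0" "c (axis_vec i 1) = 0"
    using F ne by (auto simp: factors_def supp_in_def)
  moreover have "h' (axis_vec i 1) = 0"
  proof -
    have "axis_vec i 1 \<notin> gcone (lamJ i)" using ne by (simp add: gcone_def lamJ_axis)
    then show ?thesis using P slab_nege_gcone unfolding slab_pair_def
      by (meson subsetD supp_inD)
  qed
  moreover have "h' 0 = 1" using P by (simp add: slab_pair_def)
  ultimately have "fps_nth (dilog (d i)) (Suc 0) = 0"
    using prod[of "emb i (dilog (d i))" h'] prod[of a c] by (simp add: emb_axis)
  then show False using dilog_1_neq_0[OF d_pos] by blast
qed

lemma emb_signed_supp:
  assumes x: "additive x"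
  shows "0 < x (axis_vec k 1) \<Longrightarrow> supp_in (emb k F) {m \<in> gcone lamT. m = 0 \<or> 0 < x m}"
    and "x (axis_vec k 1) < 0 \<Longrightarrow> supp_in (emb k F) {m \<in> gcone lamT. m = 0 \<or> x m < (0::real)}"
proof -
  have "axis_vec k a = 0 \<or> 0 < x (axis_vec k a)" if "0 \<le> a" "0 < x (axis_vec k 1)" for a
    using that additive_axis_vec[OF x, of k a] by (cases "a = 0") auto
  then show "0 < x (axis_vec k 1) \<Longrightarrow> supp_in (emb k F) {m \<in> gcone lamT. m = 0 \<or> 0 < x m}"
    using emb_supp_gcone[of k F] by (auto simp: supp_in_def)
  have "axis_vec k a = 0 \<or> x (axis_vec k a) < 0" if "0 \<le> a" "x (axis_vec k 1) < 0" for a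
    using that additive_axis_vec[OF x, of k a] by (cases "a = 0") (auto simp: mult_less_0_iff)
  then show "x (axis_vec k 1) < 0 \<Longrightarrow> supp_in (emb k F) {m \<in> gcone lamT. m = 0 \<or> x m < 0}"
    using emb_supp_gcone[of k F] by (auto simp: supp_in_def)
qed

lemma factors_cancel_left_pos:
  assumes x: "0 < xev x (axis_vec k 1)" and f: "supp_in f {0..}"
    and F: "factors (sform E d) (xev x) (gcone lamT) (emb k (dilog D) \<odot> f) a qone c"
  shows "\<exists>a. factors (sform E d) (xev x) (gcone lamT) f a qone c"
proof -
  interpret T: graded_qtorus "sform E d" lamT by (rule graded_T)
  let ?S = "{m \<in> gcone lamT. m = 0 \<or> 0 < xev x m}"
  have S: "?S \<subseteq> gcone lamT" "0 \<in> ?S" "\<And>a b. a \<in> ?S \<Longrightarrow> b \<in> ?S \<Longrightarrow> a + b \<in> ?S"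
    by (auto simp: T.gcone_add additive.add[OF additive_xev] additive.zero[OF additive_xev])
  obtain v where v: "supp_in v ?S" "v 0 = 1" "v \<odot> emb k (dilog D) = qone"
    using T.mul_inverse[OF S emb_signed_supp(1)[OF additive_xev x], of "dilog D"] by auto
  have "factors (sform E d) (xev x) (gcone lamT) (v \<odot> (emb k (dilog D) \<odot> f)) (v \<odot> a) qone c"
    by (rule T.factors_mul_left_pos[OF additive_xev F v(1,2)])
  moreover have "v \<odot> (emb k (dilog D) \<odot> f) = f"
    unfolding mul_assoc[symmetric] v(3) by (rule mul_one_left[OF f])
  ultimately show ?thesis by auto
qed

lemma factors_cancel_right_neg:
  assumes x: "xev x (axis_vec k 1) < 0" and f: "supp_in f {0..}"
    and F: "factors (sform E d) (xev x) (gcone lamT) (f \<odot> emb k (dilog D)) a qone c"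
  shows "\<exists>c. factors (sform E d) (xev x) (gcone lamT) f a qone c"
proof -
  interpret T: graded_qtorus "sform E d" lamT by (rule graded_T)
  let ?S = "{m \<in> gcone lamT. m = 0 \<or> xev x m < 0}"
  have S: "?S \<subseteq> gcone lamT" "0 \<in> ?S" "\<And>a b. a \<in> ?S \<Longrightarrow> b \<in> ?S \<Longrightarrow> a + b \<in> ?S"
    by (auto simp: T.gcone_add additive.add[OF additive_xev] additive.zero[OF additive_xev])
  obtain v where v: "supp_in v ?S" "v 0 = 1" "emb k (dilog D) \<odot> v = qone"
    using T.mul_inverse[OF S emb_signed_supp(2)[OF additive_xev x], of "dilog D"] by auto
  have "factors (sform E d) (xev x) (gcone lamT) ((f \<odot> emb k (dilog D)) \<odot> v) a qone (c \<odot> v)"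
    by (rule T.factors_mul_right_neg[OF additive_xev F v(1,2)])
  moreover have "(f \<odot> emb k (dilog D)) \<odot> v = f"
    unfolding mul_assoc v(3) by (rule mul_one_right[OF f])
  ultimately show ?thesis by auto
qed

text \<open>Strip the dilogarithm of \<open>e_k\<close> on the side where its sign lets an outer
  factor absorb it, carry the remaining slab series to the other seed, and multiply by the
  dilogarithm on the opposite side: the base change sends \<open>e_k\<close> to
  \<open>- e_k\<close>, so its sign has flipped.\<close>

lemma chamber_mutate:
  assumes "chamber (mutE k E) d x"
  shows "chamber E d (tmap E k x)"
proof -
  interpret T: graded_qtorus "sform E d" lamT by (rule graded_T)
  interpret N: exchange "nege E" d by (rule exchange_nege[OF exchange_axioms])
  interpret M: exchange "mutE k E" d by (rule exchange_mutE)
  interpret MT: graded_qtorus "sform (mutE k E) d" lamT by (rule M.graded_T)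
  let ?A = "amap E k" and ?A' = "amap (nege E) k" and ?u = "emb k (dilog (d k))"
  obtain h' h where P: "slab_pair E d k h' h" using slab_pair_exists by blast
  note P' = slab_pair_mutate[OF P]
  have supp: "supp_in h' (slab (nege E) k)" "supp_in h (slab E k)"
    "supp_in (h \<circ> ?A) (slab E k)" "supp_in (h' \<circ> ?A') (slab (nege E) k)"
    using P P' by (auto simp: slab_pair_def slab_mutE)
  obtain g a c where g: "is_diagram (mutE k E) d g"
    and F: "factors (sform (mutE k E) d) (xev x) (gcone lamT) g a qone c"
    using assms unfolding chamber_def by blast
  have g1: "g = qmul (sform (mutE k E) d) ?u (h \<circ> ?A)"
    using M.is_diagram_unique[OF g M.slab_pair_is_diagram(2)[OF P']] .
  then have g2: "g = qmul (sform (mutE k E) d) (h' \<circ> ?A') ?u"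
    using M.slab_pair_is_diagram(1)[OF P'] by simp
  have slabT: "slab E k \<subseteq> gcone lamT" "slab (nege E) k \<subseteq> gcone lamT"
    using slab_nonneg by (auto simp: gcone_lamT)
  have A0: "?A n = 0 \<longleftrightarrow> n = 0" "?A' n = 0 \<longleftrightarrow> n = 0" for n
    by (metis amap_0 amap_amap, metis amap_0 N.amap_amap)
  have qA: "qone \<circ> ?A = qone" "qone \<circ> ?A' = qone"
    by (rule ext, simp only: comp_def qone_def A0)+
  have hA: "h \<circ> ?A \<circ> ?A = h" "h' \<circ> ?A' \<circ> ?A' = h'"
    by (simp_all add: comp_def)
  have xk: "x k \<noteq> 0" using M.chamber_nonzero[OF assms] .
  have dch: "is_diagram E d (?u \<odot> h')" and comm: "h \<odot> ?u = ?u \<odot> h'"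
    using slab_pair_is_diagram[OF P] by auto
  show ?thesis
  proof (cases "0 < x k")
    case True
    have tm: "xev (tmap E k x) n = xev x (?A n)" for n using True by (simp add: xev_tmap)
    have "0 < xev x (axis_vec k 1)" using True by (simp add: xev_axis)
    then obtain a' where "factors (sform (mutE k E) d) (xev x) (gcone lamT) (h \<circ> ?A) a' qone c"
      using M.factors_cancel_left_pos F supp_in_mono[OF supp(3) slab_nonneg] unfolding g1 by blast
    then have "factors (sform (mutE k E) d) (xev x) (slab E k) (h \<circ> ?A) a' qone c"
      using MT.factors_one_supp[OF _ supp(3) slabT(1) zero_in_slab slab_add] by blast
    then have "factors (sform E d) (xev (tmap E k x)) (?A -` slab E k) (h \<circ> ?A \<circ> ?A) (a' \<circ> ?A) (qone \<circ> ?A) (c \<circ> ?A)"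
      by (intro factors_transport[where x = "xev x" and x' = "xev (tmap E k x)" and A = ?A, OF amap_add amap_amap _ tm slab_nonneg _ slab_add])
        (simp_all add: sform_mutE vimage_slab slab_nonneg)
    then have "factors (sform E d) (xev (tmap E k x)) (gcone lamT) h (a' \<circ> ?A) qone (c \<circ> ?A)"
      using slabT by (auto simp: qA hA vimage_slab intro: factors_mono)
    moreover have "xev (tmap E k x) (axis_vec k 1) < 0"
      unfolding tm amap_axis additive.minus[OF additive_xev] using True
      by (simp add: additive.minus[OF additive_xev] xev_axis)
    ultimately have "factors (sform E d) (xev (tmap E k x)) (gcone lamT) (h \<odot> ?u) (a' \<circ> ?A) qone ((c \<circ> ?A) \<odot> ?u)"
      by (intro T.factors_mul_right_neg[OF additive_xev] emb_signed_supp[OF additive_xev]) auto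
    then show ?thesis unfolding chamber_def comm using dch by blast
  next
    case False
    then have neg: "x k < 0" using xk by simp
    have tm: "xev (tmap E k x) n = xev x (?A' n)" for n using False by (simp add: xev_tmap)
    have "xev x (axis_vec k 1) < 0" using neg by (simp add: xev_axis)
    then obtain c' where "factors (sform (mutE k E) d) (xev x) (gcone lamT) (h' \<circ> ?A') a qone c'"
      using M.factors_cancel_right_neg F supp_in_mono[OF supp(4) slab_nonneg] unfolding g2 by blast
    then have "factors (sform (mutE k E) d) (xev x) (slab (nege E) k) (h' \<circ> ?A') a qone c'"
      using MT.factors_one_supp[OF _ supp(4) slabT(2) zero_in_slab slab_add] by blast
    then have "factors (sform E d) (xev (tmap E k x)) (?A' -` slab (nege E) k) (h' \<circ> ?A' \<circ> ?A') (a \<circ> ?A') (qone \<circ> ?A') (c' \<circ> ?A')"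
      by (intro factors_transport[where x = "xev x" and x' = "xev (tmap E k x)" and A = ?A', OF amap_add N.amap_amap _ tm slab_nonneg _ slab_add])
        (simp_all add: sform_mutE' N.vimage_slab slab_nonneg)
    then have "factors (sform E d) (xev (tmap E k x)) (gcone lamT) h' (a \<circ> ?A') qone (c' \<circ> ?A')"
      using slabT by (auto simp: qA hA N.vimage_slab intro: factors_mono)
    moreover have "0 < xev (tmap E k x) (axis_vec k 1)"
      unfolding tm N.amap_axis using neg
      by (simp add: additive.minus[OF additive_xev] xev_axis)
    ultimately have "factors (sform E d) (xev (tmap E k x)) (gcone lamT) (?u \<odot> h') (?u \<odot> (a \<circ> ?A')) qone (c' \<circ> ?A')"
      by (intro T.factors_mul_left_pos[OF additive_xev] emb_signed_supp[OF additive_xev]) auto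
    then show ?thesis unfolding chamber_def using dch by blast
  qed
qed

end

section \<open>Pulled back orthants and their linear maps\<close>

fun pullback :: "'i::finite list \<Rightarrow> ('i \<Rightarrow> 'i \<Rightarrow> int) \<Rightarrow> ('i \<Rightarrow> real) \<Rightarrow> 'i \<Rightarrow> real" where
  "pullback [] E x = x"
| "pullback (k # ks) E x = tmap E k (pullback ks (mutE k E) x)"

text \<open>The \<open>i\<close>-th row of the matrix of \<open>g\<close>-vectors is the image of the \<open>i\<close>-th basis vector under \<open>Gam\<close>.\<close>

fun Gam :: "'i::finite list \<Rightarrow> ('i \<Rightarrow> 'i \<Rightarrow> int) \<Rightarrow> ('i \<Rightarrow> int) \<Rightarrow> 'i \<Rightarrow> int" where
  "Gam [] E n = n"
| "Gam (k # ks) E n = Gam ks (mutE k E)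
     (amap (if 0 \<le> Gam ks (mutE k E) (axis_vec k 1) then E else nege E) k n)"

lemma Gam_add: "Gam ks E (m + n) = Gam ks E m + Gam ks E n"
  by (induction ks arbitrary: E m n) (simp_all add: amap_add)

lemma chamber_pullback:
  "exchange E d \<Longrightarrow> (\<And>i. 0 < x i) \<Longrightarrow> chamber E d (pullback ks E x)"
  by (induction ks arbitrary: E)
    (auto intro: exchange.chamber_orthant exchange.chamber_mutate exchange.exchange_mutE)

text \<open>Pulled back orthants avoid the coordinate hyperplanes, so the branch taken by
  \<open>tmap\<close> is constant on each and is read off from the sign of \<open>Gam\<close> at
  \<open>e_k\<close>. The pullback is therefore linear on the orthant, which in turn yields the sign
  coherence needed for the next step.\<close>

lemma Gam_pullback:
  assumes "exchange E d"
  shows "(\<forall>x. (\<forall>i. 0 < x i) \<longrightarrow> (\<forall>n. xev x (Gam ks E n) = xev (pullback ks E x) n)) \<and>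
     (\<forall>i. 0 \<le> Gam ks E (axis_vec i 1) \<or> Gam ks E (axis_vec i 1) \<le> 0)"
  using assms
proof (induction ks arbitrary: E)
  case Nil
  have "0 \<le> axis_vec i (1::int)" for i :: 'a by simp
  then show ?case unfolding Gam.simps pullback.simps by blast
next
  case (Cons k ks)
  interpret exchange E d by (rule Cons.prems)
  let ?G = "Gam ks (mutE k E)"
  note IH = Cons.IH[OF exchange_mutE]
  have lin: "xev x (Gam (k # ks) E n) = xev (pullback (k # ks) E x) n" if x: "\<And>i. 0 < x i" for x n
  proof -
    let ?y = "pullback ks (mutE k E) x"
    have y: "xev x (?G n) = xev ?y n" for n using IH x by blast
    have "?y k \<noteq> 0"
      using exchange.chamber_nonzero[OF exchange_mutE chamber_pullback[OF exchange_mutE x]] .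
    moreover have yk: "?y k = xev x (?G (axis_vec k 1))" by (simp add: y xev_axis)
    moreover have "0 \<le> xev x v" if "0 \<le> v" for v
      using that x unfolding xev_def by (auto intro!: sum_nonneg simp: le_fun_def less_imp_le)
    moreover have "xev x v \<le> 0" if "v \<le> 0" for v
      using that x unfolding xev_def by (auto intro!: sum_nonpos simp: le_fun_def less_imp_le mult_le_0_iff)
    ultimately have "0 < ?y k \<longleftrightarrow> 0 \<le> ?G (axis_vec k 1)"
      using IH by (metis less_le not_less)
    then show ?thesis by (simp add: xev_tmap y)
  qed
  moreover have "0 \<le> Gam (k # ks) E (axis_vec i 1) \<or> Gam (k # ks) E (axis_vec i 1) \<le> 0" for i
  proof (rule sign_coherent_if_nonzero)
    fix x :: "'a \<Rightarrow> real" assume x: "\<And>i. 0 < x i"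
    have "xev x (Gam (k # ks) E (axis_vec i 1)) = pullback (k # ks) E x i"
      unfolding lin[OF x] by (simp add: xev_axis)
    moreover have "pullback (k # ks) E x i \<noteq> 0"
      using chamber_nonzero[OF chamber_pullback[OF exchange_axioms x]] .
    ultimately show "xev x (Gam (k # ks) E (axis_vec i 1)) \<noteq> 0" by simp
  qed
  ultimately show ?case by blast
qed

lemma Gam_sign_coherent:
  "exchange E d \<Longrightarrow> 0 \<le> Gam ks E (axis_vec i 1) \<or> Gam ks E (axis_vec i 1) \<le> 0"
  using Gam_pullback by blast

subsection \<open>Tropical duality\<close>

text \<open>The inverse of \<open>Gam\<close>; the image of the \<open>k\<close>-th basis vector is
  the \<open>k\<close>-th c-vector of the seed reached by \<open>ks\<close>.\<close>

fun Lam :: "'i::finite list \<Rightarrow> ('i \<Rightarrow> 'i \<Rightarrow> int) \<Rightarrow> ('i \<Rightarrow> int) \<Rightarrow> 'i \<Rightarrow> int" where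
  "Lam [] E n = n"
| "Lam (k # ks) E n = amap (if 0 \<le> Gam ks (mutE k E) (axis_vec k 1) then E else nege E) k
     (Lam ks (mutE k E) n)"

lemma Lam_add: "Lam ks E (m + n) = Lam ks E m + Lam ks E n"
  by (induction ks arbitrary: E m n) (simp_all add: amap_add)

lemma exchange_fold: "exchange E d \<Longrightarrow> exchange (fold mutE ks E) d"
  by (induction ks arbitrary: E) (auto intro: exchange.exchange_mutE)

lemma amap_involution: "exchange E d \<Longrightarrow> amap (if b then E else nege E) k (amap (if b then E else nege E) k n) = n"
  using exchange.amap_amap[of E d] exchange.amap_amap[of "nege E" d] exchange_nege[of E d] by auto

lemma Lam_Gam: "exchange E d \<Longrightarrow> Lam ks E (Gam ks E n) = n"
proof (induction ks arbitrary: E n)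
  case (Cons k ks)
  show ?case
    unfolding Gam.simps Lam.simps Cons.IH[OF exchange.exchange_mutE[OF Cons.prems]]
    by (rule amap_involution[OF Cons.prems])
qed simp

lemma Gam_Lam: "exchange E d \<Longrightarrow> Gam ks E (Lam ks E n) = n"
proof (induction ks arbitrary: E n)
  case (Cons k ks)
  show ?case
    unfolding Gam.simps Lam.simps amap_involution[OF Cons.prems]
    by (rule Cons.IH[OF exchange.exchange_mutE[OF Cons.prems]])
qed simp

lemma additive_int_axis:
  fixes f :: "('i \<Rightarrow> int) \<Rightarrow> 'i \<Rightarrow> int"
  assumes "\<And>m n. f (m + n) = f m + f n"
  shows "f (axis_vec k a) l = a * f (axis_vec k 1) l"
proof -
  have "additive (\<lambda>n. real_of_int (f n l))" by (simp add: additive_def assms)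
  then have "real_of_int (f (axis_vec k a) l) = real_of_int (a * f (axis_vec k 1) l)"
    using additive_axis_vec[of "\<lambda>n. real_of_int (f n l)" k a] by simp
  then show ?thesis by (simp only: of_int_eq_iff)
qed

lemma mutE_mutE:
  assumes "exchange E d"
  shows "mutE k (mutE k E) = E"
proof -
  interpret exchange E d by fact
  show ?thesis by (auto simp: fun_eq_iff mutE_def max_def algebra_simps)
qed

lemma sform_Gam: "exchange E d \<Longrightarrow> sform (fold mutE ks E) d (Gam ks E m) (Gam ks E n) = sform E d m n"
proof (induction ks arbitrary: E m n)
  case (Cons k ks)
  interpret exchange E d by fact
  interpret N: exchange "nege E" d by (rule exchange_nege) fact
  show ?case
  proof (cases "0 \<le> Gam ks (mutE k E) (axis_vec k 1)")
    case True
    then show ?thesis by (simp add: Cons.IH[OF exchange_mutE]) (simp add: sform_mutE)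
  next
    case False
    then show ?thesis by (simp add: Cons.IH[OF exchange_mutE]) (simp add: sform_mutE')
  qed
qed simp

text \<open>\<open>Gam\<close> maps the lattice spanned by the \<open>d j e_j\<close> into itself.
  As \<open>d\<close> is real-valued, divisibility by \<open>d l\<close> is expressed by an integral
  quotient.\<close>

lemma Gam_divisible:
  assumes "exchange E d"
  shows "\<exists>z::int. d j * Gam ks E (axis_vec j 1) l = z * d l"
  using assms
proof (induction ks arbitrary: E j)
  case Nil
  then show ?case
    by (cases "j = l") (auto simp: axis_vec_apply intro: exI[of _ 1] exI[of _ 0])
next
  case (Cons k ks)
  interpret exchange E d by fact
  have main: "\<exists>z::int. d j * Gam ks (mutE k E) (amap F k (axis_vec j 1)) l = z * d l" if F: "exchange F d" for F
  proof -
    interpret F: exchange F d by fact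
    let ?G = "Gam ks (mutE k E)"
    obtain z1 :: int where z1: "d j * ?G (axis_vec j 1) l = z1 * d l" using Cons.IH[OF exchange_mutE] by blast
    obtain z2 :: int where z2: "d k * ?G (axis_vec k 1) l = z2 * d l" using Cons.IH[OF exchange_mutE] by blast
    show ?thesis
    proof (cases "j = k")
      case True
      have "?G (amap F k (axis_vec j 1)) l = - ?G (axis_vec k 1) l"
        using additive_int_axis[of ?G k "-1" l, OF Gam_add] True
        by (simp add: F.amap_axis axis_vec_minus[symmetric])
      then show ?thesis using z2 True by (intro exI[of _ "- z2"]) simp
    next
      case False
      have "?G (amap F k (axis_vec j 1)) l = ?G (axis_vec j 1) l + max 0 (F j k) * ?G (axis_vec k 1) l"
        using False additive_int_axis[of ?G k "max 0 (F j k)" l, OF Gam_add] by (simp add: F.amap_axis Gam_add)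
      moreover have "d j * max 0 (F j k) = d k * max 0 (- F k j)"
      proof -
        have "d j * max 0 (F j k) = max 0 (d j * F j k)"
          using F.d_pos[of j] by (auto simp: max_def mult_le_0_iff zero_le_mult_iff)
        also have "\<dots> = max 0 (d k * - F k j)" by (simp add: F.E_skew[of j k])
        also have "\<dots> = d k * max 0 (- F k j)"
          using F.d_pos[of k] by (auto simp: max_def mult_le_0_iff zero_le_mult_iff)
        finally show ?thesis .
      qed
      then have "d j * (max 0 (F j k) * ?G (axis_vec k 1) l) = max 0 (- F k j) * (d k * ?G (axis_vec k 1) l)"
        by (metis (no_types, opaque_lifting) mult.assoc mult.commute of_int_mult)
      ultimately show ?thesis using z1 z2
        by (intro exI[of _ "z1 + max 0 (- F k j) * z2"]) (simp add: distrib_left distrib_right mult.assoc)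
    qed
  qed
  show ?case using main[OF exchange_axioms] main[OF exchange_nege[OF exchange_axioms]] by simp
qed

text \<open>\<open>Lam\<close> is defined by splitting off the first mutation; this is the recursion
  at the last one, with the sign of a c-vector in place of that of a g-vector row.\<close>

definition end_rule :: "'i::finite list \<Rightarrow> ('i \<Rightarrow> 'i \<Rightarrow> int) \<Rightarrow> bool" where
  "end_rule ks E \<longleftrightarrow> (\<forall>k n. Lam (ks @ [k]) E n =
     Lam ks E (amap (if 0 \<le> Lam ks E (axis_vec k 1) then fold mutE ks E else nege (fold mutE ks E)) k n))"

text \<open>The recursion at the last mutation is the defining recursion of \<open>Gam\<close> read
  backwards. Negating the matrix compensates for the fact that mutation at \<open>k\<close> negates
  column \<open>k\<close>. Only strictly shorter sequences need the rule, so the lemma is available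
  within its induction.\<close>

lemma Lam_eq_Gam_rev:
  assumes "exchange E d" "\<And>ks'. length ks' < length ks \<Longrightarrow> end_rule ks' E"
  shows "Lam ks E = Gam (rev ks) (nege (fold mutE ks E))"
  using assms(2)
proof (induction ks rule: rev_induct)
  case Nil
  then show ?case by auto
next
  case (snoc k ks)
  let ?Et = "fold mutE ks E"
  have L: "Lam ks E = Gam (rev ks) (nege ?Et)" using snoc by simp
  have mm: "mutE k (mutE k ?Et) = ?Et" using mutE_mutE exchange_fold[OF assms(1)] by blast
  have "end_rule ks E" using snoc.prems by simp
  then show ?case
    by (auto simp: fun_eq_iff end_rule_def mutE_nege mm amap_mutE L[symmetric])
qed

lemma coherent_sign:
  fixes v :: "'i \<Rightarrow> int"
  assumes "0 \<le> v \<or> v \<le> 0" "v j \<noteq> 0"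
  shows "0 \<le> v \<longleftrightarrow> 0 < v j"
  using assms by (auto simp: le_fun_def less_le) (metis antisym)+

lemma amap_nege_eq: "amap E k n = amap (nege E) k n + axis_vec k (colsum E k n)"
  using colpos_nege[of E k n] by (auto simp: fun_eq_iff amap_apply axis_vec_apply)

lemma amap_axis_self: "exchange E d \<Longrightarrow> amap (if b then E else nege E) k (axis_vec k m) = axis_vec k (- m)"
  using exchange.E_diag[of E d k]
  by (auto simp: fun_eq_iff amap_apply axis_vec_apply colpos_axis nege_def)

text \<open>Compare the first mutation \<open>k1\<close> with the last one \<open>k\<close>. If the
  row \<open>p\<close> has an entry off \<open>k\<close>, coherence shows that mutation at
  \<open>k\<close> preserves its sign, and mutation at \<open>k1\<close> that of the c-vector.
  Otherwise both are plus or minus a basis vector, both signs flip, and the two ways of choosing the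
  base changes must be shown equal.\<close>

lemma end_rule:
  assumes "exchange E d"
  shows "end_rule ks E"
  using assms
proof (induction "length ks" arbitrary: ks E rule: less_induct)
  case less
  interpret exchange E d by fact
  show ?case
  proof (cases ks)
    case Nil
    then show ?thesis by (simp add: end_rule_def)
  next
    case (Cons k1 ks1)
    let ?E1 = "mutE k1 E"
    define G where "G = Gam ks1 ?E1"
    define L where "L = Lam ks1 ?E1"
    define Et where "Et = fold mutE ks1 ?E1"
    have ex1: "exchange ?E1 d" by (rule exchange_mutE)
    interpret E1: exchange ?E1 d by (rule ex1)
    have ext: "exchange Et d" unfolding Et_def by (rule exchange_fold[OF ex1])
    interpret Et: exchange Et d by (rule ext)
    have GL: "G (L n) = n" and LG: "L (G n) = n" for n
      unfolding G_def L_def using Gam_Lam[OF ex1] Lam_Gam[OF ex1] by auto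
    have Gadd: "G (m + n) = G m + G n" and Ladd: "L (m + n) = L m + L n" for m n
      by (simp_all add: G_def L_def Gam_add Lam_add)
    note Gax = additive_int_axis[of G, OF Gadd] and Lax = additive_int_axis[of L, OF Ladd]
    have end1: "end_rule ks1 ?E1" using less.hyps[OF _ ex1] Cons by simp
    have revL: "L = Gam (rev ks1) (nege Et)"
      unfolding L_def Et_def
      by (rule Lam_eq_Gam_rev[OF ex1]) (use less.hyps[OF _ ex1] Cons in auto)
    have revL': "Lam ks E = Gam (rev ks) (nege (fold mutE ks E))"
      by (rule Lam_eq_Gam_rev[OF exchange_axioms]) (use less.hyps[OF _ exchange_axioms] in auto)
    have "Lam (ks @ [k]) E n =
       Lam ks E (amap (if 0 \<le> Lam ks E (axis_vec k 1) then Et else nege Et) k n)" for k n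
    proof -
      define p where "p = G (axis_vec k1 1)"
      define c' where "c' = L (axis_vec k 1)"
      define F1 where "F1 = (if 0 \<le> p then E else nege E)"
      define c where "c = amap F1 k1 c'"
      define G' where "G' = (if 0 \<le> c' then Et else nege Et)"
      define p2 where "p2 = amap G' k p"
      define F2 where "F2 = (if 0 \<le> p2 then E else nege E)"
      define H where "H = (if 0 \<le> c then Et else nege Et)"
      have LE: "Lam ks E n = amap F1 k1 (L n)" for n
        by (simp add: Cons F1_def p_def L_def G_def)
      have c: "c = Lam ks E (axis_vec k 1)" by (simp add: LE c_def c'_def)
      have L1: "Lam (ks1 @ [k]) ?E1 n = L (amap G' k n)" for n
        using end1 by (simp add: end_rule_def L_def G'_def c'_def Et_def)
      have G1: "Gam (ks1 @ [k]) ?E1 n = amap G' k (G n)" for n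
      proof -
        have "Lam (ks1 @ [k]) ?E1 (amap G' k (G n)) = n"
          unfolding L1 by (simp add: G'_def amap_involution[OF ext, of "0 \<le> c'"] LG)
        then show ?thesis using Gam_Lam[OF ex1] by metis
      qed
      have LHS: "Lam (ks @ [k]) E n = amap F2 k1 (L (amap G' k n))"
        by (simp add: Cons G1 L1 F2_def p2_def p_def)
      have RHS: "Lam ks E (amap (if 0 \<le> Lam ks E (axis_vec k 1) then Et else nege Et) k n) =
          amap F1 k1 (L (amap H k n))"
        unfolding LE H_def c_def c'_def by (rule refl)
      have coh: "0 \<le> p \<or> p \<le> 0" "0 \<le> c' \<or> c' \<le> 0" "0 \<le> c \<or> c \<le> 0" "0 \<le> p2 \<or> p2 \<le> 0"
      proof -
        show "0 \<le> p \<or> p \<le> 0" unfolding p_def G_def by (rule Gam_sign_coherent[OF ex1])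
        show "0 \<le> c' \<or> c' \<le> 0" unfolding c'_def revL
          by (rule Gam_sign_coherent[OF exchange_nege[OF ext]])
        show "0 \<le> c \<or> c \<le> 0" unfolding c revL'
          by (rule Gam_sign_coherent[OF exchange_nege[OF exchange_fold[OF exchange_axioms]]])
        show "0 \<le> p2 \<or> p2 \<le> 0" unfolding p2_def p_def G1[symmetric]
          by (rule Gam_sign_coherent[OF ex1])
      qed
      have ek: "G c' = axis_vec k 1" by (simp add: c'_def GL)
      have ek1: "L p = axis_vec k1 1" by (simp add: p_def LG)
      show ?thesis
      proof (cases "\<exists>j. j \<noteq> k \<and> p j \<noteq> 0")
        case True
        then obtain j where j: "j \<noteq> k" "p j \<noteq> 0" by blast
        have "p2 j = p j" using j by (simp add: p2_def amap_apply)
        then have F: "F1 = F2"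
          using coherent_sign[OF coh(1) j(2)] coherent_sign[OF coh(4), of j] j(2) by (simp add: F1_def F2_def)
        have "\<exists>i. i \<noteq> k1 \<and> c' i \<noteq> 0"
        proof (rule ccontr)
          assume "\<not> ?thesis"
          then have "c' = axis_vec k1 (c' k1)" by (auto simp: fun_eq_iff axis_vec_apply)
          then have m: "axis_vec k 1 l = c' k1 * p l" for l
            using ek Gax[of k1 "c' k1" l] by (simp add: p_def)
          have "c' k1 = 0" using m[of j] j by (simp add: axis_vec_apply)
          then show False using m[of k] by simp
        qed
        then obtain i where i: "i \<noteq> k1" "c' i \<noteq> 0" by blast
        have "c i = c' i" using i by (simp add: c_def amap_apply)
        then have "G' = H"
          using coherent_sign[OF coh(2) i(2)] coherent_sign[OF coh(3), of i] i(2) by (simp add: G'_def H_def)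
        then show ?thesis unfolding LHS RHS F by simp
      next
        case False
        define m where "m = p k"
        have p: "p = axis_vec k m" using False by (auto simp: m_def fun_eq_iff axis_vec_apply)
        have mc: "axis_vec k1 1 l = m * c' l" for l
          using ek1 Lax[of k m l] by (simp add: p c'_def)
        have "m * c' k1 = 1" using mc[of k1] by simp
        then have mm: "m = 1 \<or> m = - 1" by (metis zmult_eq_1_iff)
        then have c': "c' = axis_vec k1 m"
          using mc by (auto simp: fun_eq_iff axis_vec_apply split: if_splits) (metis minus_minus neg_equal_0_iff_equal)+
        \<comment> \<open>The entries in question are 1 or -1, so divisibility holds in both
          directions and the positive multipliers coincide.\<close>
        have dk: "d k1 = d k"
        proof -
          obtain z :: int where z: "d k1 * p k = z * d k"
            using Gam_divisible[OF ex1, of k1 ks1 k] by (auto simp: p_def G_def)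
          obtain z' :: int where z': "d k * c' k1 = z' * d k1"
            using Gam_divisible[OF exchange_nege[OF ext], of k "rev ks1" k1] by (auto simp: c'_def revL)
          have z: "d k1 * m = z * d k" and z': "d k * m = z' * d k1" using z z' by (simp_all add: p c')
          have 1: "d k1 = \<bar>real_of_int z\<bar> * d k" "d k = \<bar>real_of_int z'\<bar> * d k1"
            using arg_cong[OF z, of abs] arg_cong[OF z', of abs] mm d_pos[of k] d_pos[of k1] by (auto simp: abs_mult)
          then have "z \<noteq> 0" "z' \<noteq> 0" using d_pos[of k] d_pos[of k1] by auto
          then have "1 \<le> \<bar>real_of_int z\<bar>" "1 \<le> \<bar>real_of_int z'\<bar>" by linarith+
          then have "1 * d k \<le> \<bar>real_of_int z\<bar> * d k" "1 * d k1 \<le> \<bar>real_of_int z'\<bar> * d k1"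
            using d_pos[of k] d_pos[of k1] by (intro mult_right_mono; simp)+
          then have "d k \<le> d k1" "d k1 \<le> d k" unfolding 1[symmetric] by simp_all
          then show ?thesis by simp
        qed
        have cm: "c = axis_vec k1 (- m)" and p2: "p2 = axis_vec k (- m)"
          unfolding c_def c' F1_def p2_def p G'_def
          using amap_axis_self[OF exchange_axioms] amap_axis_self[OF ext] by blast+
        define v where "v = L (amap (nege Et) k n)"
        \<comment> \<open>Reversing the sign at \<open>k\<close> and reversing it at
          \<open>k1\<close> each shift the result along \<open>e_k1\<close>. Invariance of the form
          under \<open>G\<close>, together with \<open>d k1 = d k\<close>, shows that the shifts
          match.\<close>
        have flip: "amap (nege E) k1 (L (amap Et k n)) = amap E k1 v"
        proof -
          let ?b = "colsum Et k n"
          have "L (axis_vec k ?b) = axis_vec k1 (?b * m)"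
            using Lax[of k ?b] c' by (auto simp: fun_eq_iff c'_def[symmetric] axis_vec_apply)
          then have "L (amap Et k n) = v + axis_vec k1 (?b * m)"
            by (simp add: amap_nege_eq[of Et] Ladd v_def)
          then have "amap (nege E) k1 (L (amap Et k n)) = amap (nege E) k1 v + axis_vec k1 (- (?b * m))"
            using amap_axis_self[OF exchange_axioms, of False] by (simp add: amap_add)
          moreover have "colsum E k1 v = - (?b * m)"
          proof -
            have "real_of_int (colsum ?E1 k1 v) = d k1 * sform ?E1 d v (axis_vec k1 1)"
              by (rule E1.colsum_eq)
            also have "sform ?E1 d v (axis_vec k1 1) = sform Et d (G v) (G (axis_vec k1 1))"
              unfolding G_def Et_def by (rule sform_Gam[OF ex1, symmetric])
            also have "\<dots> = m * sform Et d (amap (nege Et) k n) (axis_vec k 1)"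
              using Et.om_axis_right[of _ k m] by (simp add: v_def GL p_def[symmetric] p)
            also have "d k1 * \<dots> = m * colsum Et k (amap (nege Et) k n)"
              using Et.colsum_eq[of k "amap (nege Et) k n"] dk by simp
            also have "\<dots> = real_of_int (m * ?b)" by (simp add: Et.colsum_amap)
            finally have "colsum ?E1 k1 v = m * ?b" by (simp only: of_int_eq_iff)
            then show ?thesis by (simp add: colsum_mutE mult.commute)
          qed
          ultimately show ?thesis by (simp add: amap_nege_eq[of E])
        qed
        have ax: "0 \<le> axis_vec i m \<longleftrightarrow> m = 1" "0 \<le> axis_vec i (- m) \<longleftrightarrow> m = - 1" for i :: 'a
          using mm by auto
        show ?thesis
          unfolding LHS RHS F1_def F2_def G'_def H_def cm p2 p c' ax
          using mm flip by (auto simp: v_def)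
      qed
    qed
    then show ?thesis by (simp add: end_rule_def Cons Et_def)
  qed
qed

lemma Lam_sign_coherent:
  assumes "exchange E d"
  shows "0 \<le> Lam ks E (axis_vec k 1) \<or> Lam ks E (axis_vec k 1) \<le> 0"
  using Lam_eq_Gam_rev[OF assms end_rule[OF assms]] Gam_sign_coherent[OF exchange_nege[OF exchange_fold[OF assms]]]
  by metis

lemma Lam_snoc:
  assumes "exchange E d"
  shows "Lam (ks @ [k]) E n = Lam ks E (amap (if 0 \<le> Lam ks E (axis_vec k 1)
     then fold mutE ks E else nege (fold mutE ks E)) k n)"
  using end_rule[OF assms, of ks] by (simp add: end_rule_def)

lemma Gam_snoc:
  assumes "exchange E d"
  shows "Gam (ks @ [k]) E n = amap (if 0 \<le> Lam ks E (axis_vec k 1)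
     then fold mutE ks E else nege (fold mutE ks E)) k (Gam ks E n)"
proof -
  have "Lam (ks @ [k]) E (amap (if 0 \<le> Lam ks E (axis_vec k 1)
     then fold mutE ks E else nege (fold mutE ks E)) k (Gam ks E n)) = n"
    unfolding Lam_snoc[OF assms] amap_involution[OF exchange_fold[OF assms]] by (rule Lam_Gam[OF assms])
  then show ?thesis using Gam_Lam[OF assms] by metis
qed

subsection \<open>Integral combinations\<close>

lemma zscale_0 [simp]: "zscale 0 x = 0"
  by (simp add: zscale_def)

lemma zscale_1 [simp]: "zscale 1 x = x"
  by (simp add: zscale_def)

lemma zscale_plus_1: "zscale (k + 1) x = zscale k x + x"
proof (cases "0 \<le> k")
  case True
  then have "nat (k + 1) = Suc (nat k)" "nat (- k) = 0" "nat (- (k + 1)) = 0" by auto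
  then show ?thesis by (simp only: zscale_def) (simp add: add.commute)
next
  case False
  then have "nat (- k) = Suc (nat (- (k + 1)))" "nat k = 0" "nat (k + 1) = 0" by auto
  then show ?thesis by (simp only: zscale_def) simp
qed

lemma zscale_minus_1: "zscale (k - 1) x = zscale k x - x"
  using zscale_plus_1[of "k - 1" x] by (simp add: algebra_simps)

lemma zscale_add_left: "zscale (a + b) x = zscale a x + zscale b x"
proof (induction b rule: int_induct[where k = 0])
  case (step1 i)
  then show ?case using zscale_plus_1[of "a + i" x] zscale_plus_1[of i x] by (simp add: algebra_simps)
next
  case (step2 i)
  then show ?case by (simp only: add_diff_eq zscale_minus_1)
qed simp

lemma zscale_minus_left: "zscale (- a) x = - zscale a x"
  using zscale_add_left[of a "- a" x] by (simp add: eq_neg_iff_add_eq_0 add.commute)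

text \<open>Forms and functionals are additive only on the lattices, not on the ambient group, so
  linearity arguments are made relative to a subgroup.\<close>

definition subgrp :: "'a::ab_group_add set \<Rightarrow> bool" where
  "subgrp G \<longleftrightarrow> 0 \<in> G \<and> (\<forall>x\<in>G. \<forall>y\<in>G. x + y \<in> G) \<and> (\<forall>x\<in>G. - x \<in> G)"

lemma subgrp_zscale:
  assumes "subgrp G" "x \<in> G"
  shows "zscale k x \<in> G"
proof (induction k rule: int_induct[where k = 0])
  case base
  then show ?case using assms by (simp add: subgrp_def)
next
  case (step1 i)
  then show ?case using assms by (simp add: subgrp_def zscale_plus_1)
next
  case (step2 i)
  have "zscale (i - 1) x = zscale i x + - x" by (simp add: zscale_minus_1)
  then show ?case using step2 assms unfolding subgrp_def by metis
qed

lemma subgrp_sum: "subgrp G \<Longrightarrow> (\<And>i. i \<in> A \<Longrightarrow> f i \<in> G) \<Longrightarrow> sum f A \<in> G"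
  by (induction A rule: infinite_finite_induct) (auto simp: subgrp_def)

lemma additive_on_zero:
  fixes f :: "'a::ab_group_add \<Rightarrow> 'b::ab_group_add"
  assumes "subgrp G" "\<And>x y. x \<in> G \<Longrightarrow> y \<in> G \<Longrightarrow> f (x + y) = f x + f y"
  shows "f 0 = 0"
  using assms(2)[of 0 0] assms(1) by (simp add: subgrp_def)

lemma additive_on_minus:
  fixes f :: "'a::ab_group_add \<Rightarrow> 'b::ab_group_add"
  assumes "subgrp G" "\<And>x y. x \<in> G \<Longrightarrow> y \<in> G \<Longrightarrow> f (x + y) = f x + f y" "x \<in> G"
  shows "f (- x) = - f x"
  using assms(2)[of x "- x"] assms(1,3) additive_on_zero[OF assms(1,2)]
  by (simp add: subgrp_def eq_neg_iff_add_eq_0 add.commute)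

lemma additive_on_zscale:
  fixes f :: "'a::ab_group_add \<Rightarrow> 'b::ab_group_add"
  assumes G: "subgrp G" "\<And>x y. x \<in> G \<Longrightarrow> y \<in> G \<Longrightarrow> f (x + y) = f x + f y" and x: "x \<in> G"
  shows "f (zscale k x) = zscale k (f x)"
proof (induction k rule: int_induct[where k = 0])
  case base
  then show ?case using additive_on_zero[OF G] by simp
next
  case (step1 i)
  then show ?case using G(2)[OF subgrp_zscale[OF G(1) x] x] by (simp add: zscale_plus_1)
next
  case (step2 i)
  have "- x \<in> G" using G(1) x by (simp add: subgrp_def)
  then have "f (zscale i x + - x) = f (zscale i x) + - f x"
    using G(2)[OF subgrp_zscale[OF G(1) x], of "- x"] additive_on_minus[OF G x] by simp
  then show ?case using step2 by (simp add: zscale_minus_1)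
qed

lemma additive_on_sum:
  fixes f :: "'a::ab_group_add \<Rightarrow> 'b::ab_group_add"
  assumes G: "subgrp G" "\<And>x y. x \<in> G \<Longrightarrow> y \<in> G \<Longrightarrow> f (x + y) = f x + f y"
    and g: "\<And>i. i \<in> A \<Longrightarrow> g i \<in> G"
  shows "f (sum g A) = (\<Sum>i\<in>A. f (g i))"
  using g
proof (induction A rule: infinite_finite_induct)
  case (insert i A)
  then show ?case using G(2)[of "g i" "sum g A"] subgrp_sum[OF G(1), of A g] by simp
qed (simp_all add: additive_on_zero[OF G])

lemma additive_on_zcomb:
  fixes f :: "'a::ab_group_add \<Rightarrow> 'b::ab_group_add"
  assumes G: "subgrp G" "\<And>x y. x \<in> G \<Longrightarrow> y \<in> G \<Longrightarrow> f (x + y) = f x + f y"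
    and b: "\<And>i. b i \<in> G"
  shows "f (zcomb b c) = zcomb (\<lambda>i. f (b i)) c"
  unfolding zcomb_def
  by (subst additive_on_sum[OF G]) (auto intro: subgrp_zscale[OF G(1)] b sum.cong additive_on_zscale[OF G b])

lemma zscale_add_right: "zscale k (x + y) = zscale k x + zscale k y"
  by (induction k rule: int_induct[where k = 0]) (simp_all add: zscale_plus_1 zscale_minus_1)

lemma zscale_minus_right: "zscale k (- x) = - zscale k x"
  by (induction k rule: int_induct[where k = 0]) (simp_all add: zscale_plus_1 zscale_minus_1)

lemma zscale_zero_right [simp]: "zscale k 0 = 0"
  by (induction k rule: int_induct[where k = 0]) (simp_all add: zscale_plus_1 zscale_minus_1)

lemma zscale_sum_left: "zscale (sum f A) x = (\<Sum>i\<in>A. zscale (f i) x)"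
  by (induction A rule: infinite_finite_induct) (simp_all add: zscale_add_left)

lemma zscale_zscale: "zscale a (zscale b x) = zscale (a * b) x"
  by (induction a rule: int_induct[where k = 0])
    (simp_all add: zscale_plus_1 zscale_minus_1 distrib_right left_diff_distrib zscale_add_left
      zscale_add_left[of _ "- b", simplified] zscale_minus_left)

lemma zscale_rat: "zscale k (q::rat) = of_int k * q"
  by (induction k rule: int_induct[where k = 0]) (simp_all add: zscale_plus_1 zscale_minus_1 algebra_simps)

lemma zscale_apply: "zscale k (f :: 'a \<Rightarrow> 'b::ab_group_add) x = zscale k (f x)"
  by (induction k rule: int_induct[where k = 0]) (simp_all add: zscale_plus_1 zscale_minus_1)

lemma zscale_fun_rat: "zscale k (f :: 'a \<Rightarrow> rat) x = of_int k * f x"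
  by (simp add: zscale_apply zscale_rat)

lemma zscale_fst: "fst (zscale k x) = zscale k (fst x)"
  by (induction k rule: int_induct[where k = 0]) (simp_all add: zscale_plus_1 zscale_minus_1)

lemma zscale_snd: "snd (zscale k x) = zscale k (snd x)"
  by (induction k rule: int_induct[where k = 0]) (simp_all add: zscale_plus_1 zscale_minus_1)

lemma zscale_Pair: "zscale k (a, b) = (zscale k a, zscale k b)"
  by (rule prod_eqI) (simp_all add: zscale_fst zscale_snd)

lemma zcomb_rat: "zcomb (b :: 'i::finite \<Rightarrow> rat) c = (\<Sum>i\<in>UNIV. of_int (c i) * b i)"
  by (simp add: zcomb_def zscale_rat)

lemma zcomb_add: "zcomb b (\<lambda>i. x i + y i) = zcomb b x + zcomb b y"
  by (simp add: zcomb_def zscale_add_left sum.distrib)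

lemma zcomb_minus: "zcomb b (\<lambda>i. - x i) = - zcomb b x"
  by (simp add: zcomb_def zscale_minus_left sum_negf)

lemma zcomb_single: "zcomb b (\<lambda>i. if i = j then a else 0) = zscale a (b j)"
proof -
  have "zcomb b (\<lambda>i. if i = j then a else 0) = (\<Sum>i\<in>UNIV. if i = j then zscale a (b j) else 0)"
    unfolding zcomb_def by (rule sum.cong) auto
  then show ?thesis by simp
qed

lemma zbasis_subgrp:
  assumes "is_zbasis J b L"
  shows "subgrp L"
proof -
  have L: "L = zcomb b ` {c. \<forall>i. i \<notin> J \<longrightarrow> c i = 0}" using assms by (simp add: is_zbasis_def bij_betw_def)
  have "0 = zcomb b (\<lambda>_. 0)" by (simp add: zcomb_def)
  then have "0 \<in> L" unfolding L by (rule image_eqI[where f = "zcomb b"]) simp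
  moreover have "x + y \<in> L" if xy: "x \<in> L" "y \<in> L" for x y
  proof -
    obtain c c' where c: "\<forall>i. i \<notin> J \<longrightarrow> c i = 0" "\<forall>i. i \<notin> J \<longrightarrow> c' i = 0" "x = zcomb b c" "y = zcomb b c'"
      using xy unfolding L by auto
    then have "x + y = zcomb b (\<lambda>i. c i + c' i)" by (simp add: zcomb_add)
    then show ?thesis unfolding L by (rule image_eqI[where f = "zcomb b"]) (use c in simp)
  qed
  moreover have "- x \<in> L" if x: "x \<in> L" for x
  proof -
    obtain c where c: "\<forall>i. i \<notin> J \<longrightarrow> c i = 0" "x = zcomb b c" using x unfolding L by auto
    then have "- x = zcomb b (\<lambda>i. - c i)" by (simp add: zcomb_minus)
    then show ?thesis unfolding L by (rule image_eqI[where f = "zcomb b"]) (use c in simp)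
  qed
  ultimately show ?thesis by (simp add: subgrp_def)
qed

lemma zbasis_mem:
  assumes "is_zbasis J b L" "j \<in> J"
  shows "b j \<in> L"
proof -
  have L: "L = zcomb b ` {c. \<forall>i. i \<notin> J \<longrightarrow> c i = 0}" using assms by (simp add: is_zbasis_def bij_betw_def)
  have "b j = zcomb b (\<lambda>i. if i = j then 1 else 0)" by (simp add: zcomb_single)
  then show ?thesis unfolding L by (rule image_eqI[where f = "zcomb b"]) (use assms(2) in auto)
qed

lemma zbasis_inj: "is_zbasis UNIV b L \<Longrightarrow> inj (zcomb b)"
  by (simp add: is_zbasis_def bij_betw_def)

lemma zbasis_coords:
  assumes "is_zbasis UNIV b L" "x \<in> L"
  shows "zcomb b (inv (zcomb b) x) = x"
  using assms by (auto simp: is_zbasis_def bij_betw_def f_inv_into_f)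

text \<open>The coordinate change dual to replacing \<open>v k\<close> by \<open>- v k\<close> and
  every other \<open>v a\<close> by \<open>v a + h a v k\<close>. Being an involution, it carries
  linear independence to the new vectors.\<close>

definition kmap :: "('a::finite \<Rightarrow> int) \<Rightarrow> 'a \<Rightarrow> ('a \<Rightarrow> int) \<Rightarrow> 'a \<Rightarrow> int" where
  "kmap h k y = y(k := (\<Sum>a\<in>UNIV - {k}. h a * y a) - y k)"

lemma kmap_kmap: "kmap h k (kmap h k y) = y"
  by (auto simp: kmap_def fun_eq_iff)

lemma zcomb_kmap:
  fixes v :: "'a::finite \<Rightarrow> 'b::ab_group_add"
  assumes "\<And>a. v' a = (if a = k then - v k else v a + zscale (h a) (v k))"
  shows "zcomb v' (kmap h k y) = zcomb v y"
proof -
  let ?S = "\<Sum>a\<in>UNIV - {k}. h a * y a"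
  have "zcomb v' (kmap h k y) = zscale (?S - y k) (- v k) + (\<Sum>a\<in>UNIV - {k}. zscale (y a) (v a + zscale (h a) (v k)))"
    unfolding zcomb_def by (subst sum.remove[of _ k]) (auto simp: kmap_def assms intro!: sum.cong)
  also have "(\<Sum>a\<in>UNIV - {k}. zscale (y a) (v a + zscale (h a) (v k))) =
     (\<Sum>a\<in>UNIV - {k}. zscale (y a) (v a)) + zscale ?S (v k)"
    by (simp add: zscale_add_right sum.distrib zscale_zscale zscale_sum_left mult.commute)
  also have "zscale (?S - y k) (- v k) = zscale (y k) (v k) - zscale ?S (v k)"
    using zscale_add_left[of ?S "- y k" "v k"] by (simp add: zscale_minus_right zscale_minus_left)
  also have "zscale (y k) (v k) - zscale ?S (v k) + ((\<Sum>a\<in>UNIV - {k}. zscale (y a) (v a)) + zscale ?S (v k)) = zcomb v y"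
    unfolding zcomb_def by (subst sum.remove[of UNIV k]) auto
  finally show ?thesis .
qed

lemma inj_zcomb_kmap:
  fixes v :: "'a::finite \<Rightarrow> 'b::ab_group_add"
  assumes "\<And>a. v' a = (if a = k then - v k else v a + zscale (h a) (v k))" "inj (zcomb v)"
  shows "inj (zcomb v')"
proof (rule injI)
  fix x y assume "zcomb v' x = zcomb v' y"
  then have "zcomb v (kmap h k x) = zcomb v (kmap h k y)"
    using zcomb_kmap[OF assms(1), of "kmap h k _"] by (simp add: kmap_kmap)
  then have "kmap h k x = kmap h k y" using assms(2) by (simp add: inj_def)
  then show "x = y" by (metis kmap_kmap)
qed

subsection \<open>The principal seed\<close>

lemma sum_UNIV_sum: "(\<Sum>a\<in>(UNIV :: ('a::finite + 'b::finite) set). g a) = (\<Sum>i\<in>UNIV. g (Inl i)) + (\<Sum>j\<in>UNIV. g (Inr j))"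
  unfolding UNIV_Plus_UNIV[symmetric] by (subst sum.Plus) (auto simp: comp_def)

lemma amap_scale: "amap E k (\<lambda>l. c * n l) = (\<lambda>l. c * amap E k n l)"
  by (auto simp: fun_eq_iff amap_apply colpos_def sum_distrib_left mult.assoc right_diff_distrib)

locale principal_setup =
  fixes F :: "('n::ab_group_add, 'i::finite) gen_fixed_data"
    and p :: "'n \<Rightarrow> 'n \<Rightarrow> rat"
    and s :: "('n, 'i, 'r) torus_seed"
  assumes fd: "is_gen_fixed_data F" and ps: "is_p_star F p"
    and bN: "is_zbasis UNIV (vec s) (latN F)" and bU: "is_zbasis (Iuf F) (vec s) (latNuf F)"
    and bO: "is_zbasis UNIV (\<lambda>i. zscale (int (dnum F i)) (vec s i)) (latNo F)"
begin

abbreviation "dn \<equiv> dnum F"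
abbreviation "rd \<equiv> rdeg F"
abbreviation "ff \<equiv> seed_f F s"
abbreviation "Fh \<equiv> principal_data F"
abbreviation "bh \<equiv> bform Fh"
abbreviation "st ks \<equiv> fold (mutate F) ks s"
abbreviation "sh ks \<equiv> fold (mutate Fh) (map Inl ks) (principal_seed F s)"

lemmas gN = zbasis_subgrp[OF bN] and gU = zbasis_subgrp[OF bU] and gO = zbasis_subgrp[OF bO]

lemma d_pos: "0 < dn i" and r_pos: "0 < rd i"
  using fd by (auto simp: is_gen_fixed_data_def)

lemma UN: "x \<in> latNuf F \<Longrightarrow> x \<in> latN F" and ON: "x \<in> latNo F \<Longrightarrow> x \<in> latN F"
  using fd by (auto simp: is_gen_fixed_data_def)

lemma bf_add_left: "x \<in> latN F \<Longrightarrow> y \<in> latN F \<Longrightarrow> z \<in> latN F \<Longrightarrow> bform F (x + y) z = bform F x z + bform F y z"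
  using fd unfolding is_gen_fixed_data_def by blast

lemma bf_skew: "x \<in> latN F \<Longrightarrow> y \<in> latN F \<Longrightarrow> bform F x y = - bform F y x"
  using fd unfolding is_gen_fixed_data_def by blast

lemma bf_add_right: "x \<in> latN F \<Longrightarrow> y \<in> latN F \<Longrightarrow> z \<in> latN F \<Longrightarrow> bform F z (x + y) = bform F z x + bform F z y"
proof -
  assume a: "x \<in> latN F" "y \<in> latN F" "z \<in> latN F"
  then have "x + y \<in> latN F" using gN by (simp add: subgrp_def)
  then show ?thesis
    using bf_skew[of z "x + y"] bf_skew[of z x] bf_skew[of z y] bf_add_left[of x y z] a by simp
qed

lemma bf_int1: "x \<in> latNuf F \<Longrightarrow> y \<in> latNo F \<Longrightarrow> bform F x y \<in> \<int>"
  using fd unfolding is_gen_fixed_data_def by blast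

lemma bf_int2: "x \<in> latN F \<Longrightarrow> y \<in> latNuf F \<Longrightarrow> y \<in> latNo F \<Longrightarrow> bform F x y \<in> \<int>"
  using fd unfolding is_gen_fixed_data_def by blast

lemma bf_zscale_left: "x \<in> latN F \<Longrightarrow> y \<in> latN F \<Longrightarrow> bform F (zscale k x) y = of_int k * bform F x y"
  using additive_on_zscale[OF gN, of "\<lambda>x. bform F x y" x k] bf_add_left by (simp add: zscale_rat)

lemma bf_zscale_right: "x \<in> latN F \<Longrightarrow> y \<in> latN F \<Longrightarrow> bform F x (zscale k y) = of_int k * bform F x y"
  using additive_on_zscale[OF gN, of "\<lambda>y. bform F x y" y k] bf_add_right by (simp add: zscale_rat)

lemma bf_zero_left: "y \<in> latN F \<Longrightarrow> bform F 0 y = 0"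
  using additive_on_zero[OF gN, of "\<lambda>x. bform F x y"] bf_add_left by simp

definition crd :: "'n \<Rightarrow> 'i \<Rightarrow> int" where
  "crd x = inv (zcomb (vec s)) x"

lemma crd_zcomb: "crd (zcomb (vec s) c) = c"
  unfolding crd_def using zbasis_inj[OF bN] by simp

lemma zcomb_crd: "x \<in> latN F \<Longrightarrow> zcomb (vec s) (crd x) = x"
  unfolding crd_def by (rule zbasis_coords[OF bN])

lemma vecN: "vec s i \<in> latN F" using zbasis_mem[OF bN] by simp

lemma crd_add: "x \<in> latN F \<Longrightarrow> y \<in> latN F \<Longrightarrow> crd (x + y) = (\<lambda>i. crd x i + crd y i)"
  using crd_zcomb[of "\<lambda>i. crd x i + crd y i"] by (simp add: zcomb_add zcomb_crd)

lemma ff_eq: "x \<in> latN F \<Longrightarrow> ff j x = of_int (crd x j) / of_nat (dn j)"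
  by (simp add: seed_f_def crd_def)

lemma ff_add: "x \<in> latN F \<Longrightarrow> y \<in> latN F \<Longrightarrow> ff j (x + y) = ff j x + ff j y"
  using gN by (simp add: ff_eq crd_add add_divide_distrib subgrp_def)

lemma ff_vec: "ff j (vec s i) = (if i = j then 1 / of_nat (dn j) else 0)"
proof -
  have "crd (vec s i) = (\<lambda>j. if j = i then 1 else 0)"
    using crd_zcomb[of "\<lambda>j. if j = i then 1 else 0"] by (simp add: zcomb_single)
  then show ?thesis by (simp add: ff_eq[OF vecN])
qed

lemma ff_int: "x \<in> latNo F \<Longrightarrow> ff j x \<in> \<int>"
proof -
  assume x: "x \<in> latNo F"
  then obtain c where c: "x = zcomb (\<lambda>i. zscale (int (dn i)) (vec s i)) c"
    using bO by (auto simp: is_zbasis_def bij_betw_def)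
  then have "x = zcomb (vec s) (\<lambda>i. c i * int (dn i))" by (simp add: zcomb_def zscale_zscale)
  then have "crd x = (\<lambda>i. c i * int (dn i))" by (simp add: crd_zcomb)
  then show ?thesis using ff_eq[OF ON[OF x], of j] d_pos[of j] by simp
qed

lemma ff_Mo: "ff j \<in> latMo F"
  unfolding latMo_def using ff_add ff_int by (auto simp: seed_f_def)

lemma gMo: "subgrp (latMo F)"
  by (auto simp: subgrp_def latMo_def)

lemma Fh_simps [simp]:
  "latN Fh = latN F \<times> latMo F" "Iuf Fh = Inl ` Iuf F"
  "dnum Fh (Inl i) = dn i" "dnum Fh (Inr i) = dn i" "rdeg Fh (Inl i) = rd i"
  "bh (a, b) (a', b') = bform F a a' + b' a - b a'"
  by (simp_all add: principal_data_def)

lemma gNh: "subgrp (latN Fh)"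
  using gN gMo by (auto simp: subgrp_def zero_prod_def)

lemma bh_add_left: "X \<in> latN Fh \<Longrightarrow> Y \<in> latN Fh \<Longrightarrow> Z \<in> latN Fh \<Longrightarrow> bh (X + Y) Z = bh X Z + bh Y Z"
  by (cases X; cases Y; cases Z) (auto simp: bf_add_left latMo_def)

lemma bh_skew: "X \<in> latN Fh \<Longrightarrow> Y \<in> latN Fh \<Longrightarrow> bh X Y = - bh Y X"
  using bf_skew[of "fst X" "fst Y"] by (cases X; cases Y) auto

lemma bh_add_right: "X \<in> latN Fh \<Longrightarrow> Y \<in> latN Fh \<Longrightarrow> Z \<in> latN Fh \<Longrightarrow> bh Z (X + Y) = bh Z X + bh Z Y"
proof -
  assume a: "X \<in> latN Fh" "Y \<in> latN Fh" "Z \<in> latN Fh"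
  then have "X + Y \<in> latN Fh" using gNh unfolding subgrp_def by blast
  then show ?thesis
    using bh_skew[of Z "X + Y"] bh_skew[of Z X] bh_skew[of Z Y] bh_add_left[of X Y Z] a by simp
qed

lemma bh_zscale_left: "X \<in> latN Fh \<Longrightarrow> Y \<in> latN Fh \<Longrightarrow> bh (zscale k X) Y = of_int k * bh X Y"
  using additive_on_zscale[OF gNh, of "\<lambda>x. bh x Y" X k] bh_add_left by (simp only: zscale_rat)

lemma bh_zscale_right: "X \<in> latN Fh \<Longrightarrow> Y \<in> latN Fh \<Longrightarrow> bh X (zscale k Y) = of_int k * bh X Y"
  using additive_on_zscale[OF gNh, of "\<lambda>y. bh X y" Y k] bh_add_right by (simp only: zscale_rat)

lemma bh_zcomb_left:
  assumes "\<And>a. b a \<in> latN Fh" "Y \<in> latN Fh"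
  shows "bh (zcomb b c) Y = (\<Sum>a\<in>UNIV. of_int (c a) * bh (b a) Y)"
  using additive_on_zcomb[OF gNh, of "\<lambda>x. bh x Y" b c] bh_add_left assms by (simp only: zcomb_rat)

lemma p_Mo: "n \<in> latN F \<Longrightarrow> p n \<in> latMo F"
  and p_add: "n \<in> latN F \<Longrightarrow> n' \<in> latN F \<Longrightarrow> p (n + n') = p n + p n'"
  and p_uf: "n \<in> latNuf F \<Longrightarrow> p n = p1_star F n"
  using ps unfolding is_p_star_def by blast+

definition p_pair :: "'i \<Rightarrow> 'i \<Rightarrow> int" where
  "p_pair i j = pairing F s (p (vec s j)) i"

lemma zscale_vec_No: "zscale (int (dn i)) (vec s i) \<in> latNo F"
  using zbasis_mem[OF bO, of i] by simp

lemma p_pair_eq: "of_int (p_pair i j) = p (vec s j) (zscale (int (dn i)) (vec s i))"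
proof -
  have "p (vec s j) (zscale (int (dn i)) (vec s i)) \<in> \<int>"
    using p_Mo[OF vecN] zscale_vec_No unfolding latMo_def by blast
  then show ?thesis by (simp add: p_pair_def pairing_def of_int_floor_cancel)
qed

text \<open>Expand \<open>p u\<close> over the basis; on the unfrozen part \<open>p\<close> is given
  by the form.\<close>

lemma p_pair_sum:
  assumes u: "u \<in> latNuf F"
  shows "(\<Sum>j\<in>UNIV. of_int (crd u j) * of_int (p_pair i j)) = of_nat (dn i) * bform F u (vec s i)"
proof -
  let ?x = "zscale (int (dn i)) (vec s i)"
  have "p u = p (zcomb (vec s) (crd u))" using zcomb_crd[OF UN[OF u]] by simp
  also have "\<dots> = zcomb (\<lambda>j. p (vec s j)) (crd u)"
    by (rule additive_on_zcomb[OF gN p_add vecN])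
  finally have "p u ?x = zcomb (\<lambda>j. p (vec s j)) (crd u) ?x" by simp
  also have "\<dots> = (\<Sum>j\<in>UNIV. of_int (crd u j) * p (vec s j) ?x)"
  proof -
    have "(\<Sum>j\<in>A. zscale (crd u j) (p (vec s j))) ?x = (\<Sum>j\<in>A. of_int (crd u j) * p (vec s j) ?x)" for A
      by (induction A rule: infinite_finite_induct) (auto simp: zscale_fun_rat)
    then show ?thesis by (simp add: zcomb_def)
  qed
  finally have "(\<Sum>j\<in>UNIV. of_int (crd u j) * of_int (p_pair i j)) = p u ?x" by (simp add: p_pair_eq)
  also have "\<dots> = bform F u ?x"
    using ON[OF zscale_vec_No] by (simp add: p_uf[OF u] p1_star_def)
  also have "\<dots> = of_nat (dn i) * bform F u (vec s i)"
    using bf_zscale_right[OF UN[OF u] vecN] by simp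
  finally show ?thesis .
qed

text \<open>The rescaled exchange matrix, symmetrized by \<open>D0 i = d_i r_i\<close>. Entries
  between two frozen indices may be non-integral before rounding, so they are set to 0.\<close>

definition E0 :: "'i \<Rightarrow> 'i \<Rightarrow> int" where
  "E0 i j = (if i \<in> Iuf F \<or> j \<in> Iuf F then eps F s i j * int (rd j) else 0)"

definition D0 :: "'i \<Rightarrow> real" where
  "D0 i = real (dn i * rd i)"

text \<open>The form is integral between the unfrozen part and \<open>latNo\<close> in either order,
  so the floor changes nothing as soon as one index is unfrozen.\<close>

lemma eps_exact:
  assumes "\<And>i. vec t i \<in> latN F" "\<And>i. i \<in> Iuf F \<Longrightarrow> vec t i \<in> latNuf F"
    "\<And>i. zscale (int (dn i)) (vec t i) \<in> latNo F" "i \<in> Iuf F \<or> j \<in> Iuf F"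
  shows "of_int (eps F t i j) = bform F (vec t i) (vec t j) * of_nat (dn j)"
proof -
  have "bform F (vec t i) (zscale (int (dn j)) (vec t j)) \<in> \<int>"
    using assms(4)
  proof
    assume "i \<in> Iuf F"
    then show ?thesis using assms by (intro bf_int1) auto
  next
    assume "j \<in> Iuf F"
    then show ?thesis using assms subgrp_zscale[OF gU] by (intro bf_int2) auto
  qed
  then have "bform F (vec t i) (vec t j) * of_nat (dn j) \<in> \<int>"
    using assms(1) by (simp add: bf_zscale_right mult.commute)
  then show ?thesis by (simp add: eps_def of_int_floor_cancel)
qed

lemma vecU: "i \<in> Iuf F \<Longrightarrow> vec s i \<in> latNuf F" using zbasis_mem[OF bU] by simp

lemma E0_eq: "i \<in> Iuf F \<or> j \<in> Iuf F \<Longrightarrow> of_int (E0 i j) = bform F (vec s i) (vec s j) * of_nat (dn j) * of_nat (rd j)"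
  using eps_exact[of s i j, OF vecN vecU zscale_vec_No] by (simp add: E0_def)

lemma exchange_E0: "exchange E0 D0"
proof
  fix i j
  show "0 < D0 i" using d_pos r_pos by (simp add: D0_def)
  have "int (dn i * rd i) * E0 i j = - (int (dn j * rd j) * E0 j i)"
  proof (cases "i \<in> Iuf F \<or> j \<in> Iuf F")
    case True
    then have "of_int (int (dn i * rd i) * E0 i j) = (of_int (- (int (dn j * rd j) * E0 j i)) :: rat)"
      using E0_eq[OF True] E0_eq[of j i] bf_skew[OF vecN vecN, of i j] by auto
    then show ?thesis by (simp only: of_int_eq_iff)
  next
    case False
    then show ?thesis by (simp add: E0_def)
  qed
  then have "real_of_int (int (dn i * rd i) * E0 i j) = real_of_int (- (int (dn j * rd j) * E0 j i))"
    by (simp only:)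
  then show "D0 i * E0 i j = - (D0 j * E0 j i)" by (simp add: D0_def)
qed

definition Xv :: "'i \<Rightarrow> 'i list \<Rightarrow> 'i + 'i \<Rightarrow> int" where
  "Xv i ks = case_sum (\<lambda>l. int (dn i) * Gam ks E0 (axis_vec i 1) l) (\<lambda>j. - p_pair i j * int (dn j))"

text \<open>Evaluation of functionals at \<open>xi i\<close> is the \<open>i\<close>-th coordinate of the weight.\<close>

definition xi :: "'i \<Rightarrow> 'n \<times> ('n \<Rightarrow> rat)" where
  "xi i = zcomb (vec (principal_seed F s)) (Xv i [])"

text \<open>Pairings of frozen with unfrozen vectors are c-vectors up to sign, and the coordinates
  of \<open>xi i\<close> are given by \<open>Gam\<close>. The last clause puts the dual lattice
  \<open>latNo\<close> of the principal data into the span of the rescaled mutated vectors, which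
  makes the final \<open>f\<close>-functionals integral.\<close>

definition principal_inv :: "'i list \<Rightarrow> bool" where
  "principal_inv ks \<longleftrightarrow>
     (\<forall>i. vec (sh ks) (Inl i) = (vec (st ks) i, 0)) \<and>
     (\<forall>i. vec (st ks) i \<in> latN F) \<and> (\<forall>i\<in>Iuf F. vec (st ks) i \<in> latNuf F) \<and>
     (\<forall>i. zscale (int (dn i)) (vec (st ks) i) \<in> latNo F) \<and>
     (\<forall>j. fst (vec (sh ks) (Inr j)) \<in> latNuf F \<and> snd (vec (sh ks) (Inr j)) = ff j) \<and>
     (\<forall>i j. i \<in> Iuf F \<or> j \<in> Iuf F \<longrightarrow> of_int (fold mutE ks E0 i j) =
        bform F (vec (st ks) i) (vec (st ks) j) * of_nat (dn j) * of_nat (rd j)) \<and>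
     (\<forall>j k. bh (vec (sh ks) (Inr j)) (vec (sh ks) (Inl k)) * of_nat (dn j) =
        - of_int (Lam ks E0 (axis_vec k 1) j)) \<and>
     inj (zcomb (vec (sh ks))) \<and>
     (\<forall>i. zcomb (vec (sh ks)) (Xv i ks) = xi i) \<and>
     (\<forall>a. \<exists>Y. zcomb (vec (sh ks)) Y = zscale (int (dnum Fh a)) (vec (principal_seed F s) a) \<and>
        (\<forall>b. int (dnum Fh b) dvd Y b))"

lemma pvec [simp]: "vec (principal_seed F s) (Inl i) = (vec s i, 0)" "vec (principal_seed F s) (Inr j) = (0, ff j)"
  by (simp_all add: principal_seed_def)

lemma zero_in: "0 \<in> latN F" "0 \<in> latNuf F" "0 \<in> latMo F"
  using gN gU gMo by (auto simp: subgrp_def)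

lemma pvec_Nh: "vec (principal_seed F s) a \<in> latN Fh"
  using vecN ff_Mo zero_in by (cases a) auto

text \<open>The first component determines the unfrozen coordinates, and evaluating the second at
  \<open>vec s i\<close> gives the \<open>i\<close>-th frozen one, since \<open>f_i\<close> takes
  the value \<open>1 / d_i\<close> there.\<close>

lemma inj_zcomb_principal: "inj (zcomb (vec (principal_seed F s)))"
proof (rule injI)
  fix x y :: "'i + 'i \<Rightarrow> int"
  let ?z = "zcomb (vec (principal_seed F s))"
  assume eq: "?z x = ?z y"
  have f: "fst (?z c) = zcomb (vec s) (\<lambda>i. c (Inl i))" for c :: "'i + 'i \<Rightarrow> int"
    by (simp add: zcomb_def sum_UNIV_sum fst_sum zscale_fst)
  have sn: "snd (?z c) (vec s i) = of_int (c (Inr i)) / of_nat (dn i)" for c :: "'i + 'i \<Rightarrow> int" and i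
  proof -
    have ap: "(\<Sum>j\<in>A. g j) x = (\<Sum>j\<in>A. g j x)" for A :: "'i set" and g :: "'i \<Rightarrow> 'n \<Rightarrow> rat" and x
      by (induction A rule: infinite_finite_induct) auto
    have "snd (?z c) = (\<Sum>j\<in>UNIV. zscale (c (Inl j)) 0) + (\<Sum>j\<in>UNIV. zscale (c (Inr j)) (ff j))"
      by (simp add: zcomb_def sum_UNIV_sum snd_sum zscale_snd)
    then have "snd (?z c) (vec s i) = (\<Sum>j\<in>UNIV. of_int (c (Inr j)) * ff j (vec s i))"
      by (simp add: ap zscale_fun_rat)
    then show ?thesis by (simp add: ff_vec if_distrib cong: if_cong)
  qed
  have "(\<lambda>i. x (Inl i)) = (\<lambda>i. y (Inl i))"
    using arg_cong[OF eq, of fst] zbasis_inj[OF bN] by (simp add: f inj_def)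
  moreover have "x (Inr i) = y (Inr i)" for i
    using arg_cong[OF eq, of "\<lambda>z. snd z (vec s i)"] d_pos[of i] by (simp add: sn)
  ultimately show "x = y" by (metis sum.exhaust ext)
qed

lemma principal_inv_Nil: "principal_inv []"
proof -
  have "bh (0, ff j) (vec s k, 0) * of_nat (dn j) = - of_int (axis_vec k 1 j)" for j k
    using d_pos[of j] d_pos[of k] by (simp add: bf_zero_left[OF vecN] ff_vec axis_vec_apply)
  moreover have "\<exists>Y. zcomb (vec (principal_seed F s)) Y = zscale (int (dnum Fh a)) (vec (principal_seed F s) a) \<and>
        (\<forall>b. int (dnum Fh b) dvd Y b)" for a
    by (rule exI[of _ "\<lambda>b. if b = a then int (dnum Fh a) else 0"]) (simp add: zcomb_single)
  ultimately show ?thesis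
    unfolding principal_inv_def using vecN vecU zscale_vec_No zero_in E0_eq inj_zcomb_principal
    by (simp add: xi_def del: Fh_simps(6))
qed

text \<open>The contributions \<open>d_i {e_i, u}\<close> and \<open>d_i {u, e_i}\<close> cancel.
  Equivalently, the characters occurring in mutation factors have weight 0.\<close>

lemma bh_xi:
  assumes u: "u \<in> latNuf F"
  shows "bh (xi i) (u, 0) = 0"
proof -
  have uN: "u \<in> latN F" using UN[OF u] .
  have "bh (xi i) (u, 0) = (\<Sum>a\<in>UNIV. of_int (Xv i [] a) * bh (vec (principal_seed F s) a) (u, 0))"
    unfolding xi_def by (rule bh_zcomb_left[OF pvec_Nh]) (use uN zero_in in auto)
  also have "\<dots> = (\<Sum>l\<in>UNIV. if l = i then of_nat (dn i) * bform F (vec s i) u else 0) +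
      (\<Sum>j\<in>UNIV. of_int (crd u j) * of_int (p_pair i j))"
    unfolding sum_UNIV_sum
  proof (rule arg_cong2[where f = "(+)"]; rule sum.cong[OF refl])
    fix j
    show "of_int (Xv i [] (Inr j)) * bh (vec (principal_seed F s) (Inr j)) (u, 0) = of_int (crd u j) * of_int (p_pair i j)"
      using d_pos[of j] by (simp add: Xv_def bf_zero_left[OF uN] ff_eq[OF uN])
  qed (auto simp: Xv_def axis_vec_apply)
  also have "\<dots> = of_nat (dn i) * (bform F (vec s i) u + bform F u (vec s i))"
    by (simp add: p_pair_sum[OF u] distrib_left)
  finally show ?thesis using bf_skew[OF uN vecN, of i] by simp
qed

end

lemma mult_max_0: "(0::int) \<le> c \<Longrightarrow> c * max 0 x = max 0 (c * x)"
  by (auto simp: max_def mult_le_0_iff zero_le_mult_iff)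

context principal_setup
begin

lemma principal_inv_step:
  assumes I: "principal_inv ks" and k: "k \<in> Iuf F"
  shows "principal_inv (ks @ [k])"
proof -
  define v where "v = vec (sh ks)"
  define w where "w = vec (st ks)"
  define v' where "v' = vec (sh (ks @ [k]))"
  define w' where "w' = vec (st (ks @ [k]))"
  define Et where "Et = fold mutE ks E0"
  define cL where "cL = Lam ks E0 (axis_vec k 1)"
  define ep where "ep a = eps Fh (sh ks) a (Inl k)" for a
  define h where "h a = int (rd k) * max 0 (ep a)" for a
  define K where "K = v (Inl k)"
  define be where "be a = bh (v a) K" for a
  have v'_eq: "v' a = (if a = Inl k then - K else v a + zscale (h a) K)" for a
    by (simp add: v'_def v_def mutate_def h_def ep_def K_def)
  have w'_eq: "w' i = (if i = k then - w k else w i + zscale (int (rd k) * max 0 (eps F (st ks) i k)) (w k))" for i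
    by (simp add: w'_def w_def mutate_def)
  have I1: "v (Inl i) = (w i, 0)" and I2: "w i \<in> latN F" and I2u: "i \<in> Iuf F \<Longrightarrow> w i \<in> latNuf F"
    and I2o: "zscale (int (dn i)) (w i) \<in> latNo F"
    and I3: "fst (v (Inr i)) \<in> latNuf F" "snd (v (Inr i)) = ff i" for i
    using I by (auto simp: principal_inv_def v_def w_def)
  have I4: "of_int (Et i j) = bform F (w i) (w j) * of_nat (dn j) * of_nat (rd j)"
    if "i \<in> Iuf F \<or> j \<in> Iuf F" for i j
    using I that unfolding principal_inv_def Et_def w_def by blast
  have I5: "bh (v (Inr j)) (v (Inl l)) * of_nat (dn j) = - of_int (Lam ks E0 (axis_vec l 1) j)" for j l
    using I unfolding principal_inv_def v_def by blast
  have I6: "inj (zcomb v)" using I unfolding principal_inv_def v_def by blast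
  have I7: "zcomb v (Xv i ks) = xi i" for i using I unfolding principal_inv_def v_def by blast
  have I8: "\<exists>Y. zcomb v Y = zscale (int (dnum Fh a)) (vec (principal_seed F s) a) \<and>
        (\<forall>b. int (dnum Fh b) dvd Y b)" for a
    using I unfolding principal_inv_def v_def by blast
  have Kw: "K = (w k, 0)" by (simp add: K_def I1)
  have vN: "v a \<in> latN Fh" for a
  proof (cases a)
    case (Inl i)
    then show ?thesis using I1 I2 zero_in by simp
  next
    case (Inr j)
    then show ?thesis using I3[of j] UN ff_Mo by (metis Fh_simps(1) SigmaI prod.collapse)
  qed
  have KN: "K \<in> latN Fh" unfolding K_def by (rule vN)
  have exEt: "exchange Et D0" unfolding Et_def by (rule exchange_fold[OF exchange_E0])
  interpret Et: exchange Et D0 by (rule exEt)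
  have wk: "w k \<in> latNuf F" "w k \<in> latN F" using I2u[OF k] I2 by auto
  have beL: "be (Inl i) = bform F (w i) (w k)" for i by (simp add: be_def Kw I1)
  have beR: "be (Inr j) = bform F (fst (v (Inr j))) (w k) - ff j (w k)" for j
    using I3(2)[of j] by (cases "v (Inr j)") (simp add: be_def Kw)
  have ffz: "ff j (zscale z x) = of_int z * ff j x" if "x \<in> latN F" for j z x
    using additive_on_zscale[OF gN, of "ff j" x z] ff_add that by (simp add: zscale_rat)
  have ep_eq: "of_int (ep a) = be a * of_nat (dn k)" for a
  proof (cases a)
    case (Inl i)
    have "ep a = eps F (st ks) i k" using Inl by (simp add: ep_def eps_def v_def[symmetric] w_def[symmetric] I1)
    moreover have "of_int (eps F (st ks) i k) = bform F (w i) (w k) * of_nat (dn k)"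
      using eps_exact[of "st ks" i k] I2 I2u I2o k by (simp add: w_def)
    ultimately show ?thesis using Inl by (simp add: beL)
  next
    case (Inr j)
    let ?n = "fst (v (Inr j))"
    have "bform F ?n (zscale (int (dn k)) (w k)) - ff j (zscale (int (dn k)) (w k)) \<in> \<int>"
      using bf_int1[OF I3(1) I2o] ff_int[OF I2o] by (intro Ints_diff)
    then have "be a * of_nat (dn k) \<in> \<int>"
      using Inr by (simp add: beR bf_zscale_right[OF UN[OF I3(1)] wk(2)] ffz[OF wk(2)] algebra_simps)
    moreover have "ep a = \<lfloor>be a * of_nat (dn k)\<rfloor>" by (simp add: ep_def eps_def be_def v_def[symmetric] K_def)
    ultimately show ?thesis by (simp add: of_int_floor_cancel)
  qed
  have epsL: "eps F (st ks) i k = ep (Inl i)" for i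
    by (simp add: ep_def eps_def v_def[symmetric] w_def[symmetric] I1)
  have hE: "h (Inl i) = max 0 (Et i k)" for i
  proof -
    have "of_int (int (rd k) * ep (Inl i)) = (of_int (Et i k) :: rat)"
      using I4[of i k] k ep_eq[of "Inl i"] by (simp add: beL mult.commute)
    then have "int (rd k) * ep (Inl i) = Et i k" by (simp only: of_int_eq_iff)
    then show ?thesis by (simp add: h_def mult_max_0)
  qed
  have zint: "\<exists>z. int (dnum Fh a) * ep a = int (dn k) * z" for a
  proof -
    have "\<exists>z. be a * of_nat (dnum Fh a) = of_int z"
    proof (cases a)
      case (Inl i)
      have "be a * of_nat (dnum Fh a) = - bform F (w k) (zscale (int (dn i)) (w i))"
        using Inl bf_skew[OF I2 wk(2), of i] by (simp add: beL bf_zscale_right[OF wk(2) I2] mult.commute)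
      moreover have "- bform F (w k) (zscale (int (dn i)) (w i)) \<in> \<int>"
        using bf_int1[OF wk(1) I2o] by (intro Ints_minus)
      ultimately show ?thesis by (metis Ints_cases)
    next
      case (Inr j)
      then show ?thesis using I5[of j k] by (auto simp: be_def K_def intro: exI[of _ "- Lam ks E0 (axis_vec k 1) j"])
    qed
    then obtain z where z: "be a * of_nat (dnum Fh a) = of_int z" by blast
    then have "of_int (int (dnum Fh a) * ep a) = (of_int (int (dn k) * z) :: rat)"
      using ep_eq[of a] by (simp flip: z add: mult_ac)
    then have "int (dnum Fh a) * ep a = int (dn k) * z" by (simp only: of_int_eq_iff)
    then show ?thesis by blast
  qed
  \<comment> \<open>Multiplying the mutation exponent by the multiplier of \<open>a\<close> makes it
    divisible by \<open>d_k\<close>; hence rescaled vectors mutate by integral combinations of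
    rescaled vectors.\<close>
  have hz: "int (dn k) dvd int (dnum Fh a) * h a" for a
  proof -
    obtain z where "int (dnum Fh a) * ep a = int (dn k) * z" using zint by blast
    then have "int (dnum Fh a) * max 0 (ep a) = int (dn k) * max 0 z" by (simp add: mult_max_0)
    then have "int (dnum Fh a) * h a = int (dn k) * (int (rd k) * max 0 z)"
      unfolding h_def by (metis mult.assoc mult.commute)
    then show ?thesis by simp
  qed
  have beK: "be (Inr j) * of_nat (dn j) = - of_int (cL j)" for j
    using I5[of j k] by (simp add: be_def K_def cL_def)
  have coh: "0 \<le> cL \<or> cL \<le> 0" unfolding cL_def by (rule Lam_sign_coherent[OF exchange_E0])
  have hR0: "h (Inr j) = 0" if "0 \<le> cL" for j
  proof -
    have "be (Inr j) * of_nat (dn j) \<le> 0" using beK[of j] that by (simp add: le_fun_def)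
    then have "be (Inr j) \<le> 0" using d_pos[of j] by (simp add: mult_le_0_iff)
    then have "(of_int (ep (Inr j)) :: rat) \<le> 0" unfolding ep_eq by (simp add: mult_nonpos_nonneg)
    then show ?thesis by (simp add: h_def)
  qed
  have hR1: "of_int (h (Inr j)) = of_nat (rd k) * (be (Inr j) * of_nat (dn k))" if "\<not> 0 \<le> cL" for j
  proof -
    have "cL j \<le> 0" using that coh by (auto simp: le_fun_def)
    then have "0 \<le> be (Inr j) * of_nat (dn j)" using beK[of j] by simp
    then have "0 \<le> be (Inr j)" using d_pos[of j] by (simp add: zero_le_mult_iff)
    then have "0 \<le> (of_int (ep (Inr j)) :: rat)" unfolding ep_eq by simp
    then show ?thesis unfolding ep_eq[symmetric] by (simp add: h_def)
  qed
  define G where "G = (if 0 \<le> cL then Et else nege Et)"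
  have w'E: "w' i = (if i = k then - w k else w i + zscale (max 0 (Et i k)) (w k))" for i
    unfolding w'_eq epsL using hE by (simp add: h_def)
  have J1: "v' (Inl i) = (w' i, 0)" for i
    by (simp add: v'_eq w'E I1 Kw hE zscale_Pair)
  have J2: "w' i \<in> latN F" for i
    using I2 gN subgrp_zscale[OF gN] by (simp add: w'E subgrp_def)
  have J2u: "w' i \<in> latNuf F" if "i \<in> Iuf F" for i
    using I2u[OF that] wk gU subgrp_zscale[OF gU] by (simp add: w'E subgrp_def)
  have J2o: "zscale (int (dn i)) (w' i) \<in> latNo F" for i
  proof (cases "i = k")
    case True
    then show ?thesis using I2o gO by (simp add: w'E zscale_minus_right subgrp_def)
  next
    case False
    obtain z where z: "int (dn i) * h (Inl i) = int (dn k) * z" using hz[of "Inl i"] by (auto elim: dvdE)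
    have "zscale (int (dn i)) (w' i) = zscale (int (dn i)) (w i) + zscale z (zscale (int (dn k)) (w k))"
      using False z by (simp add: w'E hE zscale_add_right zscale_zscale mult.commute)
    then show ?thesis using I2o gO subgrp_zscale[OF gO] by (simp add: subgrp_def)
  qed
  have J3: "fst (v' (Inr j)) \<in> latNuf F" "snd (v' (Inr j)) = ff j" for j
    using I3[of j] wk gU subgrp_zscale[OF gU]
    by (simp_all add: v'_eq Kw zscale_Pair subgrp_def)
  have bkk: "bform F (w k) (w k) = 0" using bf_skew[OF wk(2) wk(2)] by simp
  have J4: "of_int (mutE k Et i j) = bform F (w' i) (w' j) * of_nat (dn j) * of_nat (rd j)"
    if ij: "i \<in> Iuf F \<or> j \<in> Iuf F" for i j
  proof -
    have zN: "zscale z (w k) \<in> latN F" for z by (rule subgrp_zscale[OF gN wk(2)])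
    have mN: "- w k \<in> latN F" using gN wk by (simp add: subgrp_def)
    have m1: "bform F (- w k) y = - bform F (w k) y" "bform F y (- w k) = - bform F y (w k)" if "y \<in> latN F" for y
      using bf_zscale_left[OF wk(2) that, of "-1"] bf_zscale_right[OF that wk(2), of "-1"]
      by (simp_all add: zscale_minus_left)
    have aN: "w i + zscale z (w k) \<in> latN F" for i z using gN I2 zN by (simp add: subgrp_def)
    note sim = aN bf_add_left bf_add_right bf_zscale_left bf_zscale_right zN mN m1 I2 wk bkk
    show ?thesis
    proof (cases "i = k \<or> j = k")
      case True
      then have "bform F (w' i) (w' j) = - bform F (w i) (w j)"
        by (auto simp: w'E sim)
      then show ?thesis using True I4[OF ij] by (simp add: mutE_def)
    next
      case False
      let ?hj = "max 0 (Et j k)" and ?hi = "max 0 (Et i k)"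
      have b: "bform F (w' i) (w' j) = bform F (w i) (w j) + of_int ?hj * bform F (w i) (w k) + of_int ?hi * bform F (w k) (w j)"
        using False by (simp add: w'E sim del: of_int_max)
      have "int (dn j * rd j) * Et j k = int (dn k * rd k) * (- Et k j)"
      proof -
        have "of_int (int (dn j * rd j) * Et j k) = (of_int (int (dn k * rd k) * (- Et k j)) :: rat)"
          using I4[of j k] I4[of k j] k bf_skew[OF I2 wk(2), of j] by simp
        then show ?thesis by (simp only: of_int_eq_iff)
      qed
      then have "int (dn j * rd j) * ?hj = int (dn k * rd k) * max 0 (- Et k j)"
        by (simp only: mult_max_0 of_nat_0_le_iff)
      then have "(of_int (int (dn j * rd j) * ?hj) :: rat) = of_int (int (dn k * rd k) * max 0 (- Et k j))"
        by (simp only:)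
      then have hj: "of_int ?hj * (of_nat (dn j) * of_nat (rd j)) = of_nat (dn k) * of_nat (rd k) * (of_int (max 0 (- Et k j)) :: rat)"
        by (simp add: mult_ac del: of_int_max)
      have "bform F (w' i) (w' j) * of_nat (dn j) * of_nat (rd j) =
          bform F (w i) (w j) * of_nat (dn j) * of_nat (rd j) +
          (of_int ?hj * (of_nat (dn j) * of_nat (rd j))) * bform F (w i) (w k) +
          of_int ?hi * (bform F (w k) (w j) * of_nat (dn j) * of_nat (rd j))"
        unfolding b by (simp add: algebra_simps del: of_int_max)
      also have "\<dots> = of_int (Et i j) + of_int (max 0 (- Et k j)) * (bform F (w i) (w k) * of_nat (dn k) * of_nat (rd k)) +
          of_int ?hi * of_int (Et k j)"
        unfolding hj using I4[OF ij] I4[of k j] k by (simp add: mult_ac del: of_int_max)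
      also have "bform F (w i) (w k) * of_nat (dn k) * of_nat (rd k) = of_int (Et i k)"
        using I4[of i k] k by simp
      finally show ?thesis using False by (simp add: mutE_def mult.commute del: of_int_max)
    qed
  qed
  have KK: "bh K K = 0" using bh_skew[OF KN KN] by simp
  have zK: "zscale z K \<in> latN Fh" for z by (rule subgrp_zscale[OF gNh KN])
  have Lam': "Lam (ks @ [k]) E0 n = Lam ks E0 (amap G k n)" for n
    unfolding Lam_snoc[OF exchange_E0] G_def cL_def Et_def ..
  have mK: "- K \<in> latN Fh" using gNh KN unfolding subgrp_def by blast
  have bm: "bh X (- K) = - bh X K" if "X \<in> latN Fh" for X
    using bh_zscale_right[OF that KN, of "-1"] by (simp add: zscale_minus_left del: Fh_simps)
  have sN: "v a + zscale z K \<in> latN Fh" for a z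
    using gNh vN zK unfolding subgrp_def by blast
  have J5: "bh (v' (Inr j)) (v' (Inl l)) * of_nat (dn j) = - of_int (Lam (ks @ [k]) E0 (axis_vec l 1) j)" for j l
  proof (cases "l = k")
    case True
    have "bh (v' (Inr j)) (v' (Inl l)) = - be (Inr j)"
      using True bm[OF sN] bh_add_left[OF vN zK KN] bh_zscale_left[OF KN KN] KK
      by (simp add: v'_eq be_def del: Fh_simps)
    moreover have "Lam (ks @ [k]) E0 (axis_vec l 1) j = - cL j"
    proof -
      have "amap G k (axis_vec k 1) = axis_vec k (- 1)"
        unfolding G_def by (rule amap_axis_self[OF exEt])
      then show ?thesis
        using True additive_int_axis[of "Lam ks E0" k "-1" j, OF Lam_add] by (simp add: Lam' cL_def)
    qed
    ultimately show ?thesis using beK[of j] by simp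
  next
    case False
    have "bh (v' (Inr j)) (v' (Inl l)) = bh (v (Inr j)) (v (Inl l)) + of_int (h (Inl l)) * be (Inr j) +
        of_int (h (Inr j)) * bh K (v (Inl l))"
      using False bh_add_right[OF vN zK sN] bh_add_left[OF vN zK vN] bh_add_left[OF vN zK zK]
        bh_zscale_left[OF KN vN] bh_zscale_right[OF vN KN] bh_zscale_right[OF KN KN] bh_zscale_left[OF KN zK] KK
      by (simp add: v'_eq be_def del: Fh_simps)
    also have "\<dots> = bh (v (Inr j)) (v (Inl l)) + of_int (max 0 (G l k)) * be (Inr j)"
    proof (cases "0 \<le> cL")
      case True
      then show ?thesis by (simp add: hR0 hE G_def del: of_int_max)
    next
      case False
      have "bh K (v (Inl l)) = - be (Inl l)" using bh_skew[OF KN vN] by (simp add: be_def del: Fh_simps)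
      then have "of_int (h (Inr j)) * bh K (v (Inl l)) = - be (Inr j) * of_int (Et l k)"
        using hR1[OF False, of j] I4[of l k] k by (simp add: beL mult_ac del: Fh_simps)
      moreover have "max 0 (Et l k) - Et l k = max 0 (G l k)" using False by (auto simp: G_def nege_def max_def)
      then have "of_int (max 0 (Et l k)) - of_int (Et l k) = (of_int (max 0 (G l k)) :: rat)" by (metis of_int_diff)
      ultimately show ?thesis by (simp add: hE algebra_simps del: of_int_max Fh_simps)
    qed
    finally have "bh (v' (Inr j)) (v' (Inl l)) * of_nat (dn j) =
       - of_int (Lam ks E0 (axis_vec l 1) j) - of_int (max 0 (G l k)) * of_int (cL j)"
      using I5[of j l] beK[of j] by (simp add: distrib_right mult.assoc del: of_int_max Fh_simps)
    moreover have "Lam (ks @ [k]) E0 (axis_vec l 1) j = Lam ks E0 (axis_vec l 1) j + max 0 (G l k) * cL j"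
    proof -
      have "exchange G D0" using exEt exchange_nege[OF exEt] by (simp add: G_def)
      then have "amap G k (axis_vec l 1) = axis_vec l 1 + axis_vec k (max 0 (G l k))"
        using exchange.amap_axis False by metis
      then show ?thesis
        using additive_int_axis[of "Lam ks E0" k "max 0 (G l k)" j, OF Lam_add] by (simp add: Lam' Lam_add cL_def)
    qed
    ultimately show ?thesis by (simp del: of_int_max)
  qed
  have J6: "inj (zcomb v')"
    by (rule inj_zcomb_kmap[where v = v and k = "Inl k" and h = h, OF _ I6]) (simp add: v'_eq K_def)
  have comb: "zcomb v' (kmap h (Inl k) y) = zcomb v y" for y
    by (rule zcomb_kmap) (simp add: v'_eq K_def)
  have J7: "zcomb v' (Xv i (ks @ [k])) = xi i" for i
  proof -
    let ?X = "\<lambda>l. Xv i ks (Inl l)"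
    have "(\<Sum>a\<in>UNIV - {Inl k}. h a * Xv i ks a) = colpos G k ?X"
    proof -
      have "(\<Sum>a\<in>UNIV. h a * Xv i ks a) = h (Inl k) * Xv i ks (Inl k) + (\<Sum>a\<in>UNIV - {Inl k}. h a * Xv i ks a)"
        by (rule sum.remove) auto
      moreover have "h (Inl k) = 0" by (simp add: hE)
      ultimately have "(\<Sum>a\<in>UNIV - {Inl k}. h a * Xv i ks a) = (\<Sum>a\<in>UNIV. h a * Xv i ks a)" by simp
      also have "\<dots> = colpos Et k ?X + (\<Sum>j\<in>UNIV. h (Inr j) * Xv i ks (Inr j))"
        by (simp add: sum_UNIV_sum colpos_def hE mult.commute)
      also have "\<dots> = colpos G k ?X"
      proof (cases "0 \<le> cL")
        case True
        then show ?thesis by (simp add: hR0 G_def)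
      next
        case False
        have "(\<Sum>a\<in>UNIV. of_int (Xv i ks a) * be a) = 0"
        proof -
          have "bh (zcomb v (Xv i ks)) K = (\<Sum>a\<in>UNIV. of_int (Xv i ks a) * be a)"
            unfolding be_def by (rule bh_zcomb_left[OF vN KN])
          then show ?thesis using bh_xi[OF wk(1), of i] by (simp add: I7 Kw del: Fh_simps)
        qed
        then have z: "(\<Sum>j\<in>UNIV. of_int (Xv i ks (Inr j)) * be (Inr j)) = - (\<Sum>l\<in>UNIV. of_int (?X l) * be (Inl l))"
          by (simp add: sum_UNIV_sum add_eq_0_iff)
        have "of_int (\<Sum>j\<in>UNIV. h (Inr j) * Xv i ks (Inr j)) =
            of_nat (rd k) * of_nat (dn k) * (\<Sum>j\<in>UNIV. of_int (Xv i ks (Inr j)) * be (Inr j))"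
          by (simp add: hR1[OF False] sum_distrib_left mult_ac)
        also have "\<dots> = - (\<Sum>l\<in>UNIV. of_int (?X l) * (be (Inl l) * of_nat (dn k) * of_nat (rd k)))"
          unfolding z by (simp add: sum_distrib_left mult_ac)
        also have "\<dots> = of_int (- colsum Et k ?X)"
          using I4[of _ k] k by (simp add: beL colsum_def)
        finally have "(\<Sum>j\<in>UNIV. h (Inr j) * Xv i ks (Inr j)) = - colsum Et k ?X" by (simp only: of_int_eq_iff)
        then show ?thesis using False colpos_nege[of Et k ?X] by (simp add: G_def)
      qed
      finally show ?thesis .
    qed
    then have km: "kmap h (Inl k) (Xv i ks) (Inl l) = amap G k ?X l" for l
      by (simp add: kmap_def amap_apply)
    have "Xv i (ks @ [k]) = kmap h (Inl k) (Xv i ks)"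
    proof
      fix a show "Xv i (ks @ [k]) a = kmap h (Inl k) (Xv i ks) a"
      proof (cases a)
        case (Inl l)
        have X: "?X = (\<lambda>l. int (dn i) * Gam ks E0 (axis_vec i 1) l)" by (simp add: Xv_def)
        have "Gam (ks @ [k]) E0 (axis_vec i 1) = amap G k (Gam ks E0 (axis_vec i 1))"
          unfolding Gam_snoc[OF exchange_E0] G_def cL_def Et_def ..
        then have "Xv i (ks @ [k]) a = amap G k ?X l" unfolding X amap_scale using Inl by (simp add: Xv_def)
        then show ?thesis using km[of l] Inl by simp
      next
        case (Inr j)
        then show ?thesis by (simp add: kmap_def Xv_def)
      qed
    qed
    then show ?thesis using comb[of "Xv i ks"] I7 by simp
  qed
  have J8: "\<exists>Y. zcomb v' Y = zscale (int (dnum Fh a)) (vec (principal_seed F s) a) \<and>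
        (\<forall>b. int (dnum Fh b) dvd Y b)" for a
  proof -
    obtain Y where Y: "zcomb v Y = zscale (int (dnum Fh a)) (vec (principal_seed F s) a)"
      "\<And>b. int (dnum Fh b) dvd Y b" using I8 by blast
    have "int (dn k) dvd h b * Y b" for b
    proof -
      obtain q where q: "Y b = int (dnum Fh b) * q" using Y(2)[of b] by (auto elim: dvdE)
      have "h b * Y b = (int (dnum Fh b) * h b) * q" unfolding q by simp
      then show ?thesis using dvd_mult2[OF hz[of b], of q] by (simp only:)
    qed
    then have "int (dnum Fh b) dvd kmap h (Inl k) Y b" for b
      using Y(2)[of b] Y(2)[of "Inl k"] by (auto simp: kmap_def intro!: dvd_diff dvd_sum)
    then show ?thesis using Y(1) comb[of Y] by metis
  qed
  have "fold mutE (ks @ [k]) E0 = mutE k Et" by (simp add: Et_def)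
  then show ?thesis
    unfolding principal_inv_def v'_def[symmetric] w'_def[symmetric]
    using J1 J2 J2u J2o J3 J4 J5 J6 J7 J8 by simp
qed

lemma principal_inv: "set ks \<subseteq> Iuf F \<Longrightarrow> principal_inv ks"
  by (induction ks rule: rev_induct) (auto intro: principal_inv_Nil principal_inv_step)

end

subsection \<open>Torus weights\<close>

definition coeffs_in :: "'c set \<Rightarrow> ('m \<Rightarrow>\<^sub>0 'c::zero) set" where
  "coeffs_in N = {f. \<forall>x. Poly_Mapping.lookup f x \<in> N}"

lemma Sum_any_closed:
  assumes "0 \<in> N" "\<And>a b. a \<in> N \<Longrightarrow> b \<in> N \<Longrightarrow> a + b \<in> N" "\<And>x. f x \<in> N"
  shows "Sum_any f \<in> N"
proof -
  have "sum f A \<in> N" for A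
    by (induction A rule: infinite_finite_induct) (auto simp: assms)
  then show ?thesis by (simp add: Sum_any.expand_set)
qed

lemma coeffs_in_add:
  assumes "\<And>a b. a \<in> N \<Longrightarrow> b \<in> N \<Longrightarrow> a + b \<in> N" "f \<in> coeffs_in N" "g \<in> coeffs_in N"
  shows "f + g \<in> coeffs_in N"
  using assms by (auto simp: coeffs_in_def lookup_add)

lemma coeffs_in_mult:
  fixes f g :: "'m::monoid_add \<Rightarrow>\<^sub>0 'c::semiring_0"
  assumes N: "0 \<in> N" "\<And>a b. a \<in> N \<Longrightarrow> b \<in> N \<Longrightarrow> a + b \<in> N" "\<And>a b. a \<in> N \<Longrightarrow> b \<in> N \<Longrightarrow> a * b \<in> N"
    and "f \<in> coeffs_in N" "g \<in> coeffs_in N"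
  shows "f * g \<in> coeffs_in N"
  unfolding coeffs_in_def times_poly_mapping.rep_eq prod_fun_def mem_Collect_eq
  using assms(4,5)
  by (intro allI Sum_any_closed N) (auto simp: coeffs_in_def when_def N)

text \<open>
  Positivity: quotients of nonzero Laurent polynomials with natural coefficients never cancel in
  a sum, so the mutation factors do not vanish.
\<close>

definition natpoly :: "('e \<Rightarrow>\<^sub>0 ('m \<Rightarrow>\<^sub>0 'k::semiring_1)) set" where
  "natpoly = coeffs_in (coeffs_in \<nat>)"

lemma natcoeff_closed:
  fixes a b :: "'m::monoid_add \<Rightarrow>\<^sub>0 'k::semiring_1"
  shows "a \<in> coeffs_in \<nat> \<Longrightarrow> b \<in> coeffs_in \<nat> \<Longrightarrow> a + b \<in> coeffs_in \<nat>"
    "a \<in> coeffs_in \<nat> \<Longrightarrow> b \<in> coeffs_in \<nat> \<Longrightarrow> a * b \<in> coeffs_in \<nat>" "(0 :: 'm \<Rightarrow>\<^sub>0 'k) \<in> coeffs_in \<nat>"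
  by (auto intro: coeffs_in_add coeffs_in_mult) (simp add: coeffs_in_def)

lemma natpoly_add: "P \<in> natpoly \<Longrightarrow> Q \<in> natpoly \<Longrightarrow> P + Q \<in> (natpoly :: ('e \<Rightarrow>\<^sub>0 ('m::monoid_add \<Rightarrow>\<^sub>0 'k::semiring_1)) set)"
  unfolding natpoly_def by (rule coeffs_in_add[OF natcoeff_closed(1)])

lemma natpoly_mult: "P \<in> natpoly \<Longrightarrow> Q \<in> natpoly \<Longrightarrow> P * Q \<in> (natpoly :: ('e::monoid_add \<Rightarrow>\<^sub>0 ('m::monoid_add \<Rightarrow>\<^sub>0 'k::semiring_1)) set)"
  unfolding natpoly_def by (rule coeffs_in_mult[OF natcoeff_closed(3,1,2)])

text \<open>A nonzero coefficient of \<open>P\<close> is a positive natural number, and in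
  characteristic zero it stays nonzero after adding a natural number.\<close>

lemma natpoly_add_neq_0:
  fixes P Q :: "'e \<Rightarrow>\<^sub>0 ('m::monoid_add \<Rightarrow>\<^sub>0 'k::field_char_0)"
  assumes "P \<in> natpoly" "Q \<in> natpoly" "P \<noteq> 0"
  shows "P + Q \<noteq> 0"
proof
  assume 0: "P + Q = 0"
  obtain x y where xy: "Poly_Mapping.lookup (Poly_Mapping.lookup P x) y \<noteq> 0"
    using \<open>P \<noteq> 0\<close> by (metis lookup_zero poly_mapping_eqI)
  obtain a b where a: "Poly_Mapping.lookup (Poly_Mapping.lookup P x) y = of_nat a"
    and b: "Poly_Mapping.lookup (Poly_Mapping.lookup Q x) y = of_nat b"
    using assms(1,2) unfolding natpoly_def coeffs_in_def by (blast elim: Nats_cases)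
  have "Poly_Mapping.lookup (Poly_Mapping.lookup (P + Q) x) y = of_nat (a + b)"
    by (simp add: lookup_add a b)
  then have "of_nat (a + b) = (0::'k)" using 0 by simp
  then show False using xy a by (simp only: of_nat_eq_0_iff)
qed

lemma natpoly_single: "c \<in> coeffs_in \<nat> \<Longrightarrow> Poly_Mapping.single x c \<in> natpoly"
  using natcoeff_closed(3) by (auto simp: natpoly_def coeffs_in_def lookup_single when_def)

lemma one_natcoeff: "1 \<in> coeffs_in \<nat>"
  by (auto simp: coeffs_in_def lookup_one when_def)

lemma formal_coef_nat: "formal_coef F i j \<in> coeffs_in \<nat>" "formal_coef F i j \<noteq> (0 :: ('i, 'k::field_char_0) coeff_ring)"
proof -
  show "formal_coef F i j \<in> coeffs_in \<nat>"
    using one_natcoeff by (auto simp: formal_coef_def coeffs_in_def lookup_single when_def)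
  have "Poly_Mapping.single x (1::'k) \<noteq> 0" for x :: "'i \<Rightarrow>\<^sub>0 (nat \<Rightarrow>\<^sub>0 nat)"
    by (metis lookup_single_eq lookup_zero zero_neq_one)
  then show "formal_coef F i j \<noteq> (0 :: ('i, 'k::field_char_0) coeff_ring)"
    by (simp add: formal_coef_def)
qed

section \<open>Weights of positive rational functions\<close>

locale weight =
  fixes wt :: "('j::linorder \<Rightarrow>\<^sub>0 int) \<Rightarrow> 'w::ab_group_add"
  assumes wt_add: "wt (x + y) = wt x + wt y"
begin

lemma wt_0: "wt 0 = 0"
  using wt_add[of 0 0] by simp

lemma homogeneous_mult:
  fixes P Q :: "('j, 'r::idom) laurent"
  assumes "is_homogeneous wt P u" "is_homogeneous wt Q v"
  shows "is_homogeneous wt (P * Q) (u + v)"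
  using assms keys_mult[of P Q] by (auto simp: is_homogeneous_def wt_add)

lemma homogeneous_unique:
  fixes P :: "('j, 'r::idom) laurent"
  assumes "is_homogeneous wt P u" "is_homogeneous wt P v"
  shows "u = v"
proof -
  have "Poly_Mapping.keys P \<noteq> {}" using assms by (simp add: is_homogeneous_def)
  then show ?thesis using assms by (auto simp: is_homogeneous_def)
qed

text \<open>Positivity is carried along because a sum of functions of equal weight might otherwise
  vanish and lose its weight.\<close>

definition pos_weight :: "('j, ('i::linorder, 'k::field_char_0) coeff_ring) ratfun \<Rightarrow> 'w \<Rightarrow> bool" where
  "pos_weight \<phi> w \<longleftrightarrow> (\<exists>P Q u v. is_homogeneous wt P u \<and> is_homogeneous wt Q v \<and> P \<in> natpoly \<and> Q \<in> natpoly \<and>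
     \<phi> = Fract P Q \<and> w = u - v)"

lemma pos_weight_mult:
  fixes \<phi> \<psi> :: "('j, ('i::linorder, 'k::field_char_0) coeff_ring) ratfun"
  assumes "pos_weight \<phi> w" "pos_weight \<psi> z"
  shows "pos_weight (\<phi> * \<psi>) (w + z)"
proof -
  obtain P Q u v where 1: "is_homogeneous wt P u" "is_homogeneous wt Q v" "P \<in> natpoly" "Q \<in> natpoly"
    "\<phi> = Fract P Q" "w = u - v" using assms(1) unfolding pos_weight_def by blast
  obtain P' Q' u' v' where 2: "is_homogeneous wt P' u'" "is_homogeneous wt Q' v'" "P' \<in> natpoly" "Q' \<in> natpoly"
    "\<psi> = Fract P' Q'" "z = u' - v'" using assms(2) unfolding pos_weight_def by blast
  show ?thesis unfolding pos_weight_def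
    using homogeneous_mult[OF 1(1) 2(1)] homogeneous_mult[OF 1(2) 2(2)] natpoly_mult[OF 1(3) 2(3)]
      natpoly_mult[OF 1(4) 2(4)] 1 2
    by (intro exI[of _ "P * P'"] exI[of _ "Q * Q'"] exI[of _ "u + u'"] exI[of _ "v + v'"]) simp
qed

lemma pos_weight_inverse:
  fixes \<phi> :: "('j, ('i::linorder, 'k::field_char_0) coeff_ring) ratfun"
  assumes "pos_weight \<phi> w"
  shows "pos_weight (inverse \<phi>) (- w)"
proof -
  obtain P Q u v where 1: "is_homogeneous wt P u" "is_homogeneous wt Q v" "P \<in> natpoly" "Q \<in> natpoly"
    "\<phi> = Fract P Q" "w = u - v" using assms(1) unfolding pos_weight_def by blast
  then show ?thesis unfolding pos_weight_def
    by (intro exI[of _ Q] exI[of _ P] exI[of _ v] exI[of _ u]) simp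
qed

lemma pos_weight_add:
  fixes \<phi> \<psi> :: "('j, ('i::linorder, 'k::field_char_0) coeff_ring) ratfun"
  assumes "pos_weight \<phi> w" "pos_weight \<psi> w"
  shows "pos_weight (\<phi> + \<psi>) w"
proof -
  obtain P Q u v where 1: "is_homogeneous wt P u" "is_homogeneous wt Q v" "P \<in> natpoly" "Q \<in> natpoly"
    "\<phi> = Fract P Q" "w = u - v" using assms(1) unfolding pos_weight_def by blast
  obtain P' Q' u' v' where 2: "is_homogeneous wt P' u'" "is_homogeneous wt Q' v'" "P' \<in> natpoly" "Q' \<in> natpoly"
    "\<psi> = Fract P' Q'" "w = u' - v'" using assms(2) unfolding pos_weight_def by blast
  have ne: "Q \<noteq> 0" "Q' \<noteq> 0" using 1 2 by (auto simp: is_homogeneous_def)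
  have h1: "is_homogeneous wt (P * Q') (u + v')" using 1 2 by (intro homogeneous_mult)
  have "is_homogeneous wt (P' * Q) (u' + v)" using 1 2 by (intro homogeneous_mult)
  moreover have "u' + v = u + v'" using 1(6) 2(6) by (simp add: algebra_simps)
  ultimately have h2: "is_homogeneous wt (P' * Q) (u + v')" by simp
  have nat: "P * Q' \<in> natpoly" "P' * Q \<in> natpoly" using natpoly_mult 1 2 by blast+
  have "P * Q' + P' * Q \<noteq> 0"
    using natpoly_add_neq_0[OF nat] h1 by (simp add: is_homogeneous_def)
  then have "is_homogeneous wt (P * Q' + P' * Q) (u + v')"
    using h1 h2 keys_add[of "P * Q'" "P' * Q"] by (auto simp: is_homogeneous_def)
  moreover have "is_homogeneous wt (Q * Q') (v + v')" using 1 2 by (intro homogeneous_mult)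
  moreover have "P * Q' + P' * Q \<in> natpoly" "Q * Q' \<in> natpoly"
    using natpoly_add[OF nat] natpoly_mult 1 2 by blast+
  moreover have "\<phi> + \<psi> = Fract (P * Q' + P' * Q) (Q * Q')" using 1 2 ne by simp
  ultimately show ?thesis unfolding pos_weight_def using 1(6)
    by (intro exI[of _ "P * Q' + P' * Q"] exI[of _ "Q * Q'"] exI[of _ "u + v'"] exI[of _ "v + v'"]) simp
qed

lemma pos_weight_single:
  assumes "c \<in> coeffs_in \<nat>" "c \<noteq> 0"
  shows "pos_weight (Fract (Poly_Mapping.single x c) 1 :: ('j, ('i::linorder, 'k::field_char_0) coeff_ring) ratfun) (wt x)"
proof -
  have "(1 :: ('j, ('i, 'k) coeff_ring) laurent) \<in> natpoly"
    using natpoly_single[OF one_natcoeff, of 0] by simp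
  moreover have "is_homogeneous wt (1 :: ('j, ('i, 'k) coeff_ring) laurent) 0"
    by (simp add: is_homogeneous_def wt_0)
  moreover have "is_homogeneous wt (Poly_Mapping.single x c) (wt x)"
    using assms(2) by (auto simp: is_homogeneous_def) (metis lookup_single_eq lookup_zero)
  ultimately show ?thesis unfolding pos_weight_def using natpoly_single[OF assms(1)]
    by (intro exI[of _ "Poly_Mapping.single x c"] exI[of _ 1] exI[of _ "wt x"] exI[of _ 0]) simp
qed

lemma pos_weight_one: "pos_weight (1 :: ('j, ('i::linorder, 'k::field_char_0) coeff_ring) ratfun) 0"
  using pos_weight_single[OF one_natcoeff, of 0] by (simp add: wt_0 One_fract_def)

lemma pos_weight_powi:
  fixes \<phi> :: "('j, ('i::linorder, 'k::field_char_0) coeff_ring) ratfun"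
  assumes "pos_weight \<phi> 0"
  shows "pos_weight (\<phi> powi n) 0"
proof -
  have pow: "pos_weight (\<psi> ^ m) 0" if "pos_weight \<psi> 0" for \<psi> :: "('j, ('i, 'k) coeff_ring) ratfun" and m
  proof (induction m)
    case 0
    then show ?case using pos_weight_one by simp
  next
    case (Suc m)
    then show ?case using pos_weight_mult[OF that Suc] by simp
  qed
  show ?thesis using pow[OF assms] pow[of "inverse \<phi>"] pos_weight_inverse[OF assms] by (simp add: power_int_def)
qed

lemma pos_weight_sum:
  fixes \<phi> :: "nat \<Rightarrow> ('j, ('i::linorder, 'k::field_char_0) coeff_ring) ratfun"
  assumes "\<And>j. pos_weight (\<phi> j) w"
  shows "pos_weight (\<Sum>j\<le>n. \<phi> j) w"
  by (induction n) (simp_all add: assms pos_weight_add)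

end

lemma coef_sh: "coef (fold (mutate G) ks t) = coef t"
  by (induction ks arbitrary: t) (simp_all add: mutate_def)

lemma zscale_sum_right: "zscale z (sum g A) = (\<Sum>a\<in>A. zscale z (g a))"
  by (induction A rule: infinite_finite_induct) (simp_all add: zscale_add_right)

lemma zcomb_scale: "zcomb v (\<lambda>a. z * Y a) = zscale z (zcomb v Y)"
  by (simp add: zcomb_def zscale_zscale zscale_sum_right)

lemma zcomb_sum: "zcomb v (\<lambda>a. \<Sum>j\<in>A. Y j a) = (\<Sum>j\<in>A. zcomb v (Y j))"
proof (induction A rule: infinite_finite_induct)
  case (insert j A)
  then show ?case using zcomb_add[of v "Y j" "\<lambda>a. \<Sum>j\<in>A. Y j a"] by simp
qed (simp_all add: zcomb_def)

section \<open>Weights of lifted cluster variables\<close>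

context principal_setup
begin

abbreviation "P0 \<equiv> principal_seed F s"
abbreviation "bz a \<equiv> zscale (int (dnum Fh a)) (vec P0 a)"

text \<open>The vectors \<open>bz a\<close> are the ones at which \<open>pairing\<close> evaluates a
  functional; integrality there makes its floor exact.\<close>

definition Mint :: "('n \<times> ('n \<Rightarrow> rat) \<Rightarrow> rat) set" where
  "Mint = {m. \<forall>a. m (bz a) \<in> \<int>}"

definition wtm :: "('n \<times> ('n \<Rightarrow> rat) \<Rightarrow> rat) \<Rightarrow> 'i \<Rightarrow> int" where
  "wtm m = monom_weight F p s (Abs_poly_mapping (pairing Fh P0 m))"

lemma wtm_eq:
  assumes "m \<in> Mint"
  shows "of_int (wtm m i) = m (bz (Inl i)) - (\<Sum>j\<in>UNIV. m (bz (Inr j)) * of_int (p_pair i j))"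
proof -
  have "of_int (pairing Fh P0 m a) = m (bz a)" for a
    using assms by (simp add: pairing_def Mint_def of_int_floor_cancel)
  then show ?thesis
    unfolding wtm_def monom_weight_def p_pair_def[symmetric] by simp
qed

lemma seed_f_sh:
  assumes "principal_inv ks" "x \<in> latN Fh" "x = zcomb (vec (sh ks)) Y"
  shows "seed_f Fh (sh ks) (Inl l) x = of_int (Y (Inl l)) / of_nat (dn l)"
proof -
  have "inj (zcomb (vec (sh ks)))" using assms(1) by (simp add: principal_inv_def)
  then have "inv (zcomb (vec (sh ks))) x = Y" using assms(3) by simp
  then show ?thesis using assms(2) by (simp add: seed_f_def)
qed

lemma bzN: "bz a \<in> latN Fh"
  by (rule subgrp_zscale[OF gNh pvec_Nh])

text \<open>The \<open>i\<close>-th weight coordinate is evaluation at \<open>xi i\<close>, while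
  \<open>m\<close> extracts the coordinate at \<open>Inl l\<close> in the mutated basis and divides
  by \<open>d_l\<close>. Up to the factor \<open>d_i / d_l\<close> this is an entry of
  \<open>Gam\<close>.\<close>

lemma final_weight:
  fixes l i :: 'i
  assumes I: "principal_inv ks"
  defines "m \<equiv> seed_f Fh (sh ks) (Inl l)"
  shows "m \<in> Mint" "of_int (wtm m i) = of_int (int (dn i) * Gam ks E0 (axis_vec i 1) l) / (of_nat (dn l) :: rat)"
proof -
  have "\<exists>Y. zcomb (vec (sh ks)) Y = bz a \<and> (\<forall>b. int (dnum Fh b) dvd Y b)" for a
    using I unfolding principal_inv_def by blast
  then obtain Y where Y: "\<And>a. zcomb (vec (sh ks)) (Y a) = bz a" "\<And>a b. int (dnum Fh b) dvd Y a b"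
    by metis
  have mz: "m (bz a) = of_int (Y a (Inl l)) / of_nat (dn l)" for a
    unfolding m_def using seed_f_sh[OF I bzN] Y(1)[of a] by metis
  have "m (bz a) \<in> \<int>" for a
  proof -
    obtain q where "Y a (Inl l) = int (dn l) * q" using Y(2)[of "Inl l" a] by (auto elim: dvdE)
    then show ?thesis using d_pos[of l] by (simp add: mz)
  qed
  then show M: "m \<in> Mint" by (simp add: Mint_def)
  \<comment> \<open>The coordinates of \<open>xi i\<close> assembled from those of the vectors
    \<open>bz a\<close>; linear independence identifies them with \<open>Xv i ks\<close>.\<close>
  let ?Z = "\<lambda>b. Y (Inl i) b + (\<Sum>j\<in>UNIV. - p_pair i j * Y (Inr j) b)"
  have "zcomb (vec (sh ks)) ?Z = bz (Inl i) + (\<Sum>j\<in>UNIV. zscale (- p_pair i j) (bz (Inr j)))"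
    by (simp only: zcomb_add zcomb_sum zcomb_scale Y)
  also have "\<dots> = xi i"
  proof -
    have "(\<Sum>l\<in>UNIV. zscale (Xv i [] (Inl l)) (vec P0 (Inl l))) = (\<Sum>l\<in>UNIV. if l = i then bz (Inl i) else 0)"
      by (rule sum.cong) (auto simp: Xv_def axis_vec_apply)
    moreover have "(\<Sum>j\<in>UNIV. zscale (Xv i [] (Inr j)) (vec P0 (Inr j))) = (\<Sum>j\<in>UNIV. zscale (- p_pair i j) (bz (Inr j)))"
      by (rule sum.cong) (simp_all add: Xv_def zscale_zscale)
    ultimately show ?thesis unfolding xi_def zcomb_def sum_UNIV_sum by simp
  qed
  also have "\<dots> = zcomb (vec (sh ks)) (Xv i ks)" using I unfolding principal_inv_def by metis
  finally have "?Z = Xv i ks" using I unfolding principal_inv_def inj_def by blast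
  then have X: "?Z (Inl l) = Xv i ks (Inl l)" by (rule fun_cong)
  have "of_int (wtm m i) = m (bz (Inl i)) - (\<Sum>j\<in>UNIV. m (bz (Inr j)) * of_int (p_pair i j))"
    by (rule wtm_eq[OF M])
  also have "\<dots> = of_int (?Z (Inl l)) / of_nat (dn l)"
    unfolding mz by (simp add: sum_divide_distrib add_divide_distrib sum_negf mult.commute diff_divide_distrib)
  also have "\<dots> = of_int (int (dn i) * Gam ks E0 (axis_vec i 1) l) / of_nat (dn l)"
    unfolding X by (simp add: Xv_def)
  finally show "of_int (wtm m i) = of_int (int (dn i) * Gam ks E0 (axis_vec i 1) l) / (of_nat (dn l) :: rat)" .
qed

lemma p1_star_weight:
  fixes c :: nat
  assumes u: "u \<in> latNuf F"
  defines "m \<equiv> \<lambda>x. of_nat c * p1_star Fh (u, 0) x"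
  shows "m \<in> Mint" "wtm m = 0"
proof -
  have uN: "u \<in> latN F" using UN[OF u] .
  have L: "m (bz (Inl i)) = of_nat c * bform F u (zscale (int (dn i)) (vec s i))" for i
    using bzN[of "Inl i"] by (simp add: m_def p1_star_def zscale_Pair)
  have R: "m (bz (Inr j)) = of_nat c * of_int (crd u j)" for j
  proof -
    have "bform F u 0 = 0" using bf_skew[OF uN zero_in(1)] bf_zero_left[OF uN] by simp
    then show ?thesis
      using bzN[of "Inr j"] d_pos[of j] by (simp add: m_def p1_star_def zscale_Pair zscale_fun_rat ff_eq[OF uN])
  qed
  have "m (bz a) \<in> \<int>" for a
    using bf_int1[OF u zscale_vec_No] unfolding L R
    by (cases a) (simp_all only: L R Ints_mult Ints_of_nat Ints_of_int)
  then show M: "m \<in> Mint" by (simp add: Mint_def)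
  have "of_int (wtm m i) = (0::rat)" for i
  proof -
    have "of_int (wtm m i) = of_nat c * (bform F u (zscale (int (dn i)) (vec s i)) -
       (\<Sum>j\<in>UNIV. of_int (crd u j) * of_int (p_pair i j)))"
      unfolding wtm_eq[OF M] L R by (simp add: right_diff_distrib sum_distrib_left mult.assoc)
    also have "\<dots> = 0" by (simp add: p_pair_sum[OF u] bf_zscale_right[OF uN vecN])
    finally show ?thesis .
  qed
  then show "wtm m = 0" by (auto simp: fun_eq_iff)
qed

lemma monom_weight_add: "monom_weight F p s (x + y) = monom_weight F p s x + monom_weight F p s y"
  by (auto simp: fun_eq_iff monom_weight_def lookup_add distrib_right sum.distrib)

end

text \<open>All monomials of a mutation factor have weight 0 and nonzero natural coefficients, so
  gluing preserves weight and positivity. The statement allows an arbitrary initial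
  \<open>chi\<close> and mutations \<open>ks1\<close> already performed so that the induction can
  pass to the next chart.\<close>

lemma chart_pos_weight:
  fixes F :: "('n::ab_group_add, 'i::{finite,linorder}) gen_fixed_data"
    and s :: "('n, 'i, ('i, 'k::field_char_0) coeff_ring) torus_seed"
  assumes "principal_setup F p s" and cf: "coef s = formal_coef F"
    and "set (ks1 @ ks2) \<subseteq> Iuf F"
    and chi: "\<And>m. m \<in> principal_setup.Mint F s \<Longrightarrow> weight.pos_weight (monom_weight F p s) (chi m) (principal_setup.wtm F p s m)"
    and m: "m \<in> principal_setup.Mint F s"
  shows "weight.pos_weight (monom_weight F p s)
     (chart (principal_data F) (map Inl ks2)
       (fold (mutate (principal_data F)) (map Inl ks1) (principal_seed F s)) chi m) (principal_setup.wtm F p s m)"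
  using assms(3) chi m
proof (induction ks2 arbitrary: ks1 chi m)
  case Nil
  then show ?case by simp
next
  case (Cons k ks2)
  interpret principal_setup F p s by fact
  interpret W: weight "monom_weight F p s"
    by standard (rule monom_weight_add)
  have I: "principal_inv ks1" using principal_inv[of ks1] Cons.prems(1) by simp
  let ?chi = "glue Fh (sh ks1) (Inl k) chi"
  have k: "k \<in> Iuf F" using Cons.prems(1) by simp
  have vk: "vec (sh ks1) (Inl k) = (vec (st ks1) k, 0)" "vec (st ks1) k \<in> latNuf F"
    using I k by (auto simp: principal_inv_def)
  have "W.pos_weight (?chi m) (wtm m)" if m: "m \<in> Mint" for m
  proof -
    have "W.pos_weight (rconst (coef (sh ks1) (Inl k) j) * chi (\<lambda>x. of_nat j * p1_star Fh (vec (sh ks1) (Inl k)) x)) 0" for j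
    proof -
      have "coef (sh ks1) (Inl k) j = formal_coef F k j"
        by (simp add: coef_sh principal_seed_def cf)
      then have "W.pos_weight (rconst (coef (sh ks1) (Inl k) j) :: ('i + 'i, ('i, 'k) coeff_ring) ratfun) 0"
        using W.pos_weight_single[OF formal_coef_nat, of 0 F k j] by (simp add: rconst_def W.wt_0)
      moreover have "W.pos_weight (chi (\<lambda>x. of_nat j * p1_star Fh (vec (sh ks1) (Inl k)) x)) 0"
        using Cons.prems(2)[OF p1_star_weight(1)[OF vk(2), of j]]
        unfolding vk(1) p1_star_weight(2)[OF vk(2), of j] .
      ultimately show ?thesis using W.pos_weight_mult by fastforce
    qed
    then have "W.pos_weight (\<Sum>j\<le>rdeg Fh (Inl k). rconst (coef (sh ks1) (Inl k) j) *
       chi (\<lambda>x. of_nat j * p1_star Fh (vec (sh ks1) (Inl k)) x)) 0"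
      by (rule W.pos_weight_sum)
    then show ?thesis
      unfolding glue_def using W.pos_weight_mult[OF Cons.prems(2)[OF m] W.pos_weight_powi] by fastforce
  qed
  then have "W.pos_weight (chart Fh (map Inl ks2) (sh (ks1 @ [k])) ?chi m) (wtm m)"
    using Cons.prems(1,3) by (intro Cons.IH) auto
  then show ?case by simp
qed

theorem theorem4p15:
  fixes F :: "('n::ab_group_add, 'i::{finite,linorder}) gen_fixed_data"
    and p :: "'n \<Rightarrow> ('n \<Rightarrow> rat)"
    and s :: "('n, 'i, ('i, 'k::field_char_0) coeff_ring) torus_seed"
    and ks :: "'i list"
  assumes "is_gen_fixed_data F"
    and "injectivity_assumption F"
    and "is_p_star F p"
    and "is_torus_seed F s"
    and "set ks \<subseteq> Iuf F"
  shows "\<forall>i. (\<forall>l. 0 \<le> g_vector F p s ks l i) \<or> (\<forall>l. g_vector F p s ks l i \<le> 0)"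
proof -
  interpret principal_setup F p s
    using assms by unfold_locales (auto simp: is_torus_seed_def)
  interpret W: weight "monom_weight F p s"
    by standard (rule monom_weight_add)
  have cf: "coef s = formal_coef F" using assms(4) by (simp add: is_torus_seed_def)
  have I: "principal_inv ks" using principal_inv[OF assms(5)] .
  have g: "of_int (g_vector F p s ks l i) = of_int (int (dn i) * Gam ks E0 (axis_vec i 1) l) / (of_nat (dn l) :: rat)" for l i
  proof -
    let ?m = "seed_f Fh (sh ks) (Inl l)" and ?phi = "lifted_cluster_variable F s ks l"
    have "W.pos_weight (zmonom Fh P0 m :: ('i + 'i, ('i, 'k) coeff_ring) ratfun) (wtm m)" for m
      unfolding zmonom_def wtm_def using W.pos_weight_single[OF one_natcoeff] by simp
    then have "W.pos_weight (chart Fh (map Inl ks) (sh []) (zmonom Fh P0) ?m :: ('i + 'i, ('i, 'k) coeff_ring) ratfun) (wtm ?m)"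
      using chart_pos_weight[OF principal_setup_axioms cf, of "[]" ks "zmonom Fh P0" ?m] final_weight(1)[OF I] assms(5) by simp
    then have ph: "W.pos_weight ?phi (wtm ?m)"
      by (simp add: lifted_cluster_variable_def cluster_variable_def)
    have "g_vector F p s ks l = wtm ?m"
      unfolding g_vector_def
    proof (rule the_equality)
      show "has_torus_weight F p s ?phi (wtm ?m)"
        using ph unfolding W.pos_weight_def has_torus_weight_def by blast
    next
      fix w assume "has_torus_weight F p s ?phi w"
      then obtain P Q u v where 1: "is_homogeneous (monom_weight F p s) P u" "is_homogeneous (monom_weight F p s) Q v"
        "?phi = Fract P Q" "w = u - v" unfolding has_torus_weight_def by blast
      obtain P' Q' u' v' where 2: "is_homogeneous (monom_weight F p s) P' u'" "is_homogeneous (monom_weight F p s) Q' v'"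
        "?phi = Fract P' Q'" "wtm ?m = u' - v'" using ph unfolding W.pos_weight_def by blast
      have "Q \<noteq> 0" "Q' \<noteq> 0" using 1 2 by (auto simp: is_homogeneous_def)
      \<comment> \<open>Cross multiplication compares two representations of the same function, and
        a nonzero homogeneous element has only one weight.\<close>
      then have "P * Q' = P' * Q" using 1(3) 2(3) by (metis eq_fract(1))
      then have "u + v' = u' + v"
        using W.homogeneous_mult[OF 1(1) 2(2)] W.homogeneous_mult[OF 2(1) 1(2)] W.homogeneous_unique by metis
      then show "w = wtm ?m" unfolding 1(4) 2(4) by (simp add: algebra_simps)
    qed
    then show ?thesis using final_weight(2)[OF I] by simp
  qed
  show ?thesis
  proof
    fix i
    have "0 \<le> Gam ks E0 (axis_vec i 1) \<or> Gam ks E0 (axis_vec i 1) \<le> 0"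
      by (rule Gam_sign_coherent[OF exchange_E0])
    then show "(\<forall>l. 0 \<le> g_vector F p s ks l i) \<or> (\<forall>l. g_vector F p s ks l i \<le> 0)"
    proof
      assume "0 \<le> Gam ks E0 (axis_vec i 1)"
      then have "0 \<le> (of_int (g_vector F p s ks l i) :: rat)" for l
        unfolding g by (simp add: le_fun_def)
      then show ?thesis by simp
    next
      assume "Gam ks E0 (axis_vec i 1) \<le> 0"
      then have "(of_int (g_vector F p s ks l i) :: rat) \<le> 0" for l
        unfolding g by (simp add: le_fun_def divide_le_0_iff mult_le_0_iff)
      then show ?thesis by simp
    qed
  qed
qed

end
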